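(* Let $\phi$ be an $f$-wavelet and $\psi$ the corresponding $m$-wavelet, both continuous. Let $\mathbf X(t)$, $t\in\mathbb R$, be a separable Gaussian random process with $\mathbf E\mathbf X(t)=0$ and $\mathbf E|\mathbf X(t)|^2<\infty$ for all $t\in\mathbb R$, whose covariance function $R(t,s)=\mathbf E\mathbf X(t)\overline{\mathbf X(s)}$ is continuous. Let $\gamma\in(0,1)$ and suppose: (i) assumption $S(\gamma)$ holds for $\phi$ and $\psi$ with a function $\Phi$ (so that $S(1)$ holds as well with the same $\Phi$). Moreover there is an even function $c:\mathbb R\to\mathbb R$, non-decreasing on $[0,\infty)$, with $c(0)>0$, such that for some function $A:(0,\infty)\to(0,\infty)$ and some $a_0,x_0\in(0,\infty)$ one has $c(ax)\le c(x)A(a)$ for all $a\ge a_0$, $x\ge x_0$, and such that $$\int_{\mathbb R}c(x)\Phi(|x|)\,dx<\infty,\qquad |R(t,t)|^{1/2}\le c(t)\ \text{ for all } t\in\mathbb R;$$ (ii) for some $\alpha>\frac1{2(1-\gamma)}$ the integrals $\int_{\mathbb R}\ln^{\alpha}(1+|u|)\,|\widehat\psi(u)|\,du$ and $\int_{\mathbb R}\ln^{\alpha}(1+|u|)\,|\widehat\phi(u)|\,du$ converge; (iii) there exist constants $b_0$ and $c_j$, $j\in\mathbb N_0$, such that $\mathbf E|\xi_{0k}|^2\le b_0$ and $\mathbf E|\eta_{jk}|^2\le c_j$ for all $k\in\mathbb Z$, $j\in\mathbb N_0$, and $$\sum_{j=0}^{\infty}\sqrt{c_j}\,2^{j/2}\,j^{\alpha(1-\gamma)}<\infty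 .$$ Then for every $T>0$, $\mathbf X_{n,\mathbf k_n}(t)\to\mathbf X(t)$ uniformly in probability on $[0,T]$, i.e. for every $\varepsilon>0$ $$P\Big\{\sup_{0\le t\le T}|\mathbf X(t)-\mathbf X_{n,\mathbf k_n}(t)|>\varepsilon\Big\}\to0,$$ when $n\to\infty$, $k_0'\to\infty$ and $k_j\to\infty$ for all $j\in\mathbb N_0$.
   Context: Notation: $\mathbb N_0=\{0,1,2,\dots\}$; $\widehat f(y)=\int_{\mathbb R}e^{-iyx}f(x)\,dx$. $f$-wavelet and $m$-wavelet: $\phi\in L_2(\mathbb R)$ is an $f$-wavelet if $\widehat\phi(0)\ne0$, $\widehat\phi$ is continuous at $0$, $\sum_{k\in\mathbb Z}|\widehat\phi(y+2\pi k)|^2=1$ a.e., and there is a $2\pi$-periodic $m_0\in L_2([0,2\pi])$ with $\widehat\phi(y)=m_0(y/2)\widehat\phi(y/2)$ a.e. The corresponding $m$-wavelet $\psi$ is the inverse Fourier transform of $\widehat\psi(y)=\overline{m_0(y/2+\pi)}\,e^{-iy/2}\,\widehat\phi(y/2)$. Set $\phi_{jk}(x)=2^{j/2}\phi(2^jx-k)$, $\psi_{jk}(x)=2^{j/2}\psi(2^jx-k)$, $j,k\in\mathbb Z$. (Then $\{\phi_{0k},\psi_{jk}: j\in\mathbb N_0,k\in\mathbb Z\}$ is an orthonormal basis of $L_2(\mathbb R)$.) Assumption $S(\gamma)$, $\gamma>0$: there is a bounded non-increasing function $\Phi:[0,\infty)\to[0,\infty)$ with $|\phi(x)|\le\Phi(|x|)$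 and $|\psi(x)|\le\Phi(|x|)$ for a.e. $x\in\mathbb R$ and $\int_{\mathbb R}\Phi(|x|)^{\gamma}\,dx<\infty$. Coefficients (integrals in the mean-square sense): $\xi_{0k}=\int_{\mathbb R}\mathbf X(t)\overline{\phi_{0k}(t)}\,dt$, $\eta_{jk}=\int_{\mathbb R}\mathbf X(t)\overline{\psi_{jk}(t)}\,dt$. Approximants: for $\mathbf k_n=(k_0',k_0,\dots,k_{n-1})$, $$\mathbf X_{n,\mathbf k_n}(t)=\sum_{|k|\le k_0'}\xi_{0k}\phi_{0k}(t)+\sum_{j=0}^{n-1}\sum_{|k|\le k_j}\eta_{jk}\psi_{jk}(t).$$ The limit "$n\to\infty$, $k_0'\to\infty$, $k_j\to\infty$ for all $j$" is along any sequence of choices of $(n,\mathbf k_n)$ for which $n\to\infty$, $k_0'\to\infty$, and for each fixed $j\in\mathbb N_0$ the entry $k_j$ tends to infinity. *)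

theory Defs
  imports "HOL-Probability.Probability"
begin

section \<open>Fourier transform and wavelets\<close>

definition square_integrable :: "(real \<Rightarrow> complex) \<Rightarrow> bool" where
  "square_integrable f \<longleftrightarrow>
     f \<in> borel_measurable lborel \<and> integrable lborel (\<lambda>x. (cmod (f x))\<^sup>2)"

definition fourier :: "(real \<Rightarrow> complex) \<Rightarrow> real \<Rightarrow> complex" where
  "fourier f y = (LINT x|lborel. exp (- \<i> * of_real (y * x)) * f x)"

text \<open>For a general square-integrable function the integral above need not exist, and its
  transform is the limit in \<open>L\<^sub>2\<close> of the transforms of its truncations. It is determined only up
  to null sets, hence a relation: \<open>g\<close> is one representative of the transform of \<open>f\<close>. Read from
  right to left, it says that \<open>f\<close> is the inverse Fourier transform of \<open>g\<close>.\<close>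

definition has_L2_fourier :: "(real \<Rightarrow> complex) \<Rightarrow> (real \<Rightarrow> complex) \<Rightarrow> bool" where
  "has_L2_fourier f g \<longleftrightarrow>
     square_integrable f \<and> square_integrable g \<and>
     ((\<lambda>N::real. \<integral>\<^sup>+ y. ennreal ((cmod (g y - fourier (\<lambda>x. indicator {-N..N} x * f x) y))\<^sup>2) \<partial>lborel)
        \<longlongrightarrow> 0) at_top"

definition refinement_mask :: "(real \<Rightarrow> complex) \<Rightarrow> (real \<Rightarrow> complex) \<Rightarrow> bool" where
  "refinement_mask \<phi>h m0 \<longleftrightarrow>
     m0 \<in> borel_measurable borel \<and>
     (\<forall>y. m0 (y + 2 * pi) = m0 y) \<and>
     set_integrable lborel {0..2 * pi} (\<lambda>y. (cmod (m0 y))\<^sup>2) \<and>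
     (AE y in lborel. \<phi>h y = m0 (y / 2) * \<phi>h (y / 2))"

definition f_wavelet :: "(real \<Rightarrow> complex) \<Rightarrow> bool" where
  "f_wavelet \<phi> \<longleftrightarrow>
     (\<exists>\<phi>h. has_L2_fourier \<phi> \<phi>h \<and> \<phi>h 0 \<noteq> 0 \<and> isCont \<phi>h 0 \<and>
        (AE y in lborel. ((\<lambda>k::int. (cmod (\<phi>h (y + 2 * pi * of_int k)))\<^sup>2) has_sum 1) UNIV) \<and>
        (\<exists>m0. refinement_mask \<phi>h m0))"

text \<open>For an f-wavelet, \<open>\<phi>h\<close> and \<open>m0\<close> below are unique up to null sets, so that \<open>\<psi>\<close> is
  determined by \<open>\<phi>\<close> up to a null set.\<close>

definition m_wavelet :: "(real \<Rightarrow> complex) \<Rightarrow> (real \<Rightarrow> complex) \<Rightarrow> bool" where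
  "m_wavelet \<phi> \<psi> \<longleftrightarrow>
     (\<exists>\<phi>h m0. has_L2_fourier \<phi> \<phi>h \<and> refinement_mask \<phi>h m0 \<and>
        has_L2_fourier \<psi> (\<lambda>y. cnj (m0 (y / 2 + pi)) * exp (- \<i> * of_real (y / 2)) * \<phi>h (y / 2)))"

definition dilate :: "(real \<Rightarrow> complex) \<Rightarrow> int \<Rightarrow> int \<Rightarrow> real \<Rightarrow> complex" where
  "dilate f j k x = of_real (2 powr (of_int j / 2)) * f (2 powi j * x - of_int k)"

definition assumption_S ::
    "real \<Rightarrow> (real \<Rightarrow> complex) \<Rightarrow> (real \<Rightarrow> complex) \<Rightarrow> (real \<Rightarrow> real) \<Rightarrow> bool" where
  "assumption_S \<gamma> \<phi> \<psi> \<Phi> \<longleftrightarrow>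
     (\<forall>x\<ge>0. 0 \<le> \<Phi> x) \<and> (\<exists>B. \<forall>x\<ge>0. \<Phi> x \<le> B) \<and> antimono_on {0..} \<Phi> \<and>
     (AE x in lborel. cmod (\<phi> x) \<le> \<Phi> \<bar>x\<bar>) \<and>
     (AE x in lborel. cmod (\<psi> x) \<le> \<Phi> \<bar>x\<bar>) \<and>
     integrable lborel (\<lambda>x. \<Phi> \<bar>x\<bar> powr \<gamma>)"


section \<open>Random processes\<close>

text \<open>A constant counts as a (degenerate) Gaussian random variable.\<close>

definition gaussian_rv :: "'w measure \<Rightarrow> ('w \<Rightarrow> real) \<Rightarrow> bool" where
  "gaussian_rv M Y \<longleftrightarrow>
     Y \<in> borel_measurable M \<and>
     (\<exists>\<mu> \<sigma>. \<sigma> > 0 \<and> distributed M lborel Y (normal_density \<mu> \<sigma>) \<or> (AE \<omega> in M. Y \<omega> = \<mu>))"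

text \<open>A complex-valued process is Gaussian if the real and imaginary parts of its values are jointly
  Gaussian; real-valued and circularly symmetric processes are both covered.\<close>

definition gaussian_process :: "'w measure \<Rightarrow> (real \<Rightarrow> 'w \<Rightarrow> complex) \<Rightarrow> bool" where
  "gaussian_process M X \<longleftrightarrow>
     (\<forall>t. X t \<in> borel_measurable M) \<and>
     (\<forall>F a b. finite F \<longrightarrow>
        gaussian_rv M (\<lambda>\<omega>. \<Sum>t\<in>F. a t * Re (X t \<omega>) + b t * Im (X t \<omega>)))"

text \<open>Separability in the sense of Doob, with respect to the class of closed sets.\<close>

definition separable_process :: "'w measure \<Rightarrow> (real \<Rightarrow> 'w \<Rightarrow> complex) \<Rightarrow> bool" where
  "separable_process M X \<longleftrightarrow>
     (\<exists>S. countable S \<and> closure S = UNIV \<and>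
        (AE \<omega> in M. \<forall>U F. open U \<and> closed F \<and> (\<forall>t\<in>U \<inter> S. X t \<omega> \<in> F) \<longrightarrow> (\<forall>t\<in>U. X t \<omega> \<in> F)))"

definition covariance :: "'w measure \<Rightarrow> (real \<Rightarrow> 'w \<Rightarrow> complex) \<Rightarrow> real \<Rightarrow> real \<Rightarrow> complex" where
  "covariance M X t s = (LINT \<omega>|M. X t \<omega> * cnj (X s \<omega>))"

text \<open>The mean-square integral over a bounded interval is the mean-square limit of Riemann sums as
  the mesh tends to 0; over the real line it is the mean-square limit of the integrals over
  \<open>[a, b]\<close>. Nonnegative integrals are used so that a distance can be infinite, rather than 0 by
  convention, when a difference is not square-integrable.\<close>

definition ms_distance :: "'w measure \<Rightarrow> ('w \<Rightarrow> complex) \<Rightarrow> ('w \<Rightarrow> complex) \<Rightarrow> ennreal" where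
  "ms_distance M Y Z = (\<integral>\<^sup>+ \<omega>. ennreal ((cmod (Y \<omega> - Z \<omega>))\<^sup>2) \<partial>M)"

definition has_ms_integral_on ::
    "'w measure \<Rightarrow> (real \<Rightarrow> 'w \<Rightarrow> complex) \<Rightarrow> real \<Rightarrow> real \<Rightarrow> ('w \<Rightarrow> complex) \<Rightarrow> bool" where
  "has_ms_integral_on M Y a b I \<longleftrightarrow>
     I \<in> borel_measurable M \<and>
     (\<forall>e>0. \<exists>\<delta>>0. \<forall>p. p tagged_division_of {a..b} \<and> (\<lambda>x. ball x \<delta>) fine p \<longrightarrow>
        ms_distance M (\<lambda>\<omega>. \<Sum>(x, K)\<in>p. of_real (measure lborel K) * Y x \<omega>) I < ennreal e)"

definition has_ms_integral ::
    "'w measure \<Rightarrow> (real \<Rightarrow> 'w \<Rightarrow> complex) \<Rightarrow> ('w \<Rightarrow> complex) \<Rightarrow> bool" where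
  "has_ms_integral M Y I \<longleftrightarrow>
     I \<in> borel_measurable M \<and>
     (\<exists>J. (\<forall>a b. a \<le> b \<longrightarrow> has_ms_integral_on M Y a b (J a b)) \<and>
        ((\<lambda>(a, b). ms_distance M (J a b) I) \<longlongrightarrow> 0) (at_bot \<times>\<^sub>F at_top))"

definition approximant ::
    "(real \<Rightarrow> complex) \<Rightarrow> (real \<Rightarrow> complex) \<Rightarrow> (int \<Rightarrow> 'w \<Rightarrow> complex) \<Rightarrow> (nat \<Rightarrow> int \<Rightarrow> 'w \<Rightarrow> complex) \<Rightarrow>
     nat \<Rightarrow> nat \<Rightarrow> (nat \<Rightarrow> nat) \<Rightarrow> real \<Rightarrow> 'w \<Rightarrow> complex" where
  "approximant \<phi> \<psi> \<xi> \<eta> n k0' k t \<omega> =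
     (\<Sum>l | \<bar>l\<bar> \<le> int k0'. \<xi> l \<omega> * dilate \<phi> 0 l t) +
     (\<Sum>j<n. \<Sum>l | \<bar>l\<bar> \<le> int (k j). \<eta> j l \<omega> * dilate \<psi> (int j) l t)"

text \<open>By separability this event differs from a measurable one by a subset of a null set, so it
  is an event of the completed probability space. The supremum is taken in \<^typ>\<open>ereal\<close> because it
  may be infinite.\<close>

definition sup_exceeds ::
    "'w measure \<Rightarrow> real \<Rightarrow> (real \<Rightarrow> 'w \<Rightarrow> complex) \<Rightarrow> (real \<Rightarrow> 'w \<Rightarrow> complex) \<Rightarrow> real \<Rightarrow> 'w set" where
  "sup_exceeds M T X Y \<epsilon> =
     {\<omega> \<in> space M. (SUP t\<in>{0..T}. ereal (cmod (X t \<omega> - Y t \<omega>))) > ereal \<epsilon>}"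

end

theory Submission
  imports Defs
begin

text \<open>
  The sum of the projections onto the first levels is the integral operator with kernel
  \<open>2^n K(2^n t, 2^n s)\<close>, where \<open>K(x, y) = (\<Sum>k. \<phi>(x - k) cnj (\<phi>(y - k)))\<close>; the two-scale identity for
  \<open>K\<close> follows from refinement equations with absolutely summable coefficients, which the periodicity of
  the mask and the orthonormality of the translates of \<open>\<phi>\<close> give in the time domain. By the decay of
  \<open>\<Phi>\<close>, these operators are an approximate identity on continuous functions of growth \<open>c\<close>. Tested
  against bounded random variables, this shows that the series represents \<open>X(t)\<close> for each \<open>t\<close>, once
  it converges.

  For the convergence, at level \<open>j\<close> only about \<open>2^j\<close> of the coefficients matter on a bounded interval, and they
  are Gaussian with variance at most \<open>c\<^sub>j\<close>. The supremum of the level over the interval therefore has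
  expectation of order \<open>\<surd>c\<^sub>j 2^(j/2) \<surd>(j + 1)\<close>, which is summable because \<open>\<alpha> (1 - \<gamma>) > 1/2\<close>. So the
  series almost surely converges uniformly, to a continuous limit; by separability it agrees with \<open>X\<close>
  everywhere on \<open>[0, T]\<close>.
\<close>


section \<open>Sums over the integers\<close>

text \<open>The mask is given only as a square-integrable periodic function, so its Fourier
  coefficients are not known to be absolutely summable, and the rearrangements of double series need
  that. The coefficients \<open>h\<close> are therefore defined as inner products of
  \<open>\<phi>2\<close> with translates of \<open>\<phi>\<close>, where the decay of
  \<open>\<Phi>\<close> gives summability; only afterwards is \<open>m0\<close> identified with
  their symbol. The paths of \<open>X\<close> have no growth bound or continuity known in advance,
  so the kernel operators are not applied to a path but to \<open>F s = E (X s Z)\<close> with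
  \<open>|Z| <= 1\<close>, which is continuous and bounded by \<open>c\<close>. Choosing
  \<open>Z\<close> as the conjugate phase of the difference recovers almost sure equality at each
  fixed time. The mean-square integrals are limits of Riemann sums, for which Gaussianity is
  immediate; what is carried to the limit, by Fatou, is a bound on an exponential square moment, and
  this is enough to control suprema. Sums over the integers are integrals over counting measure
  throughout, so that one dominated Fubini lemma serves sums, integrals and mixtures of
  both.\<close>

abbreviation CI :: "int measure" where "CI \<equiv> count_space UNIV"

lemma sigma_finite_CI: "sigma_finite_measure CI"
  by (rule sigma_finite_measure_count_space_countable) simp

lemma measurable_pair_CI:
  assumes "\<And>k. f k \<in> borel_measurable M"
  shows "(\<lambda>(x, k). f k x) \<in> borel_measurable (M \<Otimes>\<^sub>M CI)"
proof -
  have "(\<lambda>(k, x). f k x) \<in> borel_measurable (CI \<Otimes>\<^sub>M M)"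
    by (rule measurable_pair_measure_countable1) (use assms in auto)
  then show ?thesis
    using measurable_pair_swap_iff[of "\<lambda>(k, x). f k x" CI M borel] by (simp add: case_prod_unfold)
qed

text \<open>A majorant \<open>g\<close> whose inner integrals stay below an integrable
  \<open>h\<close> is all that has to be exhibited; joint integrability comes out as a conclusion.
  With counting measure as one or both factors the same statement exchanges sum with integral and
  sum with sum.\<close>

lemma Fubini_dom:
  fixes f :: "'a \<Rightarrow> 'b \<Rightarrow> 'c::{banach, second_countable_topology}"
  assumes "sigma_finite_measure M" "sigma_finite_measure N"
    and [measurable]: "case_prod f \<in> borel_measurable (M \<Otimes>\<^sub>M N)"
    and bound: "\<And>x y. x \<in> space M \<Longrightarrow> y \<in> space N \<Longrightarrow> norm (f x y) \<le> g x y"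
    and g: "\<And>x. x \<in> space M \<Longrightarrow> integrable N (g x)"
    and gg: "integrable M h" "\<And>x. x \<in> space M \<Longrightarrow> (LINT y|N. g x y) \<le> h x"
  shows "integrable (M \<Otimes>\<^sub>M N) (case_prod f)"
    and "\<And>x. x \<in> space M \<Longrightarrow> integrable N (f x)"
    and "integrable M (\<lambda>x. LINT y|N. f x y)"
    and "AE y in N. integrable M (\<lambda>x. f x y)"
    and "integrable N (\<lambda>y. LINT x|M. f x y)"
    and "(LINT y|N. LINT x|M. f x y) = (LINT x|M. LINT y|N. f x y)"
proof -
  interpret pair_sigma_finite M N using assms(1,2) by (simp add: pair_sigma_finite_def)
  interpret N: sigma_finite_measure N by fact
  show fx: "integrable N (f x)" if "x \<in> space M" for x
    by (rule Bochner_Integration.integrable_bound[OF g[OF that]])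
      (use that bound in \<open>auto intro!: AE_I2 order_trans[OF bound]\<close>)
  show 1: "integrable (M \<Otimes>\<^sub>M N) (case_prod f)"
  proof (rule Fubini_integrable)
    show "integrable M (\<lambda>x. LINT y|N. norm (case (x, y) of (x, y) \<Rightarrow> f x y))"
    proof (rule Bochner_Integration.integrable_bound[OF gg(1)])
      show "AE x in M. norm (LINT y|N. norm (case (x, y) of (x, y) \<Rightarrow> f x y)) \<le> norm (h x)"
      proof (rule AE_I2)
        fix x assume x: "x \<in> space M"
        have "(LINT y|N. norm (f x y)) \<le> (LINT y|N. g x y)"
          by (rule integral_mono) (use x fx g bound in auto)
        with gg(2)[OF x] have "(LINT y|N. norm (f x y)) \<le> h x" by simp
        moreover have "0 \<le> (LINT y|N. norm (f x y))" by simp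
        ultimately show "norm (LINT y|N. norm (case (x, y) of (x, y) \<Rightarrow> f x y)) \<le> norm (h x)" by simp
      qed
    qed measurable
  qed (use fx in auto)
  show "integrable M (\<lambda>x. LINT y|N. f x y)" using integrable_fst[OF 1] .
  show "AE y in N. integrable M (\<lambda>x. f x y)" using AE_integrable_snd[OF 1] .
  show "integrable N (\<lambda>y. LINT x|M. f x y)" using integrable_snd[OF 1] .
  show "(LINT y|N. LINT x|M. f x y) = (LINT x|M. LINT y|N. f x y)" using Fubini_integral[OF 1] .
qed

lemma integral_CI_reindex:
  fixes f :: "int \<Rightarrow> 'a::{banach, second_countable_topology}"
  assumes "bij g"
  shows "(LINT k|CI. f (g k)) = (LINT k|CI. f k)"
  using integral_bij_count_space[OF assms, of f] by simp

lemma integrable_CI_reindex: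
  fixes f :: "int \<Rightarrow> 'a::{banach, second_countable_topology}"
  assumes "bij g"
  shows "integrable CI (\<lambda>k. f (g k)) \<longleftrightarrow> integrable CI f"
  using integrable_bij_count_space[OF assms, of f] by simp

lemma bij_uminus_int [simp]: "bij (uminus :: int \<Rightarrow> int)"
  by (rule bijI) (auto intro!: injI surjI[of _ uminus])

lemma bij_add_int [simp]: "bij (\<lambda>k. k + m :: int)" "bij (\<lambda>k. m + k :: int)" "bij (\<lambda>k. k - m :: int)"
   "bij (\<lambda>k. m - k :: int)"
proof -
  have 1: "bij (\<lambda>k. k + m)" for m :: int
    by (rule o_bij[of "\<lambda>k. k - m"]) auto
  show "bij (\<lambda>k. k + m)" by (rule 1)
  show "bij (\<lambda>k. m + k)" using 1[of m] by (simp add: add.commute)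
  show "bij (\<lambda>k. k - m)" using 1[of "- m"] by simp
  show "bij (\<lambda>k. m - k)" by (rule o_bij[of "\<lambda>k. m - k"]) auto
qed

lemma integral_CI_single:
  fixes f :: "int \<Rightarrow> 'a::{banach, second_countable_topology}"
  assumes "\<And>k. k \<noteq> m \<Longrightarrow> f k = 0"
  shows "(LINT k|CI. f k) = f m" "integrable CI f"
proof -
  have f: "f = (\<lambda>k. indicator {m} k *\<^sub>R f m)"
    using assms by (auto simp: indicator_def fun_eq_iff)
  have "has_bochner_integral CI f (measure CI {m} *\<^sub>R f m)"
    by (subst f, rule has_bochner_integral_indicator) auto
  then show "(LINT k|CI. f k) = f m" "integrable CI f"
    by (auto simp: has_bochner_integral_iff measure_def)
qed

text \<open>Half-open intervals tile the line without overlap. In the periodization lemmas this lets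
  a sum of shifted indicators stand for 1.\<close>

lemma exists_unique_shift:
  fixes a \<tau> x :: real assumes "\<tau> > 0"
  obtains m :: int where "\<And>k. x - \<tau> * of_int k \<in> {a..<a + \<tau>} \<longleftrightarrow> k = m"
proof -
  define m where "m = \<lfloor>(x - a) / \<tau>\<rfloor>"
  have "x - \<tau> * of_int k \<in> {a..<a + \<tau>} \<longleftrightarrow> of_int k \<le> (x - a) / \<tau> \<and> (x - a) / \<tau> < of_int k + 1" for k :: int
    using assms by (auto simp: field_simps)
  then have "x - \<tau> * of_int k \<in> {a..<a + \<tau>} \<longleftrightarrow> k = m" for k :: int
    unfolding m_def using floor_eq_iff[of "(x - a) / \<tau>" k] by auto
  then show ?thesis by (rule that)
qed

text \<open>Unfolding: the factor 1 is written as the sum of the indicators of all translates of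
  \<open>{a..<a+\<tau>}\<close>, Tonelli exchanges sum and integral, and each piece is shifted back
  to the base interval.\<close>

lemma periodize_nn:
  fixes F :: "real \<Rightarrow> ennreal"
  assumes [measurable]: "F \<in> borel_measurable borel" and "\<tau> > 0"
  shows "(\<integral>\<^sup>+x. F x \<partial>lborel) =
    (\<integral>\<^sup>+x. indicator {a..<a+\<tau>} x * (\<integral>\<^sup>+k. F (x + \<tau> * of_int k) \<partial>CI) \<partial>lborel)"
proof -
  interpret P: pair_sigma_finite lborel CI
    by (simp add: pair_sigma_finite_def sigma_finite_CI lborel.sigma_finite_measure_axioms)
  let ?G = "\<lambda>x k. indicator {a..<a+\<tau>} (x - \<tau> * of_int k) * F x"
  have [measurable]: "(\<lambda>(x, k). ?G x k) \<in> borel_measurable (lborel \<Otimes>\<^sub>M CI)"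
    by (rule measurable_pair_CI) simp
  have *: "F x = (\<integral>\<^sup>+k. ?G x k \<partial>CI)" for x
  proof -
    obtain m :: int where m: "\<And>k. x - \<tau> * of_int k \<in> {a..<a + \<tau>} \<longleftrightarrow> k = m"
      using exists_unique_shift[OF \<open>\<tau> > 0\<close>, where a=a and x=x] by metis
    have "(\<integral>\<^sup>+k. ?G x k \<partial>CI) = (\<integral>\<^sup>+k. F x * indicator {m} k \<partial>CI)"
      using m by (intro nn_integral_cong) (auto simp: indicator_def)
    also have "\<dots> = F x" by (subst nn_integral_cmult_indicator) auto
    finally show ?thesis by simp
  qed
  have "(\<integral>\<^sup>+x. F x \<partial>lborel) = (\<integral>\<^sup>+x. \<integral>\<^sup>+k. ?G x k \<partial>CI \<partial>lborel)" using * by simp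
  also have "\<dots> = (\<integral>\<^sup>+k. \<integral>\<^sup>+x. ?G x k \<partial>lborel \<partial>CI)"
    by (rule P.Fubini'[symmetric]) measurable
  also have "\<dots> = (\<integral>\<^sup>+k. \<integral>\<^sup>+x. indicator {a..<a+\<tau>} x * F (x + \<tau> * of_int k) \<partial>lborel \<partial>CI)"
  proof (rule nn_integral_cong)
    fix k :: int
    show "(\<integral>\<^sup>+x. indicator {a..<a+\<tau>} (x - \<tau> * of_int k) * F x \<partial>lborel) = (\<integral>\<^sup>+x. indicator {a..<a+\<tau>} x * F (x + \<tau> * of_int k) \<partial>lborel)"
      by (subst nn_integral_real_affine[where c=1 and t="\<tau> * of_int k"]) (auto simp: algebra_simps)
  qed
  also have "\<dots> = (\<integral>\<^sup>+x. \<integral>\<^sup>+k. indicator {a..<a+\<tau>} x * F (x + \<tau> * of_int k) \<partial>CI \<partial>lborel)"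
    by (rule P.Fubini', rule measurable_pair_CI) simp
  also have "\<dots> = (\<integral>\<^sup>+x. indicator {a..<a+\<tau>} x * (\<integral>\<^sup>+k. F (x + \<tau> * of_int k) \<partial>CI) \<partial>lborel)"
    by (intro nn_integral_cong nn_integral_cmult) simp
  finally show ?thesis .
qed

lemma periodize:
  fixes F :: "real \<Rightarrow> complex"
  assumes F: "integrable lborel F" and "\<tau> > 0"
  shows "(LINT x|lborel. F x) =
    (LINT x|lborel. indicator {a..<a+\<tau>} x * (LINT k|CI. F (x + \<tau> * of_int k)))"
    and "AE x in lborel. x \<in> {a..<a+\<tau>} \<longrightarrow> integrable CI (\<lambda>k. F (x + \<tau> * of_int k))"
proof -
  interpret P: pair_sigma_finite lborel CI
    by (simp add: pair_sigma_finite_def sigma_finite_CI lborel.sigma_finite_measure_axioms)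
  have [measurable]: "F \<in> borel_measurable borel" using F by auto
  let ?G = "\<lambda>x k. indicator {a..<a+\<tau>} (x - \<tau> * of_int k) * F x"
  have [measurable]: "(\<lambda>(x, k). ?G x k) \<in> borel_measurable (lborel \<Otimes>\<^sub>M CI)"
    by (rule measurable_pair_CI) simp
  have *: "(LINT k|CI. ?G x k) = F x" "integrable CI (\<lambda>k. ?G x k)" "(LINT k|CI. norm (?G x k)) = norm (F x)" for x
  proof -
    obtain m :: int where m: "\<And>k. x - \<tau> * of_int k \<in> {a..<a + \<tau>} \<longleftrightarrow> k = m"
      using exists_unique_shift[OF \<open>\<tau> > 0\<close>, where a=a and x=x] by metis
    have 1: "k \<noteq> m \<Longrightarrow> indicator {a..<a+\<tau>} (x - \<tau> * of_int k) * F x = 0" for k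
      using m[of k] by (auto simp: indicator_def)
    have 2: "indicator {a..<a+\<tau>} (x - \<tau> * of_int m) * F x = F x"
      using m[of m] by (auto simp: indicator_def)
    show "(LINT k|CI. ?G x k) = F x" using integral_CI_single(1)[of m "?G x"] 1 2 by auto
    show "integrable CI (\<lambda>k. ?G x k)" using integral_CI_single(2)[of m "?G x"] 1 by auto
    show "(LINT k|CI. norm (?G x k)) = norm (F x)"
      using integral_CI_single(1)[of m "\<lambda>k. norm (?G x k)"] 1 2 by (metis norm_zero)
  qed
  note D = Fubini_dom[where M=lborel and N=CI and f="?G" and g="\<lambda>x k. norm (?G x k)" and h="\<lambda>x. norm (F x)",
      OF lborel.sigma_finite_measure_axioms sigma_finite_CI]
  have sw: "(LINT k|CI. LINT x|lborel. ?G x k) = (LINT x|lborel. LINT k|CI. ?G x k)"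
    by (rule D(6)) (use * F in auto)
  have int: "integrable (lborel \<Otimes>\<^sub>M CI) (\<lambda>(x, k). ?G x k)"
    by (rule D(1)) (use * F in auto)
  let ?H = "\<lambda>x k. indicator {a..<a+\<tau>} x * F (x + \<tau> * of_int k)"
  have meas[measurable]: "(\<lambda>(x, k). ?H x k) \<in> borel_measurable (lborel \<Otimes>\<^sub>M CI)"
    by (rule measurable_pair_CI) simp
  have shift: "(LINT x|lborel. ?G x k) = (LINT x|lborel. ?H x k)" for k
    by (subst lborel_integral_real_affine[where c=1 and t="\<tau> * of_int k"]) (auto simp: algebra_simps)
  \<comment> \<open>By the nonnegative version the norms of the shifted family integrate to the
    integral of \<open>norm (F x)\<close>. This joint integrability drives both the second exchange
    and the almost everywhere claim.\<close>
  have "integrable (lborel \<Otimes>\<^sub>M CI) (\<lambda>(x, k). ?H x k)"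
  proof (subst integrable_iff_bounded, intro conjI meas)
    have "(\<integral>\<^sup>+p. ennreal (norm (case p of (x, k) \<Rightarrow> ?H x k)) \<partial>(lborel \<Otimes>\<^sub>M CI))
       = (\<integral>\<^sup>+x. \<integral>\<^sup>+k. ennreal (norm (?H x k)) \<partial>CI \<partial>lborel)"
      by (subst P.M2.nn_integral_fst[symmetric]) auto
    also have "\<dots> = (\<integral>\<^sup>+x. indicator {a..<a+\<tau>} x * (\<integral>\<^sup>+k. ennreal (norm (F (x + \<tau> * of_int k))) \<partial>CI) \<partial>lborel)"
      by (intro nn_integral_cong) (auto simp: indicator_def)
    also have "\<dots> = (\<integral>\<^sup>+x. ennreal (norm (F x)) \<partial>lborel)"
      by (rule periodize_nn[symmetric]) (use assms in auto)
    also have "\<dots> < \<infinity>" using F by (simp add: integrable_iff_bounded)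
    finally show "(\<integral>\<^sup>+p. ennreal (norm (case p of (x, k) \<Rightarrow> ?H x k)) \<partial>(lborel \<Otimes>\<^sub>M CI)) < \<infinity>" .
  qed
  note H = this
  have "(LINT x|lborel. F x) = (LINT k|CI. LINT x|lborel. ?H x k)"
    using sw unfolding *(1) shift by (rule sym)
  also have "\<dots> = (LINT x|lborel. LINT k|CI. ?H x k)"
    by (rule P.Fubini_integral[OF H])
  finally show "(LINT x|lborel. F x) =
    (LINT x|lborel. indicator {a..<a+\<tau>} x * (LINT k|CI. F (x + \<tau> * of_int k)))"
    by simp
  from P.AE_integrable_fst[OF H]
  show "AE x in lborel. x \<in> {a..<a+\<tau>} \<longrightarrow> integrable CI (\<lambda>k. F (x + \<tau> * of_int k))"
    by eventually_elim (auto simp: indicator_def)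
qed


section \<open>Radial envelopes\<close>

lemma integrable_indicator_Icc [simp]: "integrable lborel (indicator {a..b} :: real \<Rightarrow> real)"
proof (rule integrable_real_indicator)
  show "emeasure lborel {a..b} < \<infinity>" by (cases "a \<le> b") auto
qed simp

locale envelope =
  fixes \<Phi> :: "real \<Rightarrow> real"
  assumes \<Phi>_nonneg: "\<And>x. x \<ge> 0 \<Longrightarrow> 0 \<le> \<Phi> x"
    and \<Phi>_anti: "antimono_on {0..} \<Phi>"
    and \<Phi>_integrable: "integrable lborel (\<lambda>x. \<Phi> \<bar>x\<bar>)"
begin

text \<open>The envelope with a plateau of radius \<open>r\<close>: moving the argument by at most
  \<open>d\<close> then costs no more than replacing \<open>r\<close> by \<open>r + d\<close>. The
  \<open>max 0\<close> keeps \<open>\<Phi>\<close> away from negative arguments, where nothing is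
  known about it.\<close>

definition E :: "real \<Rightarrow> real \<Rightarrow> real" where "E r x = \<Phi> (max 0 (\<bar>x\<bar> - r))"

lemma \<Phi>_le: "0 \<le> x \<Longrightarrow> x \<le> y \<Longrightarrow> \<Phi> y \<le> \<Phi> x"
  using \<Phi>_anti by (auto simp: monotone_on_def)

lemma \<Phi>_max_measurable [measurable]: "(\<lambda>x. \<Phi> (max 0 x)) \<in> borel_measurable borel"
proof -
  have "mono (\<lambda>x. - \<Phi> (max 0 x))" by (intro monoI) (auto intro!: \<Phi>_le)
  then have "(\<lambda>x. - \<Phi> (max 0 x)) \<in> borel_measurable borel" by (rule borel_measurable_mono)
  from borel_measurable_uminus[OF this] show ?thesis by simp
qed

lemma E_measurable [measurable]: "E r \<in> borel_measurable borel"
  unfolding E_def[abs_def] by measurable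

lemma E_nonneg [simp]: "0 \<le> E r x" by (simp add: E_def \<Phi>_nonneg)

lemma E_le [simp]: "E r x \<le> \<Phi> 0" by (auto simp: E_def intro!: \<Phi>_le)

lemma \<Phi>0_nonneg [simp]: "0 \<le> \<Phi> 0" by (simp add: \<Phi>_nonneg)

lemma E_minus [simp]: "E r (- x) = E r x" by (simp add: E_def)

lemma E_mono: "\<bar>x\<bar> - s \<le> \<bar>y\<bar> - r \<Longrightarrow> E r y \<le> E s x"
  by (auto simp: E_def intro!: \<Phi>_le)

lemma E_shift: "\<bar>x - y\<bar> \<le> d \<Longrightarrow> E r y \<le> E (r + d) x"
  by (rule E_mono) auto

lemma E_abs_mono: "\<bar>x\<bar> \<le> \<bar>y\<bar> \<Longrightarrow> E r y \<le> E r x"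
  by (rule E_mono) auto

text \<open>The plateau contributes a multiple of an indicator, and off the plateau
  \<open>E r\<close> coincides with one of the two translates of \<open>\<Phi> \<bar>x\<bar>\<close>
  by \<open>r\<close>.\<close>

lemma E_integrable [simp]:
  assumes "r \<ge> 0" shows "integrable lborel (E r)"
proof (rule Bochner_Integration.integrable_bound)
  show "integrable lborel (\<lambda>x. \<Phi> 0 * indicator {-r..r} x + \<Phi> \<bar>-r + 1 * x\<bar> + \<Phi> \<bar>r + 1 * x\<bar>)"
    by (intro Bochner_Integration.integrable_add integrable_mult_right
        lborel_integrable_real_affine[OF \<Phi>_integrable]) auto
  show "AE x in lborel. norm (E r x) \<le> norm (\<Phi> 0 * indicator {-r..r} x + \<Phi> \<bar>-r + 1 * x\<bar> + \<Phi> \<bar>r + 1 * x\<bar>)"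
  proof (rule AE_I2)
    fix x :: real
    have 0: "0 \<le> \<Phi> \<bar>-r + x\<bar>" "0 \<le> \<Phi> \<bar>r + x\<bar>" by (simp_all add: \<Phi>_nonneg)
    have "E r x \<le> \<Phi> 0 * indicator {-r..r} x + \<Phi> \<bar>-r + x\<bar> + \<Phi> \<bar>r + x\<bar>"
    proof (cases "\<bar>x\<bar> \<le> r")
      case True
      then have "E r x = \<Phi> 0" "x \<in> {-r..r}" by (auto simp: E_def)
      then show ?thesis using 0 by auto
    next
      case False
      then have "max 0 (\<bar>x\<bar> - r) = \<bar>-r + x\<bar> \<or> max 0 (\<bar>x\<bar> - r) = \<bar>r + x\<bar>"
        using assms by linarith
      then have "E r x = \<Phi> \<bar>-r + x\<bar> \<or> E r x = \<Phi> \<bar>r + x\<bar>" by (auto simp: E_def)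
      moreover have "x \<notin> {-r..r}" using False by auto
      ultimately show ?thesis using 0 by auto
    qed
    then show "norm (E r x) \<le> norm (\<Phi> 0 * indicator {-r..r} x + \<Phi> \<bar>-r + 1 * x\<bar> + \<Phi> \<bar>r + 1 * x\<bar>)"
      using 0 by simp
  qed
qed measurable

definition latC :: "real \<Rightarrow> real" where "latC r = (LINT x|lborel. E (r + 1) x)"

lemma latC_nonneg [simp]: "0 \<le> latC r" unfolding latC_def by (rule integral_nonneg_AE) simp

text \<open>Sum against integral: each sample at \<open>x + k\<close> is at most the value of the
  wider envelope \<open>E (r + 1)\<close> anywhere within distance 1, so the lattice sum is below
  the unit-interval average of the periodized wider envelope. The bound is uniform in
  \<open>x\<close>.\<close>

lemma lattice_nn:
  assumes "r \<ge> 0"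
  shows "(\<integral>\<^sup>+k. ennreal (E r (x + of_int k)) \<partial>CI) \<le> ennreal (latC r)"
proof -
  let ?S = "\<integral>\<^sup>+k. ennreal (E r (x + of_int k)) \<partial>CI"
  have "?S = (\<integral>\<^sup>+y. indicator {x..<x+1} y * ?S \<partial>lborel)"
    by (subst nn_integral_multc) auto
  also have "\<dots> \<le> (\<integral>\<^sup>+y. indicator {x..<x+1} y * (\<integral>\<^sup>+k. ennreal (E (r + 1) (y + 1 * of_int k)) \<partial>CI) \<partial>lborel)"
  proof (rule nn_integral_mono)
    fix y
    show "indicator {x..<x+1} y * ?S
        \<le> indicator {x..<x+1} y * (\<integral>\<^sup>+k. ennreal (E (r + 1) (y + 1 * of_int k)) \<partial>CI)"
    proof (cases "y \<in> {x..<x+1}")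
      case True
      then have "?S \<le> (\<integral>\<^sup>+k. ennreal (E (r + 1) (y + 1 * of_int k)) \<partial>CI)"
        by (intro nn_integral_mono ennreal_leI E_shift) auto
      then show ?thesis by (rule mult_left_mono) simp
    qed simp
  qed
  also have "\<dots> = (\<integral>\<^sup>+y. ennreal (E (r + 1) y) \<partial>lborel)"
    by (rule periodize_nn[symmetric]) auto
  also have "\<dots> = ennreal (latC r)"
    unfolding latC_def using assms by (intro nn_integral_eq_integral) auto
  finally show ?thesis .
qed

lemma lattice_integrable [simp]:
  assumes "r \<ge> 0"
  shows "integrable CI (\<lambda>k. E r (x + of_int k))" "integrable CI (\<lambda>k. E r (x - of_int k))"
proof -
  show 1: "integrable CI (\<lambda>k. E r (x + of_int k))"
    by (rule integrableI_bounded) (use lattice_nn[OF assms, of x] in \<open>auto simp: top_unique less_top[symmetric]\<close>)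
  show "integrable CI (\<lambda>k. E r (x - of_int k))"
    using 1 integrable_CI_reindex[OF bij_uminus_int, of "\<lambda>k. E r (x + of_int k)"] by simp
qed

lemma lattice_le:
  assumes "r \<ge> 0"
  shows "(LINT k|CI. E r (x + of_int k)) \<le> latC r" "(LINT k|CI. E r (x - of_int k)) \<le> latC r"
proof -
  show 1: "(LINT k|CI. E r (x + of_int k)) \<le> latC r"
  proof -
    have "ennreal (LINT k|CI. E r (x + of_int k)) = (\<integral>\<^sup>+k. ennreal (E r (x + of_int k)) \<partial>CI)"
      by (rule nn_integral_eq_integral[symmetric]) (use assms in auto)
    with lattice_nn[OF assms, of x] show ?thesis by (metis ennreal_le_iff latC_nonneg)
  qed
  show "(LINT k|CI. E r (x - of_int k)) \<le> latC r"
    using 1 integral_CI_reindex[OF bij_uminus_int, of "\<lambda>k. E r (x + of_int k)"] by simp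
qed

text \<open>At least one of \<open>x\<close>, \<open>y\<close> lies at distance
  \<open>|x - y| / 2\<close> or more from \<open>z\<close>, and monotonicity extracts a factor that
  does not depend on \<open>z\<close>. Summed over \<open>z\<close>, this is the off-diagonal decay
  of the projection kernels.\<close>

lemma E_mult_le: "E r (x - z) * E r (y - z) \<le> E r ((x - y) / 2) * (E r (x - z) + E r (y - z))"
proof -
  have "\<bar>(x - y) / 2\<bar> \<le> \<bar>x - z\<bar> \<or> \<bar>(x - y) / 2\<bar> \<le> \<bar>y - z\<bar>" by (auto simp: abs_if field_simps)
  then show ?thesis
  proof
    assume "\<bar>(x - y) / 2\<bar> \<le> \<bar>x - z\<bar>"
    then have "E r (x - z) \<le> E r ((x - y) / 2)" by (rule E_abs_mono)
    then have "E r (x - z) * E r (y - z) \<le> E r ((x - y) / 2) * E r (y - z)"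
      by (rule mult_right_mono) simp
    also have "\<dots> \<le> E r ((x - y) / 2) * (E r (x - z) + E r (y - z))"
      by (intro mult_left_mono) auto
    finally show ?thesis .
  next
    assume "\<bar>(x - y) / 2\<bar> \<le> \<bar>y - z\<bar>"
    then have "E r (y - z) \<le> E r ((x - y) / 2)" by (rule E_abs_mono)
    then have "E r (x - z) * E r (y - z) \<le> E r (x - z) * E r ((x - y) / 2)"
      by (rule mult_left_mono) simp
    also have "\<dots> = E r ((x - y) / 2) * E r (x - z)" by simp
    also have "\<dots> \<le> E r ((x - y) / 2) * (E r (x - z) + E r (y - z))"
      by (intro mult_left_mono) auto
    finally show ?thesis .
  qed
qed

lemma lattice_mult:
  assumes "r \<ge> 0"
  shows "integrable CI (\<lambda>k. E r (x - of_int k) * E r (y - of_int k))"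
    and "(LINT k|CI. E r (x - of_int k) * E r (y - of_int k)) \<le> 2 * latC r * E r ((x - y) / 2)"
proof -
  let ?g = "\<lambda>k::int. E r ((x - y) / 2) * (E r (x - of_int k) + E r (y - of_int k))"
  have g: "integrable CI ?g" using assms by simp
  show i: "integrable CI (\<lambda>k. E r (x - of_int k) * E r (y - of_int k))"
    by (rule Bochner_Integration.integrable_bound[OF g]) (auto simp: E_mult_le)
  have "(LINT k|CI. E r (x - of_int k) * E r (y - of_int k)) \<le> (LINT k|CI. ?g k)"
    by (rule integral_mono[OF i g]) (rule E_mult_le)
  also have "\<dots> = E r ((x - y) / 2) * ((LINT k|CI. E r (x - of_int k)) + (LINT k|CI. E r (y - of_int k)))"
    using assms by simp
  also have "\<dots> \<le> E r ((x - y) / 2) * (latC r + latC r)"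
    by (intro mult_left_mono add_mono lattice_le assms) simp
  finally show "(LINT k|CI. E r (x - of_int k) * E r (y - of_int k)) \<le> 2 * latC r * E r ((x - y) / 2)"
    by (simp add: algebra_simps)
qed

lemma dilated_envelope: "l > 0 \<Longrightarrow> envelope (\<lambda>x. \<Phi> (l * x))"
proof unfold_locales
  assume l: "l > 0"
  show "0 \<le> \<Phi> (l * x)" if "x \<ge> 0" for x using l that by (simp add: \<Phi>_nonneg)
  show "antimono_on {0..} (\<lambda>x. \<Phi> (l * x))"
    using l by (auto simp: monotone_on_def intro!: \<Phi>_le mult_left_mono)
  have "integrable lborel (\<lambda>x. \<Phi> \<bar>0 + l * x\<bar>)"
    using l by (intro lborel_integrable_real_affine[OF \<Phi>_integrable]) auto
  then show "integrable lborel (\<lambda>x. \<Phi> (l * \<bar>x\<bar>))" using l by (simp add: abs_mult)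
qed

text \<open>Half-integers do not have unit spacing; passing to the envelope dilated by 1/2 restores
  it and doubles the plateau.\<close>

lemma half_lattice_integrable:
  assumes "r \<ge> 0" shows "integrable CI (\<lambda>k. E r (of_int k / 2))"
proof -
  interpret e: envelope "\<lambda>x. \<Phi> (1/2 * x)" by (rule dilated_envelope) simp
  have "e.E (2 * r) (0 + of_int k) = E r (of_int k / 2)" for k :: int
    unfolding e.E_def E_def by (rule arg_cong[of _ _ \<Phi>]) (auto simp: max_def field_simps)
  with e.lattice_integrable(1)[of "2 * r" 0] assms show ?thesis by simp
qed

end

locale weighted_envelope = envelope +
  fixes c A :: "real \<Rightarrow> real" and a0 x0 :: real
  assumes c_even: "\<And>x. c (- x) = c x" and c_mono: "mono_on {0..} c" and c0: "c 0 > 0"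
    and x0_pos: "x0 > 0"
    and A_pos: "\<And>a. a > 0 \<Longrightarrow> A a > 0"
    and c_dilate: "\<And>a x. a \<ge> a0 \<Longrightarrow> x \<ge> x0 \<Longrightarrow> c (a * x) \<le> c x * A a"
    and c_integrable: "integrable lborel (\<lambda>x. c x * \<Phi> \<bar>x\<bar>)"
begin

lemma c_abs: "c \<bar>x\<bar> = c x" using c_even[of x] by (auto simp: abs_if)

lemma c_le: "\<bar>x\<bar> \<le> \<bar>y\<bar> \<Longrightarrow> c x \<le> c y"
  using monotone_onD[OF c_mono, of "\<bar>x\<bar>" "\<bar>y\<bar>"] by (simp add: c_abs)

lemma c_pos: "c x > 0" using c_le[of 0 x] c0 by simp

lemma c_nonneg [simp]: "c x \<ge> 0" using c_pos[of x] by simp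

lemma c_measurable [measurable]: "c \<in> borel_measurable borel"
proof -
  have "mono (\<lambda>x. c (max 0 x))" by (intro monoI c_le) auto
  then have [measurable]: "(\<lambda>x. c (max 0 x)) \<in> borel_measurable borel" by (rule borel_measurable_mono)
  have "(\<lambda>x. c (max 0 \<bar>x\<bar>)) \<in> borel_measurable borel" by measurable
  then show ?thesis by (simp add: c_abs)
qed

text \<open>For large \<open>v\<close> the shift by \<open>r\<close> uses up at most half of
  \<open>l * |v|\<close>. With \<open>x = l * |v| / 2\<close> the second factor is at most
  \<open>\<Phi> x\<close>, and the first satisfies
  \<open>c (a * v) <= c (b * x) <= c x * A b\<close> by the dilation inequality. The remaining
  bounded range costs a constant times an indicator.\<close>

lemma weighted_integrable:
  assumes "a > 0" "l > 0" "r \<ge> 0"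
  shows "integrable lborel (\<lambda>v. c (a * v) * \<Phi> (max 0 (l * \<bar>v\<bar> - r)))"
proof (rule Bochner_Integration.integrable_bound)
  \<comment> \<open>\<open>b >= a0\<close> admits the dilation inequality and
    \<open>b >= 2 * a / l\<close> gives \<open>a * |v| <= b * x\<close>. Beyond \<open>V\<close>
    both \<open>l * |v| - r >= x\<close> and \<open>x >= x0\<close> hold.\<close>
  define b where "b = max \<bar>a0\<bar> (2 * a / l)"
  define V where "V = max (2 * r / l) (2 * x0 / l)"
  have b: "b > 0" "b \<ge> a0" "b \<ge> 2 * a / l" unfolding b_def using assms by (auto simp: less_max_iff_disj)
  let ?g = "\<lambda>v. c (a * V) * \<Phi> 0 * indicator {-V..V} v
      + A b * (c (0 + (l / 2) * v) * \<Phi> \<bar>0 + (l / 2) * v\<bar>)"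
  show "integrable lborel ?g"
    using assms by (intro Bochner_Integration.integrable_add integrable_mult_right
        lborel_integrable_real_affine[OF c_integrable]) auto
  show "AE v in lborel. norm (c (a * v) * \<Phi> (max 0 (l * \<bar>v\<bar> - r))) \<le> norm (?g v)"
  proof (rule AE_I2)
    fix v :: real
    have nn: "0 \<le> c (a * V) * \<Phi> 0 * indicator {-V..V} v" by (simp add: indicator_def)
    have nn2: "0 \<le> A b * (c ((l / 2) * v) * \<Phi> \<bar>(l / 2) * v\<bar>)"
      using A_pos[OF b(1)] by (simp add: \<Phi>_nonneg)
    have "c (a * v) * \<Phi> (max 0 (l * \<bar>v\<bar> - r)) \<le> c (a * V) * \<Phi> 0 * indicator {-V..V} v
      + A b * (c ((l / 2) * v) * \<Phi> \<bar>(l / 2) * v\<bar>)"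
    proof (cases "\<bar>v\<bar> \<le> V")
      case True
      have "c (a * v) * \<Phi> (max 0 (l * \<bar>v\<bar> - r)) \<le> c (a * V) * \<Phi> 0"
        using True assms by (intro mult_mono c_le \<Phi>_le) (auto simp: abs_mult \<Phi>_nonneg intro!: mult_mono)
      then show ?thesis using True nn2 by (auto simp: indicator_def)
    next
      case False
      define x where "x = l * \<bar>v\<bar> / 2"
      have xx: "x \<ge> x0" "l * \<bar>v\<bar> - r \<ge> x" "x > 0"
      proof -
        have "\<bar>v\<bar> > 2 * r / l" "\<bar>v\<bar> > 2 * x0 / l" using False unfolding V_def by linarith+
        then have "l * \<bar>v\<bar> > 2 * r" "l * \<bar>v\<bar> > 2 * x0"
          using assms by (simp_all add: pos_divide_less_eq mult.commute)
        then show "x \<ge> x0" "l * \<bar>v\<bar> - r \<ge> x" "x > 0" using x0_pos by (auto simp: x_def)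
      qed
      have "c (a * v) \<le> c (b * x)"
      proof (rule c_le)
        have "a * \<bar>v\<bar> = (2 * a / l) * x" using assms by (simp add: x_def)
        also have "\<dots> \<le> b * x" using b(3) xx(3) by (intro mult_right_mono) auto
        finally show "\<bar>a * v\<bar> \<le> \<bar>b * x\<bar>" using assms b xx by (simp add: abs_mult)
      qed
      also have "\<dots> \<le> c x * A b" by (rule c_dilate) (use b xx in auto)
      finally have 1: "c (a * v) \<le> c x * A b" .
      have 2: "\<Phi> (max 0 (l * \<bar>v\<bar> - r)) \<le> \<Phi> x" using xx by (intro \<Phi>_le) auto
      have "c (a * v) * \<Phi> (max 0 (l * \<bar>v\<bar> - r)) \<le> (c x * A b) * \<Phi> x"
        by (intro mult_mono 1 2) (use A_pos[OF b(1)] in \<open>auto simp: \<Phi>_nonneg\<close>)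
      moreover have "c x = c ((l / 2) * v)" "\<Phi> x = \<Phi> \<bar>(l / 2) * v\<bar>"
        using c_abs[of "(l / 2) * v"] assms by (auto simp: x_def abs_mult)
      moreover have "indicator {-V..V} v = (0::real)" using False by (auto simp: indicator_def)
      ultimately show ?thesis by (simp add: algebra_simps)
    qed
    then show "norm (c (a * v) * \<Phi> (max 0 (l * \<bar>v\<bar> - r))) \<le> norm (?g v)"
      using nn nn2 by (simp add: \<Phi>_nonneg)
  qed
qed measurable

end


section \<open>Fourier analysis on the line and on the circle\<close>

lemma AE_lborel_obtain:
  assumes "AE x in lborel. P x" "a < (b::real)"
  obtains x where "a < x" "x < b" "P x"
proof (rule ccontr)
  assume "\<not> thesis"
  then have "\<And>x. P x \<Longrightarrow> x \<notin> {a<..<b}" using that by auto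
  with assms(1) have "AE x in lborel. x \<notin> {a<..<b}" by (auto elim: eventually_mono)
  then have "emeasure lborel {a<..<b} = 0"
    by (subst (asm) AE_iff_null) (auto simp: null_sets_def greaterThanLessThan_def greaterThan_def lessThan_def Int_def)
  then show False using assms(2) by simp
qed

lemma AE_eq_continuous:
  fixes f g :: "real \<Rightarrow> complex"
  assumes "continuous_on UNIV f" "continuous_on UNIV g" "AE x in lborel. f x = g x"
  shows "f x = g x"
proof (rule ccontr)
  assume "f x \<noteq> g x"
  have "open {x. f x \<noteq> g x}"
    by (rule open_Collect_neq) (use assms in auto)
  with \<open>f x \<noteq> g x\<close> obtain e where e: "e > 0" "ball x e \<subseteq> {x. f x \<noteq> g x}"
    unfolding open_contains_ball by auto
  obtain z where "x < z" "z < x + e" "f z = g z"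
    using AE_lborel_obtain[OF assms(3), of x "x + e"] e by auto
  then have "z \<in> ball x e" by (auto simp: dist_real_def)
  with e \<open>f z = g z\<close> show False by blast
qed

lemma integrable_fourier:
  assumes "integrable lborel f"
  shows "integrable lborel (\<lambda>x. exp (- \<i> * of_real (y * x)) * f x)"
  by (rule Bochner_Integration.integrable_bound[OF assms]) (use assms in \<open>auto simp: norm_mult\<close>)

lemma norm_fourier_le:
  assumes "integrable lborel f"
  shows "norm (fourier f y) \<le> (LINT x|lborel. norm (f x))"
  unfolding fourier_def
  by (rule order_trans[OF integral_norm_bound]) (simp add: norm_mult)

lemma continuous_fourier:
  assumes f: "integrable lborel f"
  shows "continuous_on UNIV (fourier f)"
proof -
  have "isCont (fourier f) y" for y
  proof (rule continuous_at_sequentiallyI)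
    fix u :: "nat \<Rightarrow> real" assume u: "u \<longlonglongrightarrow> y"
    show "(\<lambda>n. fourier f (u n)) \<longlonglongrightarrow> fourier f y"
      unfolding fourier_def
      by (rule integral_dominated_convergence[where w="\<lambda>x. norm (f x)"])
        (use f u in \<open>auto intro!: tendsto_intros AE_I2 simp: norm_mult\<close>)
  qed
  then show ?thesis by (simp add: continuous_at_imp_continuous_on)
qed

lemma fourier_measurable: "integrable lborel f \<Longrightarrow> fourier f \<in> borel_measurable borel"
  by (rule borel_measurable_continuous_onI) (rule continuous_fourier)

lemma fourier_scale: "fourier (\<lambda>x. f (x / 2) / 2) u = fourier f (2 * u)"
  unfolding fourier_def
  by (subst lborel_integral_real_affine[where c=2 and t=0]) (auto simp: algebra_simps scaleR_conv_of_real)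

lemma fourier_shift: "fourier (\<lambda>x. f (x - a)) u = exp (- \<i> * of_real (u * a)) * fourier f u"
proof -
  have "exp (- \<i> * of_real (u * (a + 1 * x))) * f (a + 1 * x - a)
      = exp (- \<i> * of_real (u * a)) * (exp (- \<i> * of_real (u * x)) * f x)" for x
  proof -
    have "exp (- \<i> * of_real (u * (a + 1 * x))) = exp (- \<i> * of_real (u * a)) * exp (- \<i> * of_real (u * x))"
      by (subst exp_add[symmetric]) (simp add: ring_distribs)
    then show ?thesis by simp
  qed
  note eq = this
  have "fourier (\<lambda>x. f (x - a)) u = (LINT x|lborel. exp (- \<i> * of_real (u * (a + 1 * x))) * f (a + 1 * x - a))"
    unfolding fourier_def by (subst lborel_integral_real_affine[where c=1 and t=a]) simp_all
  then show ?thesis unfolding eq fourier_def by simp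
qed

lemma fourier_modulate: "fourier (\<lambda>x. exp (- \<i> * of_real (v * x)) * f x) u = fourier f (u + v)"
proof -
  have "exp (- \<i> * of_real (u * x)) * (exp (- \<i> * of_real (v * x)) * f x) = exp (- \<i> * of_real ((u + v) * x)) * f x" for x
  proof -
    have "exp (- \<i> * of_real ((u + v) * x)) = exp (- \<i> * of_real (u * x)) * exp (- \<i> * of_real (v * x))"
      by (subst exp_add[symmetric]) (simp add: ring_distribs)
    then show ?thesis by simp
  qed
  then show ?thesis unfolding fourier_def by (simp only:)
qed

lemma fourier_cdiff:
  assumes "integrable lborel f" "integrable lborel g"
  shows "fourier (\<lambda>x. f x - g x) u = fourier f u - fourier g u"
  unfolding fourier_def right_diff_distrib using assms
  by (intro Bochner_Integration.integral_diff integrable_fourier)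

lemma integral_gaussian_iexp:
  "(LINT z|lborel. of_real (std_normal_density z) * exp (\<i> * of_real (t * z))) = of_real (exp (- t\<^sup>2 / 2))"
proof -
  have "char std_normal_distribution t = of_real (exp (- (t\<^sup>2) / 2))"
    using char_std_normal_distribution by (simp add: fun_eq_iff)
  moreover have "char std_normal_distribution t =
      (LINT z|lborel. std_normal_density z *\<^sub>R exp (\<i> * of_real (t * z)))"
    unfolding char_def by (subst integral_density) auto
  ultimately show ?thesis by (simp add: scaleR_conv_of_real)
qed

lemma integrable_std_normal_density [simp]: "integrable lborel std_normal_density"
  using integrable_std_normal_moment[of 0] by simp

lemma integral_std_normal_density [simp]: "(LINT z|lborel. std_normal_density z) = 1"
  using integral_std_normal_moment_even[of 0] by simp

text \<open>The Gaussian factor makes the double integral absolutely convergent although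
  \<open>fourier f\<close> need not be integrable; after Fubini the inner integral is the
  characteristic function of the standard normal law.\<close>

lemma gaussian_smoothing:
  fixes f :: "real \<Rightarrow> complex"
  assumes f: "integrable lborel f" and e: "e > 0"
  shows "(LINT u|lborel. of_real (std_normal_density (e * u)) * exp (\<i> * of_real (u * x)) * fourier f u) =
     of_real (sqrt (2 * pi)) * (LINT z|lborel. of_real (std_normal_density z) * f (x - e * z))"
proof -
  have [measurable]: "f \<in> borel_measurable borel" using f by auto
  have dens: "integrable lborel (\<lambda>u. std_normal_density (e * u))"
    using lborel_integrable_real_affine[OF integrable_std_normal_density, of e 0] e by simp
  let ?F = "\<lambda>u y. of_real (std_normal_density (e * u)) * exp (\<i> * of_real (u * x)) *
      (exp (- \<i> * of_real (u * y)) * f y)"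
  have nF: "norm (?F u y) = std_normal_density (e * u) * norm (f y)" for u y
    by (simp add: norm_mult)
  have "(LINT u|lborel. of_real (std_normal_density (e * u)) * exp (\<i> * of_real (u * x)) * fourier f u)
     = (LINT u|lborel. LINT y|lborel. ?F u y)"
    unfolding fourier_def by simp
  also have "\<dots> = (LINT y|lborel. LINT u|lborel. ?F u y)"
  proof (rule Fubini_dom(6)[symmetric, where g="\<lambda>u y. std_normal_density (e * u) * norm (f y)"
        and h="\<lambda>u. std_normal_density (e * u) * (LINT y|lborel. norm (f y))"])
    show "integrable lborel (\<lambda>u. std_normal_density (e * u) * (LINT y|lborel. norm (f y)))"
      using dens by simp
    show "norm (?F u y) \<le> std_normal_density (e * u) * norm (f y)" for u y using nF by simp
    show "integrable lborel (\<lambda>y. std_normal_density (e * u) * norm (f y))" for u using f by simp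
  qed (auto simp: lborel.sigma_finite_measure_axioms)
  also have "\<dots> = (LINT y|lborel. of_real (exp (- ((x - y) / e)\<^sup>2 / 2)) * (f y / of_real e))"
  proof (rule Bochner_Integration.integral_cong)
    fix y
    have "(LINT u|lborel. ?F u y) =
      (LINT u|lborel. of_real (std_normal_density (e * u)) * exp (\<i> * of_real (u * (x - y)))) * f y"
      by (simp add: algebra_simps exp_add[symmetric] flip: integral_mult_left_zero)
    also have "(LINT u|lborel. of_real (std_normal_density (e * u)) * exp (\<i> * of_real (u * (x - y)))) =
        (LINT u|lborel. of_real (std_normal_density u) * exp (\<i> * of_real (((x - y) / e) * u))) / of_real e"
      by (subst lborel_integral_real_affine[where c="1/e" and t=0]) (use e in \<open>auto simp: field_simps scaleR_conv_of_real\<close>)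
    also have "\<dots> = of_real (exp (- ((x - y) / e)\<^sup>2 / 2)) / of_real e"
      by (simp only: integral_gaussian_iexp)
    finally show "(LINT u|lborel. ?F u y) = of_real (exp (- ((x - y) / e)\<^sup>2 / 2)) * (f y / of_real e)"
      by simp
  qed simp
  also have "\<dots> = (LINT z|lborel. of_real (exp (- z\<^sup>2 / 2)) * f (x - e * z))"
    by (subst lborel_integral_real_affine[where c="-e" and t=x])
      (use e in \<open>auto simp: field_simps scaleR_conv_of_real\<close>)
  also have "\<dots> = (LINT z|lborel. of_real (sqrt (2 * pi)) * (of_real (std_normal_density z) * f (x - e * z)))"
    by (rule Bochner_Integration.integral_cong) (auto simp: std_normal_density_def)
  finally show ?thesis by simp
qed

lemma gaussian_smoothing_limit:
  fixes f :: "real \<Rightarrow> complex"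
  assumes "continuous_on UNIV f" "\<And>x. norm (f x) \<le> B"
  shows "(\<lambda>n. LINT z|lborel. of_real (std_normal_density z) * f (x - 1 / Suc n * z)) \<longlonglongrightarrow> f x"
proof -
  have [measurable]: "f \<in> borel_measurable borel"
    by (rule borel_measurable_continuous_onI) fact
  have "(\<lambda>n. LINT z|lborel. of_real (std_normal_density z) * f (x - 1 / Suc n * z))
     \<longlonglongrightarrow> (LINT z|lborel. of_real (std_normal_density z) * f x)"
  proof (rule integral_dominated_convergence[where w="\<lambda>z. std_normal_density z * B"])
    show "AE z in lborel. (\<lambda>n. of_real (std_normal_density z) * f (x - 1 / Suc n * z)) \<longlonglongrightarrow>
        of_real (std_normal_density z) * f x"
    proof (rule AE_I2, rule tendsto_mult_left)
      fix z
      have "(\<lambda>n. x - 1 / Suc n * z) \<longlonglongrightarrow> x - 0 * z"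
        by (intro tendsto_intros LIMSEQ_Suc[OF lim_inverse_n'])
      then show "(\<lambda>n. f (x - 1 / Suc n * z)) \<longlonglongrightarrow> f x"
        using assms(1) by (intro continuous_on_tendsto_compose[of UNIV f]) auto
    qed
    show "AE z in lborel. norm (of_real (std_normal_density z) * f (x - 1 / Suc n * z)) \<le> std_normal_density z * B" for n
      by (auto simp: norm_mult intro!: mult_left_mono assms)
  qed auto
  moreover have "(LINT z|lborel. of_real (std_normal_density z) * f x) = f x"
    by (simp del: of_real_mult)
  ultimately show ?thesis by simp
qed

text \<open>Both sides of the smoothing identity are evaluated as its width tends to 0: the left by
  dominated convergence with the integrable transform, the right as an approximate identity. The
  factor \<open>2 * pi\<close> is \<open>sqrt (2 * pi)\<close> divided by the value
  \<open>1 / sqrt (2 * pi)\<close> of the density at 0.\<close>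

lemma fourier_inversion:
  fixes f :: "real \<Rightarrow> complex"
  assumes f: "integrable lborel f" "continuous_on UNIV f" "\<And>x. norm (f x) \<le> B"
    and fh: "integrable lborel (fourier f)"
  shows "(LINT u|lborel. exp (\<i> * of_real (u * x)) * fourier f u) = of_real (2 * pi) * f x"
proof -
  have [measurable]: "fourier f \<in> borel_measurable borel" using fourier_measurable[OF f(1)] .
  let ?n = "std_normal_density"
  have n0: "?n x \<le> ?n 0" for x by (auto simp: std_normal_density_def intro!: divide_right_mono)
  have "(\<lambda>n. LINT u|lborel. of_real (?n (1 / Suc n * u)) * exp (\<i> * of_real (u * x)) * fourier f u)
    \<longlonglongrightarrow> (LINT u|lborel. of_real (?n 0) * exp (\<i> * of_real (u * x)) * fourier f u)"
  proof (rule integral_dominated_convergence[where w="\<lambda>u. ?n 0 * norm (fourier f u)"])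
    show "AE u in lborel. (\<lambda>n. of_real (?n (1 / Suc n * u)) * exp (\<i> * of_real (u * x)) * fourier f u)
       \<longlonglongrightarrow> of_real (?n 0) * exp (\<i> * of_real (u * x)) * fourier f u"
    proof (rule AE_I2)
      fix u
      have "(\<lambda>n. 1 / Suc n * u) \<longlonglongrightarrow> 0 * u"
        by (intro tendsto_intros LIMSEQ_Suc[OF lim_inverse_n'])
      moreover have "isCont ?n 0" unfolding normal_density_def by (intro continuous_intros) auto
      ultimately have "(\<lambda>n. ?n (1 / Suc n * u)) \<longlonglongrightarrow> ?n 0"
        by (intro isCont_tendsto_compose[of 0 ?n]) auto
      then show "(\<lambda>n. of_real (?n (1 / Suc n * u)) * exp (\<i> * of_real (u * x)) * fourier f u)
        \<longlonglongrightarrow> of_real (?n 0) * exp (\<i> * of_real (u * x)) * fourier f u"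
        by (intro tendsto_intros)
    qed
    show "AE u in lborel. norm (of_real (?n (1 / Suc n * u)) * exp (\<i> * of_real (u * x)) * fourier f u)
       \<le> ?n 0 * norm (fourier f u)" for n
      by (auto simp: norm_mult intro!: mult_right_mono n0)
  qed (use fh in auto)
  moreover have "(\<lambda>n. LINT u|lborel. of_real (?n (1 / Suc n * u)) * exp (\<i> * of_real (u * x)) * fourier f u)
     \<longlonglongrightarrow> of_real (sqrt (2 * pi)) * f x"
    by (subst gaussian_smoothing[OF f(1)], simp)
      (intro tendsto_intros gaussian_smoothing_limit[OF f(2,3)])
  ultimately have "(LINT u|lborel. of_real (?n 0) * exp (\<i> * of_real (u * x)) * fourier f u) = of_real (sqrt (2 * pi)) * f x"
    by (rule LIMSEQ_unique)
  then have "(LINT u|lborel. of_real (?n 0) * (exp (\<i> * of_real (u * x)) * fourier f u)) = of_real (sqrt (2 * pi)) * f x"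
    by (simp add: mult.assoc)
  then have "of_real (?n 0) * (LINT u|lborel. exp (\<i> * of_real (u * x)) * fourier f u) = of_real (sqrt (2 * pi)) * f x"
    by simp
  then have "(of_real (sqrt (2 * pi)) * of_real (?n 0)) * (LINT u|lborel. exp (\<i> * of_real (u * x)) * fourier f u)
      = (of_real (sqrt (2 * pi)) * of_real (sqrt (2 * pi))) * f x"
    by (simp add: mult.assoc)
  moreover have "sqrt (2 * pi) * ?n 0 = 1" by (simp add: std_normal_density_def)
  moreover have "sqrt (2 * pi) * sqrt (2 * pi) = 2 * pi" by simp
  ultimately show ?thesis
    unfolding of_real_mult[symmetric] by (simp only: of_real_1 mult_1_left)
qed

lemma fourier_eq_0:
  fixes f :: "real \<Rightarrow> complex"
  assumes f: "integrable lborel f" "continuous_on UNIV f" "\<And>x. norm (f x) \<le> B"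
    and fh: "\<And>u. fourier f u = 0"
  shows "f x = 0"
proof -
  have "fourier f = (\<lambda>_. 0)" using fh by auto
  then show ?thesis using fourier_inversion[OF f, of x] by simp
qed

lemma fourier_inject:
  fixes f g :: "real \<Rightarrow> complex"
  assumes "integrable lborel f" "continuous_on UNIV f" "\<And>x. norm (f x) \<le> B"
    and "integrable lborel g" "continuous_on UNIV g" "\<And>x. norm (g x) \<le> C"
    and "AE u in lborel. fourier f u = fourier g u"
  shows "f x = g x"
proof -
  have "fourier f u = fourier g u" for u
    using assms by (intro AE_eq_continuous[of "fourier f" "fourier g"] continuous_fourier) auto
  then have "fourier (\<lambda>x. f x - g x) u = 0" for u using assms by (simp add: fourier_cdiff)
  moreover have "norm (f x - g x) \<le> B + C" for x
    using norm_triangle_ineq4[of "f x" "g x"] assms(3)[of x] assms(6)[of x] by simp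
  ultimately have "f x - g x = 0"
    using assms by (intro fourier_eq_0[where f="\<lambda>x. f x - g x" and B="B + C"] continuous_on_diff) auto
  then show ?thesis by simp
qed

text \<open>For integrable \<open>f\<close> the transforms of the truncations also converge
  pointwise to \<open>fourier f\<close>; Fatou then makes the squared distance between the pointwise
  and the mean-square limit vanish.\<close>

lemma has_L2_fourier_AE:
  assumes L2: "has_L2_fourier f g" and f: "integrable lborel f"
  shows "AE y in lborel. g y = fourier f y"
proof -
  have [measurable]: "f \<in> borel_measurable borel" "g \<in> borel_measurable borel"
    using L2 by (auto simp: has_L2_fourier_def square_integrable_def)
  define F where "F n = fourier (\<lambda>x. indicator {- real n..real n} x * f x)" for n
  have int: "integrable lborel (\<lambda>x. indicator {- real n..real n} x * f x)" for n
    by (rule Bochner_Integration.integrable_bound[OF f]) (auto simp: indicator_def)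
  have [measurable]: "F n \<in> borel_measurable borel" for n unfolding F_def using fourier_measurable[OF int] .
  have [measurable]: "fourier f \<in> borel_measurable borel" using fourier_measurable[OF f] .
  have lim: "(\<lambda>n. F n y) \<longlonglongrightarrow> fourier f y" for y
    unfolding F_def fourier_def
  proof (rule integral_dominated_convergence[where w="\<lambda>x. norm (f x)"])
    show "AE x in lborel. (\<lambda>n. exp (- \<i> * of_real (y * x)) * (indicator {- real n..real n} x * f x))
        \<longlonglongrightarrow> exp (- \<i> * of_real (y * x)) * f x"
    proof (rule AE_I2, rule tendsto_eventually)
      fix x :: real
      have "\<forall>\<^sub>F n in sequentially. \<bar>x\<bar> \<le> real n"
        by (rule eventually_sequentiallyI[of "nat \<lceil>\<bar>x\<bar>\<rceil>"]) linarith
      then show "\<forall>\<^sub>F n in sequentially. exp (- \<i> * of_real (y * x)) * (indicator {- real n..real n} x * f x)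
         = exp (- \<i> * of_real (y * x)) * f x"
        by eventually_elim (auto simp: indicator_def)
    qed
  qed (use f in \<open>auto simp: norm_mult indicator_def\<close>)
  have "((\<lambda>N::real. \<integral>\<^sup>+ y. ennreal ((cmod (g y - fourier (\<lambda>x. indicator {-N..N} x * f x) y))\<^sup>2) \<partial>lborel)
        \<longlongrightarrow> 0) at_top"
    using L2 by (auto simp: has_L2_fourier_def)
  from filterlim_compose[OF this filterlim_real_sequentially]
  have "(\<lambda>n. \<integral>\<^sup>+ y. ennreal ((cmod (g y - F n y))\<^sup>2) \<partial>lborel) \<longlonglongrightarrow> 0"
    by (simp add: F_def)
  then have 0: "liminf (\<lambda>n. \<integral>\<^sup>+ y. ennreal ((cmod (g y - F n y))\<^sup>2) \<partial>lborel) = 0"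
    by (rule lim_imp_Liminf[rotated]) simp
  have "(\<integral>\<^sup>+ y. ennreal ((cmod (g y - fourier f y))\<^sup>2) \<partial>lborel)
     = (\<integral>\<^sup>+ y. liminf (\<lambda>n. ennreal ((cmod (g y - F n y))\<^sup>2)) \<partial>lborel)"
    by (intro nn_integral_cong lim_imp_Liminf[symmetric] tendsto_ennrealI tendsto_intros lim) simp
  also have "\<dots> \<le> 0" by (subst 0[symmetric], rule nn_integral_liminf) simp
  finally have "(\<integral>\<^sup>+ y. ennreal ((cmod (g y - fourier f y))\<^sup>2) \<partial>lborel) = 0" by simp
  then have "AE y in lborel. ennreal ((cmod (g y - fourier f y))\<^sup>2) = 0"
    by (subst (asm) nn_integral_0_iff_AE) auto
  then show ?thesis by eventually_elim auto
qed

text \<open>The first three conclusions are the form in which \<open>fourier_inject\<close> wants a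
  function, so that two convolutions can be identified by comparing their transforms.\<close>

lemma convolution:
  fixes f g :: "real \<Rightarrow> complex"
  assumes f: "integrable lborel f" "continuous_on UNIV f" "\<And>x. norm (f x) \<le> B"
    and g: "integrable lborel g"
  defines "h \<equiv> \<lambda>x. LINT y|lborel. f (x - y) * g y"
  shows "integrable lborel h" "continuous_on UNIV h" "\<And>x. norm (h x) \<le> B * (LINT y|lborel. norm (g y))"
    "fourier h u = fourier f u * fourier g u"
    "\<And>x. integrable lborel (\<lambda>y. f (x - y) * g y)"
proof -
  have [measurable]: "f \<in> borel_measurable borel" "g \<in> borel_measurable borel" using f g by auto
  have fshift: "integrable lborel (\<lambda>x. norm (f (x - y)))" "(LINT x|lborel. norm (f (x - y))) = (LINT x|lborel. norm (f x))" for y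
  proof -
    show "integrable lborel (\<lambda>x. norm (f (x - y)))"
      using lborel_integrable_real_affine[OF f(1), of 1 "-y"] by (intro integrable_norm) simp
    show "(LINT x|lborel. norm (f (x - y))) = (LINT x|lborel. norm (f x))"
      by (subst lborel_integral_real_affine[where c=1 and t=y]) auto
  qed
  show i: "integrable lborel (\<lambda>y. f (x - y) * g y)" for x
    by (rule Bochner_Integration.integrable_bound[OF integrable_mult_right[OF integrable_norm[OF g], of B]])
      (auto simp: norm_mult intro!: AE_I2 mult_mono f order_trans[OF _ abs_ge_self] order_trans[OF norm_ge_zero f(3)])
  note D = Fubini_dom[where M=lborel and N=lborel and f="\<lambda>y x. exp (- \<i> * of_real (u * x)) * (f (x - y) * g y)"
      and g="\<lambda>y x. norm (f (x - y)) * norm (g y)" and h="\<lambda>y. (LINT x|lborel. norm (f x)) * norm (g y)" for u]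
  have sw: "(LINT x|lborel. LINT y|lborel. exp (- \<i> * of_real (u * x)) * (f (x - y) * g y)) =
     (LINT y|lborel. LINT x|lborel. exp (- \<i> * of_real (u * x)) * (f (x - y) * g y))"
    by (rule D(6)) (use fshift g in \<open>auto simp: norm_mult lborel.sigma_finite_measure_axioms\<close>)
  have "integrable lborel (\<lambda>x. LINT y|lborel. exp (- \<i> * of_real (0 * x)) * (f (x - y) * g y))"
    by (rule D(5)) (use fshift g in \<open>auto simp: norm_mult lborel.sigma_finite_measure_axioms\<close>)
  then show "integrable lborel h" by (simp add: h_def)
  show "norm (h x) \<le> B * (LINT y|lborel. norm (g y))" for x
  proof -
    have "norm (h x) \<le> (LINT y|lborel. norm (f (x - y) * g y))"
      unfolding h_def by (rule integral_norm_bound)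
    also have "\<dots> \<le> (LINT y|lborel. B * norm (g y))"
    proof (rule integral_mono)
      show "norm (f (x - y) * g y) \<le> B * norm (g y)" for y
        by (simp add: norm_mult mult_right_mono f(3))
    qed (use i g in auto)
    finally show ?thesis by simp
  qed
  have "isCont h x" for x
  proof (rule continuous_at_sequentiallyI)
    fix s :: "nat \<Rightarrow> real" assume s: "s \<longlonglongrightarrow> x"
    show "(\<lambda>n. h (s n)) \<longlonglongrightarrow> h x"
      unfolding h_def
    proof (rule integral_dominated_convergence[where w="\<lambda>y. B * norm (g y)"])
      show "AE y in lborel. (\<lambda>n. f (s n - y) * g y) \<longlonglongrightarrow> f (x - y) * g y"
        by (intro AE_I2 tendsto_mult_right continuous_on_tendsto_compose[OF f(2)] tendsto_intros s) auto
    qed (use g in \<open>auto simp: norm_mult intro!: mult_right_mono f(3)\<close>)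
  qed
  then show "continuous_on UNIV h" by (simp add: continuous_at_imp_continuous_on)
  have "fourier h u = (LINT x|lborel. LINT y|lborel. exp (- \<i> * of_real (u * x)) * (f (x - y) * g y))"
    unfolding fourier_def h_def by simp
  also have "\<dots> = (LINT y|lborel. fourier (\<lambda>x. f (x - y)) u * g y)"
    unfolding sw fourier_def by (simp add: mult.assoc flip: integral_mult_left_zero)
  also have "\<dots> = (LINT y|lborel. fourier f u * (exp (- \<i> * of_real (u * y)) * g y))"
    by (simp add: fourier_shift mult_ac)
  also have "\<dots> = fourier f u * fourier g u" by (simp add: fourier_def)
  finally show "fourier h u = fourier f u * fourier g u" .
qed


lemma continuous_CI_sum:
  fixes u :: "int \<Rightarrow> real \<Rightarrow> complex"
  assumes cont: "\<And>k. continuous_on UNIV (u k)"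
    and dom: "\<And>x0. \<exists>w. integrable CI w \<and> (\<forall>x k. \<bar>x - x0\<bar> < 1 \<longrightarrow> norm (u k x) \<le> w k)"
  shows "continuous_on UNIV (\<lambda>x. LINT k|CI. u k x)"
proof -
  have "isCont (\<lambda>x. LINT k|CI. u k x) x0" for x0
  proof (rule continuous_at_sequentiallyI)
    fix s :: "nat \<Rightarrow> real" assume s: "s \<longlonglongrightarrow> x0"
    obtain w where w: "integrable CI w" "\<And>x k. \<bar>x - x0\<bar> < 1 \<Longrightarrow> norm (u k x) \<le> w k"
      using dom by blast
    obtain N where N: "\<And>n. n \<ge> N \<Longrightarrow> \<bar>s n - x0\<bar> < 1"
      using LIMSEQ_D[OF s, of 1] by auto
    show "(\<lambda>n. LINT k|CI. u k (s n)) \<longlonglongrightarrow> (LINT k|CI. u k x0)"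
    proof (rule LIMSEQ_offset[where k=N], rule integral_dominated_convergence[where w=w])
      show "AE k in CI. (\<lambda>n. u k (s (n + N))) \<longlonglongrightarrow> u k x0"
        by (intro AE_I2 continuous_on_tendsto_compose[OF cont] LIMSEQ_ignore_initial_segment s) auto
      show "AE k in CI. norm (u k (s (n + N))) \<le> w k" for n
        using w N by (intro AE_I2) simp
    qed (use w in auto)
  qed
  then show ?thesis by (simp add: continuous_at_imp_continuous_on)
qed

section \<open>Periodizations of enveloped functions and their Fourier coefficients\<close>

context envelope
begin

lemma lattice_sum:
  fixes H :: "real \<Rightarrow> complex"
  assumes H: "\<And>y. norm (H y) \<le> C * E r y" and r: "r \<ge> 0" and C: "C \<ge> 0"
  shows "integrable CI (\<lambda>k. H (y + of_int k))"
    and "norm (LINT k|CI. H (y + of_int k)) \<le> C * latC r"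
    and "continuous_on UNIV H \<Longrightarrow> continuous_on UNIV (\<lambda>y. LINT k|CI. H (y + of_int k))"
proof -
  have i: "integrable CI (\<lambda>k. C * E r (y + of_int k))" for y using r by simp
  show int: "integrable CI (\<lambda>k. H (y + of_int k))" for y
    by (rule Bochner_Integration.integrable_bound[OF i[of y]]) (auto intro!: AE_I2 order_trans[OF H])
  have "norm (LINT k|CI. H (y + of_int k)) \<le> (LINT k|CI. C * E r (y + of_int k))"
    by (rule order_trans[OF integral_norm_bound integral_mono]) (use int i H in auto)
  also have "\<dots> \<le> C * latC r" using lattice_le(1)[OF r, of y] C by (simp add: mult_left_mono)
  finally show "norm (LINT k|CI. H (y + of_int k)) \<le> C * latC r" .
  assume cont: "continuous_on UNIV H"
  show "continuous_on UNIV (\<lambda>y. LINT k|CI. H (y + of_int k))"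
  proof (rule continuous_CI_sum)
    show "continuous_on UNIV (\<lambda>x. H (x + of_int k))" for k
      by (rule continuous_on_compose2[OF cont]) (auto intro!: continuous_intros)
    fix x0
    have "norm (H (x + of_int k)) \<le> C * E (r + 1) (x0 + of_int k)" if "\<bar>x - x0\<bar> < 1" for x and k :: int
      by (rule order_trans[OF H]) (use that C in \<open>auto intro!: mult_left_mono E_shift\<close>)
    moreover have "integrable CI (\<lambda>k. C * E (r + 1) (x0 + of_int k))" using r by simp
    ultimately show "\<exists>w. integrable CI w \<and> (\<forall>x k. \<bar>x - x0\<bar> < 1 \<longrightarrow> norm (H (x + of_int k)) \<le> w k)"
      by blast
  qed
qed

text \<open>Rudin's kernels \<open>(1 + cos (y - y0) - cos \<delta>)^n\<close> concentrate at \<open>y0\<close>, which contradicts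
  the vanishing of all Fourier coefficients if the periodization does not vanish at \<open>y0\<close>.\<close>

lemma lattice_sum_eq_0:
  fixes H :: "real \<Rightarrow> complex"
  assumes H: "\<And>y. norm (H y) \<le> C * E r y" and r: "r \<ge> 0" and C: "C \<ge> 0"
    and cont: "continuous_on UNIV H"
    and coeff: "\<And>m::int. fourier H (2 * pi * of_int m) = 0"
  shows "(LINT k|CI. H (y0 + of_int k)) = 0"
proof (rule ccontr)
  define p where "p y = (LINT k|CI. H (y + of_int k))" for y
  assume "(LINT k|CI. H (y0 + of_int k)) \<noteq> 0"
  then have p0: "p y0 \<noteq> 0" by (simp add: p_def)
  have [measurable]: "H \<in> borel_measurable borel" by (rule borel_measurable_continuous_onI) fact
  have pc: "continuous_on UNIV p" unfolding p_def by (rule lattice_sum(3)) fact+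
  then have [measurable]: "p \<in> borel_measurable borel" by (rule borel_measurable_continuous_onI)
  have intH: "integrable lborel H"
    by (rule Bochner_Integration.integrable_bound[OF integrable_mult_right[OF E_integrable[OF r], of C]])
      (auto intro!: AE_I2 order_trans[OF H])
  \<comment> \<open>Rotation by the conjugate of \<open>p y0\<close> reduces the complex
    periodization to a real function that is strictly positive at \<open>y0\<close>.\<close>
  define w where "w = cnj (p y0)"
  define \<rho> where "\<rho> y = Re (w * p y)" for y
  have [measurable]: "\<rho> \<in> borel_measurable borel" unfolding \<rho>_def by measurable
  define R0 where "R0 = \<rho> y0"
  have R0: "R0 > 0" using p0 unfolding R0_def \<rho>_def w_def
    by (simp add: complex_eq_iff sum_power2_gt_zero_iff flip: power2_eq_square)
  define Q where "Q = norm w * (C * latC r)"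
  have \<rho>_le: "\<bar>\<rho> y\<bar> \<le> Q" for y
  proof -
    have "\<bar>\<rho> y\<bar> \<le> norm (w * p y)" unfolding \<rho>_def by (rule abs_Re_le_cmod)
    also have "\<dots> \<le> Q" unfolding norm_mult Q_def p_def
      by (intro mult_left_mono lattice_sum(2)[OF H r C]) auto
    finally show ?thesis .
  qed
  have "isCont \<rho> y0" unfolding \<rho>_def using pc
    by (intro continuous_Re continuous_mult continuous_const) (simp add: continuous_on_eq_continuous_at)
  then obtain d1 where d1: "d1 > 0" "\<And>y. \<bar>y - y0\<bar> < d1 \<Longrightarrow> \<bar>\<rho> y - R0\<bar> < R0 / 2"
    unfolding continuous_at_eps_delta dist_real_def R0_def using R0 R0_def by (metis half_gt_zero)
  define d where "d = min (d1 / 2) (1 / 4)"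
  have d: "d > 0" "d \<le> 1/4" "d < d1" using d1 by (auto simp: d_def)
  \<comment> \<open>Subtracting the value of the cosine at distance \<open>d\<close> makes
    \<open>base\<close> at least 1 up to that distance from \<open>y0\<close>, at least
    \<open>b1 > 1\<close> up to half of it, and of modulus at most 1 on the rest of the
    period.\<close>
  define base where "base y = 1 + cos (2 * pi * (y - y0)) - cos (2 * pi * d)" for y
  have [measurable]: "base \<in> borel_measurable borel" unfolding base_def by measurable
  have base_le: "\<bar>base y\<bar> \<le> 3" for y
    unfolding base_def using cos_le_one[of "2 * pi * (y - y0)"] cos_ge_minus_one[of "2 * pi * (y - y0)"]
      cos_le_one[of "2 * pi * d"] cos_ge_minus_one[of "2 * pi * d"] by linarith
  have cos_anti: "cos (2 * pi * b) \<le> cos (2 * pi * a)" if "\<bar>a\<bar> \<le> b" "b \<le> 1/2" for a b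
  proof -
    have "cos (2 * pi * b) \<le> cos (2 * pi * \<bar>a\<bar>)"
      by (rule cos_monotone_0_pi_le) (use that in \<open>auto simp: field_simps\<close>)
    also have "cos (2 * pi * \<bar>a\<bar>) = cos (2 * pi * a)" by (auto simp: abs_if)
    finally show ?thesis .
  qed
  have near: "base y \<ge> 1" if "\<bar>y - y0\<bar> \<le> d" for y
    using cos_anti[of "y - y0" d] that d by (simp add: base_def)
  define b1 where "b1 = 1 + cos (2 * pi * (d / 2)) - cos (2 * pi * d)"
  have b1: "b1 > 1"
  proof -
    have "cos (2 * pi * d) < cos (2 * pi * (d / 2))"
      by (rule cos_monotone_0_pi) (use d in \<open>auto simp: field_simps\<close>)
    then show ?thesis by (simp add: b1_def)
  qed
  have near2: "base y \<ge> b1" if "\<bar>y - y0\<bar> \<le> d / 2" for y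
    using cos_anti[of "y - y0" "d/2"] that d by (simp add: base_def b1_def)
  have far: "\<bar>base y\<bar> \<le> 1" if "\<bar>y - y0\<bar> > d" "\<bar>y - y0\<bar> \<le> 1/2" for y
  proof -
    have "cos (2 * pi * \<bar>y - y0\<bar>) \<le> cos (2 * pi * d)"
      using cos_anti[of d "\<bar>y - y0\<bar>"] that d by simp
    also have "cos (2 * pi * \<bar>y - y0\<bar>) = cos (2 * pi * (y - y0))"
      using cos_abs_real[of "2 * pi * (y - y0)"] by (simp add: abs_mult)
    finally show ?thesis unfolding base_def
      using cos_ge_minus_one[of "2 * pi * (y - y0)"] cos_le_one[of "2 * pi * d"] by linarith
  qed
  have intB: "integrable lborel (\<lambda>y. exp (- \<i> * of_real (2 * pi * of_int m * y)) * (H y * of_real (base y ^ n)))" for m :: int and n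
  proof (rule Bochner_Integration.integrable_bound[OF integrable_mult_right[OF integrable_norm[OF intH], of "3 ^ n"]])
    show "AE y in lborel. norm (exp (- \<i> * of_real (2 * pi * of_int m * y)) * (H y * of_real (base y ^ n))) \<le> norm (3 ^ n * norm (H y))"
      using power_mono[OF base_le, of _ n]
      by (intro AE_I2) (auto simp: norm_mult norm_power mult.commute intro!: mult_left_mono)
  qed measurable
  \<comment> \<open>A factor \<open>base\<close> mixes only the frequencies \<open>m - 1\<close>,
    \<open>m\<close> and \<open>m + 1\<close>, so vanishing at all integer frequencies passes to the
    next power; hence the generalization over \<open>m\<close>.\<close>
  have zero: "(LINT y|lborel. exp (- \<i> * of_real (2 * pi * of_int m * y)) * (H y * of_real (base y ^ n))) = 0" for m :: int and n
  proof (induction n arbitrary: m)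
    case 0
    show ?case using coeff[of m] by (simp add: fourier_def)
  next
    case (Suc n)
    let ?e = "\<lambda>(m::int) y. exp (- \<i> * of_real (2 * pi * of_int m * y)) :: complex"
    let ?a = "exp (- \<i> * of_real (2 * pi * y0)) / 2" and ?b = "exp (\<i> * of_real (2 * pi * y0)) / 2"
    have trig: "?e m y * of_real (base y) = of_real (1 - cos (2 * pi * d)) * ?e m y + ?a * ?e (m - 1) y + ?b * ?e (m + 1) y" for y
    proof -
      have "of_real (cos (2 * pi * (y - y0))) =
         (exp (\<i> * of_real (2 * pi * (y - y0))) + exp (- (\<i> * of_real (2 * pi * (y - y0))))) / 2"
        by (simp add: cos_of_real[symmetric] cos_exp_eq del: of_real_mult of_real_diff)
      moreover have "?e m y * exp (\<i> * of_real (2 * pi * (y - y0))) = exp (- \<i> * of_real (2 * pi * y0)) * ?e (m - 1) y"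
        by (simp add: exp_add[symmetric] algebra_simps)
      moreover have "?e m y * exp (- (\<i> * of_real (2 * pi * (y - y0)))) = exp (\<i> * of_real (2 * pi * y0)) * ?e (m + 1) y"
        by (simp add: exp_add[symmetric] algebra_simps)
      ultimately have c: "?e m y * of_real (cos (2 * pi * (y - y0))) = ?a * ?e (m - 1) y + ?b * ?e (m + 1) y"
        by (simp only: times_divide_eq_right distrib_left add_divide_distrib) simp
      have "?e m y * of_real (base y) = of_real (1 - cos (2 * pi * d)) * ?e m y + ?e m y * of_real (cos (2 * pi * (y - y0)))"
        unfolding base_def of_real_add of_real_diff by (simp only: ring_distribs) (simp add: mult.commute)
      then show ?thesis unfolding c by (simp only: add.assoc)
    qed
    have "?e m y * (H y * of_real (base y ^ Suc n)) =
       of_real (1 - cos (2 * pi * d)) * (?e m y * (H y * of_real (base y ^ n)))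
       + ?a * (?e (m - 1) y * (H y * of_real (base y ^ n))) + ?b * (?e (m + 1) y * (H y * of_real (base y ^ n)))" for y
    proof -
      have "?e m y * (H y * of_real (base y ^ Suc n)) = (?e m y * of_real (base y)) * (H y * of_real (base y ^ n))"
        by (simp only: power_Suc of_real_mult mult_ac)
      then show ?thesis unfolding trig by (simp only: distrib_right mult.assoc)
    qed
    note eq = this
    show ?case unfolding eq using intB
      by (subst Bochner_Integration.integral_add, (intro Bochner_Integration.integrable_add integrable_mult_right intB)+)+
        (simp only: integral_mult_right_zero Suc.IH mult_zero_right add_0_left)
  qed
  let ?I = "{y0 - 1/2..<y0 - 1/2 + 1}"
  have base_per: "base (y + 1 * of_int k) = base y" for y and k :: int
  proof -
    have "cos (2 * pi * (y + of_int k - y0)) = cos (2 * pi * (y - y0) + 2 * pi * of_int k)"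
      by (simp add: algebra_simps)
    also have "\<dots> = cos (2 * pi * (y - y0))" by (simp add: cos_add)
    finally show ?thesis by (simp add: base_def)
  qed
  have zero2: "(LINT y|lborel. indicator ?I y * (p y * of_real (base y ^ n))) = 0" for n
  proof -
    have "integrable lborel (\<lambda>y. H y * of_real (base y ^ n))" "(LINT y|lborel. H y * of_real (base y ^ n)) = 0"
      using intB[of 0 n] zero[of 0 n] by auto
    then have "(LINT y|lborel. indicator ?I y * (LINT k|CI. H (y + 1 * of_int k) * of_real (base (y + 1 * of_int k) ^ n))) = 0"
      by (subst periodize(1)[where \<tau>=1, symmetric]) auto
    then show ?thesis unfolding base_per by (simp add: p_def)
  qed
  \<comment> \<open>The integral over one period is 0. The range within \<open>d / 2\<close>, of
    length \<open>d\<close>, contributes at least \<open>R0 / 2 * b1 ^ n\<close> per unit length,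
    the range between \<open>d / 2\<close> and \<open>d\<close> is nonnegative, and the rest is at
    least \<open>- Q\<close>. Exponential growth against a fixed \<open>Q\<close> is the
    contradiction.\<close>
  have bound: "R0 / 2 * b1 ^ n * d \<le> Q" for n
  proof -
    let ?f = "\<lambda>y. indicator ?I y * (\<rho> y * base y ^ n)"
    have "integrable lborel (\<lambda>y. indicator ?I y * (p y * of_real (base y ^ n)))"
    proof (rule Bochner_Integration.integrable_bound)
      show "integrable lborel (\<lambda>y. (C * latC r * 3 ^ n) * indicator {y0 - 1/2..y0+1/2} y)" by simp
      show "AE y in lborel. norm (indicator ?I y * (p y * of_real (base y ^ n))) \<le> norm ((C * latC r * 3 ^ n) * indicator {y0 - 1/2..y0+1/2} y)"
        using C by (intro AE_I2)
          (auto simp: indicator_def norm_mult norm_power p_def intro!: mult_mono lattice_sum(2)[OF H r C] power_mono base_le)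
    qed measurable
    note ip = this
    have re: "Re (w * (indicator ?I y * (p y * of_real (base y ^ n)))) = ?f y" for y
      by (simp add: \<rho>_def indicator_def algebra_simps flip: of_real_power)
    have if': "integrable lborel ?f"
      using integrable_Re[OF integrable_mult_right[OF ip, of w]] unfolding re .
    have "(LINT y|lborel. ?f y) = Re (LINT y|lborel. w * (indicator ?I y * (p y * of_real (base y ^ n))))"
      unfolding re[symmetric] by (rule integral_Re) (rule integrable_mult_right[OF ip])
    then have f0: "(LINT y|lborel. ?f y) = 0" using zero2 by simp
    let ?g = "\<lambda>y. (R0 / 2 * b1 ^ n) * indicator {y0 - d/2..y0 + d/2} y - Q * indicator {y0 - 1/2..y0 + 1/2} y"
    have "(LINT y|lborel. ?g y) \<le> (LINT y|lborel. ?f y)"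
    proof (rule integral_mono[OF _ if'])
      fix y
      have Q: "Q \<ge> 0" using \<rho>_le[of 0] by linarith
      consider "\<bar>y - y0\<bar> \<le> d/2" | "d/2 < \<bar>y - y0\<bar>" "\<bar>y - y0\<bar> \<le> d" | "d < \<bar>y - y0\<bar>" "y \<in> ?I" | "d < \<bar>y - y0\<bar>" "y \<notin> ?I"
        by linarith
      then show "?g y \<le> ?f y"
      proof cases
        case 1
        then have "\<rho> y \<ge> R0 / 2" using d1(2)[of y] d by (auto simp: abs_if field_simps split: if_splits)
        moreover have "base y ^ n \<ge> b1 ^ n" using near2[OF 1] b1 by (intro power_mono) auto
        ultimately have "(R0 / 2) * b1 ^ n \<le> \<rho> y * base y ^ n"
          using R0 b1 by (intro mult_mono) auto
        moreover have "y \<in> ?I" unfolding atLeastLessThan_iff using 1 d by linarith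
        moreover have "y \<in> {y0 - d/2..y0 + d/2}" unfolding atLeastAtMost_iff using 1 d by linarith
        ultimately show ?thesis using Q by (auto simp: indicator_def)
      next
        case 2
        then have "\<rho> y \<ge> R0 / 2" using d1(2)[of y] d by (auto simp: abs_if field_simps split: if_splits)
        moreover have "base y \<ge> 1" using near 2 by simp
        ultimately have "0 \<le> \<rho> y * base y ^ n" using R0 by (intro mult_nonneg_nonneg) auto
        moreover have "y \<notin> {y0 - d/2..y0 + d/2}" using 2 by (auto simp: abs_if split: if_splits)
        ultimately show ?thesis using Q by (auto simp: indicator_def)
      next
        case 3
        then have "\<bar>y - y0\<bar> \<le> 1/2" unfolding atLeastLessThan_iff by linarith
        with 3 have "\<bar>base y\<bar> \<le> 1" by (intro far) auto
        then have "\<bar>base y\<bar> ^ n \<le> 1" by (intro power_le_one) auto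
        then have "\<bar>\<rho> y\<bar> * \<bar>base y\<bar> ^ n \<le> Q * 1" using \<rho>_le[of y] Q by (intro mult_mono) auto
        then have "\<bar>\<rho> y * base y ^ n\<bar> \<le> Q" by (simp add: abs_mult power_abs)
        moreover have "y \<notin> {y0 - d/2..y0 + d/2}" using 3 d by (auto simp: abs_if split: if_splits)
        ultimately show ?thesis using 3 by (auto simp: indicator_def)
      next
        case 4
        then have "y \<notin> {y0 - d/2..y0 + d/2}" using d by (auto simp: abs_if split: if_splits)
        with 4 show ?thesis using Q by (auto simp: indicator_def)
      qed
    qed simp
    then have "(LINT y|lborel. ?g y) \<le> 0" using f0 by simp
    moreover have "(LINT y|lborel. ?g y) = (R0 / 2 * b1 ^ n) * measure lborel {y0 - d/2..y0 + d/2} - Q * 1"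
      by (subst Bochner_Integration.integral_diff) auto
    moreover have "measure lborel {y0 - d/2..y0 + d/2} = d" using d by simp
    ultimately show ?thesis by simp
  qed
  obtain n where "b1 ^ n > Q / (R0 / 2 * d)" using real_arch_pow[OF b1] by blast
  then have "Q < R0 / 2 * b1 ^ n * d" using R0 d by (simp add: field_simps)
  with bound[of n] show False by simp
qed

end


section \<open>Refinement equations and projection kernels\<close>

lemma measurable_cnj [measurable]: "cnj \<in> borel_measurable borel"
  by (intro borel_measurable_continuous_onI continuous_intros)

lemma AE_lborel_affine:
  assumes "AE x in lborel. P x" "c \<noteq> (0::real)"
  shows "AE x in lborel. P (t + c * x)"
proof -
  obtain N where N: "{x \<in> space lborel. \<not> P x} \<subseteq> N" "emeasure lborel N = 0" "N \<in> sets lborel"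
    by (rule AE_E[OF assms(1)])
  have [measurable]: "N \<in> sets borel" using N by simp
  have "AE x in lborel. x \<notin> N" using N by (intro AE_not_in) (auto simp: null_sets_def)
  then have "AE x in lborel. t + c * x \<notin> N"
    by (rule AE_borel_affine[OF assms(2), rotated]) measurable
  then show ?thesis by eventually_elim (use N in auto)
qed

lemma exp_2pi_int [simp]: "exp (\<i> * of_real (2 * pi * of_int n)) = 1"
  using exp_integer_2pi[of "of_int n"] by (simp add: mult_ac)

lemma integral_iexp_period:
  "(LINT u|lborel. indicator {0..<0 + 2 * pi} u * exp (\<i> * of_real (u * of_int l))) = (if l = 0 then of_real (2 * pi) else 0)"
proof (cases "l = 0")
  case True
  have "(LINT u|lborel. indicator {0..<0 + 2 * pi} u * (1::complex)) = (LINT u|lborel. indicator {0..<2 * pi} u *\<^sub>R (1::complex))"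
    by (rule Bochner_Integration.integral_cong) (auto simp: indicator_def)
  then show ?thesis using True by (simp add: scaleR_conv_of_real)
next
  case False
  let ?F = "\<lambda>u. exp (\<i> * of_real (u * of_int l)) / (\<i> * of_int l)"
  have "AE u in lborel. u \<noteq> 2 * pi" by (rule AE_lborel_singleton)
  then have "(LINT u|lborel. indicator {0..<0 + 2 * pi} u * exp (\<i> * of_real (u * of_int l)))
     = (LINT u|lborel. indicator {0..2 * pi} u *\<^sub>R exp (\<i> * of_real (u * of_int l)))"
    by (intro integral_cong_AE) (auto simp: indicator_def elim!: eventually_mono)
  also have "\<dots> = ?F (2 * pi) - ?F 0"
  proof (rule integral_FTC_Icc)
    fix x
    have "((\<lambda>z. exp (\<i> * (z * of_int l)) / (\<i> * of_int l)) has_field_derivative exp (\<i> * (of_real x * of_int l))) (at (of_real x))"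
      using False by (auto intro!: derivative_eq_intros) (simp add: complex_eq_iff)
    from has_vector_derivative_real_field[OF this]
    show "(?F has_vector_derivative exp (\<i> * of_real (x * of_int l))) (at x within {0..2 * pi})"
      by simp
  qed (auto intro!: continuous_intros)
  also have "\<dots> = 0" using exp_2pi_int[of l] False by simp
  finally show ?thesis using False by simp
qed

lemma sum_integral_swap:
  fixes a :: "int \<Rightarrow> complex" and g :: "real \<Rightarrow> complex"
  assumes a: "integrable CI a" and g: "integrable lborel g"
    and [measurable]: "\<And>k. u k \<in> borel_measurable borel" and u: "\<And>k x. norm (u k x) \<le> B"
  shows "(LINT x|lborel. (LINT k|CI. a k * u k x) * g x) = (LINT k|CI. a k * (LINT x|lborel. u k x * g x))"
    and "integrable lborel (\<lambda>x. (LINT k|CI. a k * u k x) * g x)"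
proof -
  have [measurable]: "g \<in> borel_measurable borel" using g by auto
  note D = Fubini_dom[where M=lborel and N=CI and f="\<lambda>x k. a k * u k x * g x"
      and g="\<lambda>x k. norm (a k) * (B * norm (g x))" and h="\<lambda>x. (LINT k|CI. norm (a k)) * (B * norm (g x))",
      OF lborel.sigma_finite_measure_axioms sigma_finite_CI]
  have m: "(\<lambda>(x, k). a k * u k x * g x) \<in> borel_measurable (lborel \<Otimes>\<^sub>M CI)"
    by (rule measurable_pair_CI) simp
  have b: "norm (a k * u k x * g x) \<le> norm (a k) * (B * norm (g x))" for k x
    by (simp add: norm_mult mult.assoc mult_left_mono mult_right_mono u)
  have "(LINT k|CI. LINT x|lborel. a k * u k x * g x) = (LINT x|lborel. LINT k|CI. a k * u k x * g x)"
    by (rule D(6)) (use m b a g in auto)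
  moreover have "(LINT x|lborel. a k * u k x * g x) = a k * (LINT x|lborel. u k x * g x)" for k
    by (simp add: mult.assoc)
  moreover have "(LINT k|CI. a k * u k x * g x) = (LINT k|CI. a k * u k x) * g x" for x by simp
  ultimately show "(LINT x|lborel. (LINT k|CI. a k * u k x) * g x) = (LINT k|CI. a k * (LINT x|lborel. u k x * g x))"
    by (simp only:)
  have "integrable lborel (\<lambda>x. LINT k|CI. a k * u k x * g x)"
    by (rule D(3)) (use m b a g in auto)
  then show "integrable lborel (\<lambda>x. (LINT k|CI. a k * u k x) * g x)" by simp
qed

text \<open>The pointwise bounds use \<open>E 1\<close> because an almost everywhere bound by a
  possibly discontinuous \<open>\<Phi>\<close> passes to every point only after a small shift of the
  argument. All conditions refer to the ordinary transforms, so that no choice of representatives of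
  these remains.\<close>

locale wavelet_pair = envelope +
  fixes \<phi> \<psi> m0 :: "real \<Rightarrow> complex"
  assumes \<phi>_cont: "continuous_on UNIV \<phi>" and \<psi>_cont: "continuous_on UNIV \<psi>"
    and \<phi>_bd: "\<And>x. norm (\<phi> x) \<le> E 1 x" and \<psi>_bd: "\<And>x. norm (\<psi> x) \<le> E 1 x"
    and \<phi>h_int: "integrable lborel (fourier \<phi>)"
    and \<phi>h_sum: "AE y in lborel. integrable CI (\<lambda>k. (cmod (fourier \<phi> (y + 2 * pi * of_int k)))\<^sup>2) \<and>
        (LINT k|CI. (cmod (fourier \<phi> (y + 2 * pi * of_int k)))\<^sup>2) = 1"
    and \<phi>h_0: "fourier \<phi> 0 \<noteq> 0"
    and m0_per: "\<And>y. m0 (y + 2 * pi) = m0 y"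
    and \<phi>h_refine: "AE y in lborel. fourier \<phi> y = m0 (y / 2) * fourier \<phi> (y / 2)"
    and \<psi>h: "AE y in lborel. fourier \<psi> y = cnj (m0 (y / 2 + pi)) * exp (- \<i> * of_real (y / 2)) * fourier \<phi> (y / 2)"
begin

lemma \<phi>_measurable [measurable]: "\<phi> \<in> borel_measurable borel" and \<psi>_measurable [measurable]: "\<psi> \<in> borel_measurable borel"
  using borel_measurable_continuous_onI[OF \<phi>_cont] borel_measurable_continuous_onI[OF \<psi>_cont] by auto

lemma \<phi>_le: "norm (\<phi> x) \<le> \<Phi> 0" and \<psi>_le: "norm (\<psi> x) \<le> \<Phi> 0"
  using order_trans[OF \<phi>_bd E_le] order_trans[OF \<psi>_bd E_le] by auto

lemma \<phi>_int: "integrable lborel \<phi>" and \<psi>_int: "integrable lborel \<psi>"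
  by (auto intro!: Bochner_Integration.integrable_bound[OF E_integrable[of 1]] AE_I2 \<phi>_bd \<psi>_bd)

lemma \<phi>h_measurable [measurable]: "fourier \<phi> \<in> borel_measurable borel"
  by (rule fourier_measurable[OF \<phi>_int])

lemma \<phi>_shift_int: "integrable lborel (\<lambda>x. \<phi> (x + t))"
  using lborel_integrable_real_affine[OF \<phi>_int, of 1 t] by (simp add: add.commute)

lemma m0_per_int: "m0 (y + 2 * pi * of_int k) = m0 y"
proof -
  have nat: "m0 (y + 2 * pi * of_nat n) = m0 y" for n y
  proof (induction n)
    case (Suc n)
    have "m0 (y + 2 * pi * of_nat (Suc n)) = m0 ((y + 2 * pi * of_nat n) + 2 * pi)"
      by (simp add: algebra_simps)
    also have "\<dots> = m0 (y + 2 * pi * of_nat n)" by (rule m0_per)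
    finally show ?case using Suc by simp
  qed simp
  show ?thesis
  proof (cases "k \<ge> 0")
    case True
    then show ?thesis using nat[of y "nat k"] by simp
  next
    case False
    then show ?thesis using nat[of "y + 2 * pi * of_int k" "nat (- k)"] by simp
  qed
qed

text \<open>One null set serves all \<open>k\<close>, so that the common value \<open>m0 u\<close>
  can be eliminated between different translates of the same frequency.\<close>

lemma refine_double: "AE u in lborel. \<forall>k::int. fourier \<phi> (2 * (u + 2 * pi * of_int k)) = m0 u * fourier \<phi> (u + 2 * pi * of_int k)"
proof (subst AE_all_countable, rule allI)
  fix k :: int
  have "AE u in lborel. fourier \<phi> (4 * pi * of_int k + 2 * u) =
     m0 ((4 * pi * of_int k + 2 * u) / 2) * fourier \<phi> ((4 * pi * of_int k + 2 * u) / 2)"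
    by (rule AE_lborel_affine[OF \<phi>h_refine]) simp
  moreover have "(4 * pi * of_int k + 2 * u) / 2 = u + 2 * pi * of_int k" for u by simp
  moreover have "4 * pi * of_int k + 2 * u = 2 * (u + 2 * pi * of_int k)" for u by simp
  ultimately show "AE u in lborel. fourier \<phi> (2 * (u + 2 * pi * of_int k)) = m0 u * fourier \<phi> (u + 2 * pi * of_int k)"
    by (simp only: m0_per_int)
qed

text \<open>Parseval by hand: inversion is inserted for the first factor, and Fubini leaves the
  squared modulus of the transform against a character of period \<open>2 * pi\<close>. Folding onto
  one period replaces that square by the constant 1, so that only the Fourier coefficients of a
  constant remain.\<close>

lemma ortho0: "(LINT x|lborel. \<phi> x * cnj (\<phi> (x - of_int l))) = (if l = 0 then 1 else 0)"
proof -
  let ?f = "\<lambda>x u. exp (\<i> * of_real (u * x)) * fourier \<phi> u * cnj (\<phi> (x - of_int l))"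
  have "of_real (2 * pi) * (LINT x|lborel. \<phi> x * cnj (\<phi> (x - of_int l)))
     = (LINT x|lborel. (of_real (2 * pi) * \<phi> x) * cnj (\<phi> (x - of_int l)))"
    by (simp add: mult.assoc)
  also have "\<dots> = (LINT x|lborel. LINT u|lborel. ?f x u)"
    by (subst fourier_inversion[OF \<phi>_int \<phi>_cont \<phi>_le \<phi>h_int, symmetric]) simp
  also have "\<dots> = (LINT u|lborel. LINT x|lborel. ?f x u)"
  proof (rule Fubini_dom(6)[symmetric, where g="\<lambda>x u. norm (fourier \<phi> u) * norm (\<phi> (x - of_int l))"
      and h="\<lambda>x. (LINT u|lborel. norm (fourier \<phi> u)) * norm (\<phi> (x - of_int l))"])
    show "integrable lborel (\<lambda>x. (LINT u|lborel. norm (fourier \<phi> u)) * norm (\<phi> (x - of_int l)))"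
      using \<phi>_shift_int[of "- of_int l"] by simp
  qed (use \<phi>h_int in \<open>auto simp: norm_mult lborel.sigma_finite_measure_axioms\<close>)
  also have "\<dots> = (LINT u|lborel. exp (\<i> * of_real (u * of_int l)) * of_real ((cmod (fourier \<phi> u))\<^sup>2))"
  proof (rule Bochner_Integration.integral_cong)
    fix u
    have "(LINT x|lborel. ?f x u) = (LINT x|lborel. fourier \<phi> u * cnj (exp (- \<i> * of_real (u * x)) * \<phi> (x - of_int l)))"
      by (rule Bochner_Integration.integral_cong) (auto simp: exp_cnj)
    also have "\<dots> = fourier \<phi> u * cnj (fourier (\<lambda>x. \<phi> (x - of_int l)) u)"
      unfolding fourier_def[of "\<lambda>x. \<phi> (x - of_int l)"] by (simp only: integral_mult_right_zero Bochner_Integration.integral_cnj)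
    also have "\<dots> = fourier \<phi> u * (exp (\<i> * of_real (u * of_int l)) * cnj (fourier \<phi> u))"
      by (subst fourier_shift) (simp add: exp_cnj)
    also have "\<dots> = exp (\<i> * of_real (u * of_int l)) * of_real ((cmod (fourier \<phi> u))\<^sup>2)"
      by (simp only: complex_norm_square mult_ac)
    finally show "(LINT x|lborel. ?f x u) = exp (\<i> * of_real (u * of_int l)) * of_real ((cmod (fourier \<phi> u))\<^sup>2)" .
  qed simp
  also have "\<dots> = (LINT u|lborel. indicator {0..<0 + 2 * pi} u * (LINT k|CI. exp (\<i> * of_real ((u + 2 * pi * of_int k) * of_int l)) *
      of_real ((cmod (fourier \<phi> (u + 2 * pi * of_int k)))\<^sup>2)))"
  proof (rule periodize(1))
    show "integrable lborel (\<lambda>u. exp (\<i> * of_real (u * of_int l)) * of_real ((cmod (fourier \<phi> u))\<^sup>2))"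
    proof (rule Bochner_Integration.integrable_bound)
      show "integrable lborel (\<lambda>u. (LINT x|lborel. norm (\<phi> x)) * norm (fourier \<phi> u))" using \<phi>h_int by simp
      show "AE u in lborel. norm (exp (\<i> * of_real (u * of_int l)) * of_real ((cmod (fourier \<phi> u))\<^sup>2))
         \<le> norm ((LINT x|lborel. norm (\<phi> x)) * norm (fourier \<phi> u))"
        using norm_fourier_le[OF \<phi>_int]
        by (intro AE_I2) (auto simp: norm_mult power2_eq_square norm_power intro!: mult_right_mono)
    qed measurable
  qed simp
  also have "\<dots> = (LINT u|lborel. indicator {0..<0 + 2 * pi} u * exp (\<i> * of_real (u * of_int l)))"
  proof (rule integral_cong_AE)
    have e: "exp (\<i> * of_real ((u + 2 * pi * of_int k) * of_int l)) = exp (\<i> * of_real (u * of_int l))" for u and k :: int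
    proof -
      have "\<i> * of_real ((u + 2 * pi * of_int k) * of_int l) = \<i> * of_real (u * of_int l) + \<i> * of_real (2 * pi * of_int (k * l))"
        by (simp add: algebra_simps)
      then show ?thesis by (simp only: exp_add exp_2pi_int mult_1_right)
    qed
    interpret CI: sigma_finite_measure CI by (rule sigma_finite_CI)
    have "(\<lambda>(u, k). exp (\<i> * of_real ((u + 2 * pi * of_int k) * of_int l)) * of_real ((cmod (fourier \<phi> (u + 2 * pi * of_int k)))\<^sup>2))
      \<in> borel_measurable (lborel \<Otimes>\<^sub>M CI)"
      by (rule measurable_pair_CI) measurable
    from CI.borel_measurable_lebesgue_integral[OF this]
    show "(\<lambda>u. indicator {0..<0 + 2 * pi} u * (LINT k|CI. exp (\<i> * of_real ((u + 2 * pi * of_int k) * of_int l)) *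
      of_real ((cmod (fourier \<phi> (u + 2 * pi * of_int k)))\<^sup>2))) \<in> borel_measurable lborel"
      by measurable
    show "AE u in lborel. indicator {0..<0 + 2 * pi} u * (LINT k|CI. exp (\<i> * of_real ((u + 2 * pi * of_int k) * of_int l)) *
      of_real ((cmod (fourier \<phi> (u + 2 * pi * of_int k)))\<^sup>2)) = indicator {0..<0 + 2 * pi} u * exp (\<i> * of_real (u * of_int l))"
      using \<phi>h_sum unfolding e
    proof eventually_elim
      case (elim u)
      have "(LINT k|CI. complex_of_real ((cmod (fourier \<phi> (u + 2 * pi * of_int k)))\<^sup>2)) = 1"
        unfolding integral_complex_of_real using elim by simp
      then show ?case by (simp only: integral_mult_right_zero mult_1_right)
    qed
  qed measurable
  also have "\<dots> = (if l = 0 then of_real (2 * pi) else 0)" by (rule integral_iexp_period)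
  finally have "of_real (2 * pi) * (LINT x|lborel. \<phi> x * cnj (\<phi> (x - of_int l))) = of_real (2 * pi) * (if l = 0 then 1 else 0)"
    by simp
  then show ?thesis by (subst (asm) mult_left_cancel) auto
qed

lemma ortho: "(LINT x|lborel. \<phi> (x - of_int k) * cnj (\<phi> (x - of_int l))) = (if k = l then 1 else 0)"
  using ortho0[of "l - k"]
  by (subst lborel_integral_real_affine[where c=1 and t="of_int k"]) (auto simp: algebra_simps)

text \<open>Normalized so that its transform at \<open>u\<close> is
  \<open>fourier \<phi> (2 * u)\<close>, the dilated side of the refinement relation.\<close>

definition \<phi>2 :: "real \<Rightarrow> complex" where "\<phi>2 x = \<phi> (x / 2) / 2"

lemma \<phi>2_measurable [measurable]: "\<phi>2 \<in> borel_measurable borel" unfolding \<phi>2_def by measurable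

lemma \<phi>2_cont: "continuous_on UNIV \<phi>2"
  unfolding \<phi>2_def by (intro continuous_intros continuous_on_compose2[OF \<phi>_cont]) auto

lemma \<phi>2_le: "norm (\<phi>2 x) \<le> \<Phi> 0"
proof -
  have "norm (\<phi>2 x) = norm (\<phi> (x / 2)) / 2" by (simp add: \<phi>2_def norm_divide)
  then show ?thesis using \<phi>_le[of "x / 2"] \<Phi>0_nonneg by linarith
qed

lemma \<phi>2_int: "integrable lborel \<phi>2"
  unfolding \<phi>2_def using lborel_integrable_real_affine[OF \<phi>_int, of "1/2" 0] by simp

lemma fourier_\<phi>2: "fourier \<phi>2 u = fourier \<phi> (2 * u)"
  unfolding \<phi>2_def by (rule fourier_scale)

text \<open>The periodicity of the mask, read in the time domain: the two convolutions
  \<open>\<phi>2 * (e \<phi>)\<close> and \<open>(e \<phi>2) * \<phi>\<close> agree for every character \<open>e\<close> of period 1, so that the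
  periodization of \<open>y \<mapsto> \<phi>2 (x - y) \<phi> y\<close> is invariant under \<open>y \<mapsto> x - y\<close>.\<close>

lemma zak_symmetry: "(LINT k|CI. \<phi>2 (a - of_int k) * \<phi> (y + of_int k)) = (LINT k|CI. \<phi>2 (y + of_int k) * \<phi> (a - of_int k))"
proof -
  define x where "x = a + y"
  define H where "H z = \<phi>2 (x - z) * \<phi> z - \<phi>2 z * \<phi> (x - z)" for z
  have B1: "norm (\<phi>2 (x - z) * \<phi> z) \<le> \<Phi> 0 * E (1 + \<bar>x\<bar>) z" for z
    unfolding norm_mult
    by (rule mult_mono[OF \<phi>2_le order_trans[OF \<phi>_bd]]) (auto intro: E_mono)
  have B2: "norm (\<phi>2 z * \<phi> (x - z)) \<le> \<Phi> 0 * E (1 + \<bar>x\<bar>) z" for z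
    unfolding norm_mult
    by (rule mult_mono[OF \<phi>2_le order_trans[OF \<phi>_bd]]) (auto intro: E_mono)
  have c1: "continuous_on UNIV (\<lambda>z. \<phi>2 (x - z) * \<phi> z)"
    by (intro continuous_intros continuous_on_compose2[OF \<phi>2_cont] \<phi>_cont) auto
  have c2: "continuous_on UNIV (\<lambda>z. \<phi>2 z * \<phi> (x - z))"
    by (intro continuous_intros continuous_on_compose2[OF \<phi>_cont] \<phi>2_cont) auto
  have ii: "integrable lborel (\<lambda>z. \<Phi> 0 * E (1 + \<bar>x\<bar>) z)" by simp
  have i1: "integrable lborel (\<lambda>z. \<phi>2 (x - z) * \<phi> z)"
    by (rule Bochner_Integration.integrable_bound[OF ii]) (auto intro!: AE_I2 order_trans[OF B1])
  have i2: "integrable lborel (\<lambda>z. \<phi>2 z * \<phi> (x - z))"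
    by (rule Bochner_Integration.integrable_bound[OF ii]) (auto intro!: AE_I2 order_trans[OF B2])
  have coeff: "fourier H (2 * pi * of_int m) = 0" for m :: int
  proof -
    define v where "v = 2 * pi * of_int m"
    let ?e = "\<lambda>y. exp (- \<i> * of_real (v * y))"
    have ei: "integrable lborel (\<lambda>y. ?e y * \<phi> y)" "integrable lborel (\<lambda>y. ?e y * \<phi>2 y)"
      by (rule integrable_fourier[OF \<phi>_int], rule integrable_fourier[OF \<phi>2_int])
    have ec: "continuous_on UNIV (\<lambda>y. ?e y * \<phi>2 y)"
      by (intro continuous_intros \<phi>2_cont)
    have en: "norm (?e y * \<phi>2 y) \<le> \<Phi> 0" for y using \<phi>2_le by (simp add: norm_mult)
    let ?h = "\<lambda>x. LINT y|lborel. \<phi>2 (x - y) * (?e y * \<phi> y)"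
    let ?h' = "\<lambda>x. LINT y|lborel. (?e (x - y) * \<phi>2 (x - y)) * \<phi> y"
    note C = convolution[OF \<phi>2_int \<phi>2_cont \<phi>2_le ei(1)]
    note C' = convolution[OF ei(2) ec en \<phi>_int]
    have "?h x = ?h' x"
    proof (rule fourier_inject[OF C(1-3) C'(1-3)])
      show "AE u in lborel. fourier ?h u = fourier ?h' u"
        using refine_double
      proof eventually_elim
        case (elim u)
        have "fourier ?h u = fourier \<phi> (2 * u) * fourier \<phi> (u + v)"
          unfolding C(4) fourier_modulate fourier_\<phi>2 ..
        \<comment> \<open>Both sides equal
          \<open>m0 u * fourier \<phi> u * fourier \<phi> (u + v)\<close>: since \<open>v\<close> is
          a multiple of \<open>2 * pi\<close>, the mask takes the same value at \<open>u\<close> and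
          at \<open>u + v\<close>.\<close>
        also have "\<dots> = fourier \<phi> (2 * (u + v)) * fourier \<phi> u"
          using elim[rule_format, of 0] elim[rule_format, of m] by (simp add: v_def)
        also have "\<dots> = fourier ?h' u" unfolding C'(4) fourier_modulate fourier_\<phi>2 ..
        finally show ?case .
      qed
    qed
    moreover have "?h x = fourier (\<lambda>z. \<phi>2 (x - z) * \<phi> z) v"
      unfolding fourier_def by (simp add: mult_ac)
    moreover have "?h' x = fourier (\<lambda>z. \<phi>2 z * \<phi> (x - z)) v"
      unfolding fourier_def
      by (subst (2) lborel_integral_real_affine[where c="-1" and t=x]) (simp_all add: mult_ac)
    ultimately show ?thesis unfolding H_def v_def[symmetric] using i1 i2 by (simp add: fourier_cdiff)
  qed
  have Hb: "norm (H z) \<le> 2 * \<Phi> 0 * E (1 + \<bar>x\<bar>) z" for z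
    unfolding H_def using norm_triangle_ineq4[of "\<phi>2 (x - z) * \<phi> z" "\<phi>2 z * \<phi> (x - z)"] B1[of z] B2[of z] by linarith
  have "(LINT k|CI. H (y + of_int k)) = 0"
    by (rule lattice_sum_eq_0[OF Hb]) (use coeff c1 c2 in \<open>auto simp: H_def[abs_def] intro!: continuous_on_diff\<close>)
  moreover have "integrable CI (\<lambda>k. \<phi>2 (x - (y + of_int k)) * \<phi> (y + of_int k))"
    by (rule lattice_sum(1)[OF B1]) auto
  moreover have "integrable CI (\<lambda>k. \<phi>2 (y + of_int k) * \<phi> (x - (y + of_int k)))"
    by (rule lattice_sum(1)[OF B2]) auto
  ultimately show ?thesis unfolding H_def by (simp add: x_def algebra_simps)
qed

text \<open>The coefficients of the refinement equation \<open>\<phi> x = (\<Sum>k. h k * \<phi> (2 x - k))\<close>.\<close>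

definition h :: "int \<Rightarrow> complex" where
  "h k = 2 * (LINT y|lborel. \<phi>2 (y + of_int k) * cnj (\<phi> y))"

lemma \<phi>2_lattice: "integrable CI (\<lambda>k. \<phi>2 (y + of_int k))"
  "\<exists>C. \<forall>y. (LINT k|CI. norm (\<phi>2 (y + of_int k))) \<le> C"
proof -
  interpret e: envelope "\<lambda>x. \<Phi> (1/2 * x)" by (rule dilated_envelope) simp
  have eq: "e.E 2 x = E 1 (x / 2)" for x
    unfolding e.E_def E_def by (rule arg_cong[of _ _ \<Phi>]) (auto simp: max_def field_simps)
  have b: "norm (\<phi>2 x) \<le> e.E 2 x" for x
  proof -
    have "norm (\<phi>2 x) = norm (\<phi> (x / 2)) / 2" by (simp add: \<phi>2_def norm_divide)
    then show ?thesis using \<phi>_bd[of "x / 2"] E_nonneg[of 1 "x / 2"] unfolding eq by linarith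
  qed
  show 1: "integrable CI (\<lambda>k. \<phi>2 (y + of_int k))" for y
    by (rule e.lattice_sum(1)[where C=1 and r=2]) (use b in auto)
  have "(LINT k|CI. norm (\<phi>2 (y + of_int k))) \<le> e.latC 2" for y
  proof (rule order_trans[OF integral_mono e.lattice_le(1)])
    show "integrable CI (\<lambda>k. e.E 2 (y + of_int k))" by (rule e.lattice_integrable) simp
  qed (use 1 b in auto)
  then show "\<exists>C. \<forall>y. (LINT k|CI. norm (\<phi>2 (y + of_int k))) \<le> C" by blast
qed

text \<open>The lattice sums of \<open>\<phi>2\<close> are bounded uniformly in the base point, so
  summing over \<open>k\<close> under the integral costs only a constant times the norm of
  \<open>\<phi>\<close> in \<open>L_1\<close>. This is where absolute summability of the mask
  coefficients originates.\<close>

lemma h_int: "integrable CI h"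
proof -
  obtain C where C: "\<And>y. (LINT k|CI. norm (\<phi>2 (y + of_int k))) \<le> C" using \<phi>2_lattice(2) by blast
  have m: "(\<lambda>(y, k). \<phi>2 (y + of_int k) * cnj (\<phi> y)) \<in> borel_measurable (lborel \<Otimes>\<^sub>M CI)"
    by (rule measurable_pair_CI) simp
  have "integrable CI (\<lambda>k. LINT y|lborel. \<phi>2 (y + of_int k) * cnj (\<phi> y))"
    by (rule Fubini_dom(5)[where g="\<lambda>y k. norm (\<phi>2 (y + of_int k)) * norm (\<phi> y)" and h="\<lambda>y. C * norm (\<phi> y)",
          OF lborel.sigma_finite_measure_axioms sigma_finite_CI m])
      (use \<phi>2_lattice(1) \<phi>_int in \<open>auto simp: norm_mult intro!: mult_right_mono C\<close>)
  then show ?thesis unfolding h_def by simp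
qed

text \<open>The symmetry identity at \<open>a = 2 * x\<close> is multiplied by
  \<open>cnj (\<phi> y)\<close> and integrated over \<open>y\<close>. On one side orthonormality
  leaves only the term \<open>k = 0\<close>, which is \<open>\<phi>2 a\<close>; on the other the
  integrals over \<open>y\<close> are by definition \<open>h k / 2\<close>.\<close>

lemma refinement: "\<phi> x = (LINT k|CI. h k * \<phi> (2 * x - of_int k))"
proof -
  define a where "a = 2 * x"
  let ?L = "\<lambda>y k. \<phi>2 (a - of_int k) * \<phi> (y + of_int k) * cnj (\<phi> y)"
  let ?R = "\<lambda>y k. \<phi>2 (y + of_int k) * \<phi> (a - of_int k) * cnj (\<phi> y)"
  have [measurable]: "case_prod ?L \<in> borel_measurable (lborel \<Otimes>\<^sub>M CI)" "case_prod ?R \<in> borel_measurable (lborel \<Otimes>\<^sub>M CI)"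
    by (rule measurable_pair_CI, measurable)+
  have "(LINT y|lborel. LINT k|CI. ?L y k) = (LINT k|CI. LINT y|lborel. ?L y k)"
    by (rule Fubini_dom(6)[symmetric, where g="\<lambda>y k. \<Phi> 0 * E 1 (y + of_int k) * norm (\<phi> y)" and h="\<lambda>y. \<Phi> 0 * latC 1 * norm (\<phi> y)",
          OF lborel.sigma_finite_measure_axioms sigma_finite_CI])
      (use \<phi>_int in \<open>auto simp: norm_mult intro!: mult_mono mult_left_mono lattice_le \<phi>2_le \<phi>_bd\<close>)
  also have "\<dots> = (LINT k|CI. (if k = 0 then \<phi>2 a else 0))"
  proof (rule Bochner_Integration.integral_cong)
    fix k :: int
    have "(LINT y|lborel. ?L y k) = \<phi>2 (a - of_int k) * (LINT y|lborel. \<phi> (y - of_int (-k)) * cnj (\<phi> (y - of_int 0)))"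
      by (simp add: mult.assoc)
    also have "\<dots> = \<phi>2 (a - of_int k) * (if k = 0 then 1 else 0)" by (subst ortho) simp
    finally show "(LINT y|lborel. ?L y k) = (if k = 0 then \<phi>2 a else 0)" by simp
  qed simp
  also have "\<dots> = \<phi>2 a" using integral_CI_single(1)[of 0 "\<lambda>k. if k = 0 then \<phi>2 a else 0"] by simp
  finally have L: "(LINT y|lborel. LINT k|CI. ?L y k) = \<phi>2 a" .
  have "(LINT y|lborel. LINT k|CI. ?R y k) = (LINT k|CI. LINT y|lborel. ?R y k)"
    by (rule Fubini_dom(6)[symmetric, where g="\<lambda>y k. \<Phi> 0 * E 1 (a - of_int k) * norm (\<phi> y)" and h="\<lambda>y. \<Phi> 0 * latC 1 * norm (\<phi> y)",
          OF lborel.sigma_finite_measure_axioms sigma_finite_CI])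
      (use \<phi>_int in \<open>auto simp: norm_mult intro!: mult_mono mult_left_mono lattice_le \<phi>2_le \<phi>_bd\<close>)
  also have "\<dots> = (LINT k|CI. (h k * \<phi> (a - of_int k)) / 2)"
  proof (rule Bochner_Integration.integral_cong)
    fix k :: int
    have "(LINT y|lborel. ?R y k) = (LINT y|lborel. \<phi> (a - of_int k) * (\<phi>2 (y + of_int k) * cnj (\<phi> y)))"
      by (simp add: mult_ac)
    also have "\<dots> = (h k * \<phi> (a - of_int k)) / 2" by (simp add: h_def)
    finally show "(LINT y|lborel. ?R y k) = (h k * \<phi> (a - of_int k)) / 2" .
  qed simp
  finally have R: "(LINT y|lborel. LINT k|CI. ?R y k) = (LINT k|CI. h k * \<phi> (a - of_int k)) / 2" by simp
  have "(LINT k|CI. ?L y k) = (LINT k|CI. ?R y k)" for y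
    using zak_symmetry[of a y] by simp
  with L R have "\<phi>2 a = (LINT k|CI. h k * \<phi> (a - of_int k)) / 2" by (simp only:)
  then show ?thesis by (simp add: a_def \<phi>2_def)
qed

end


section \<open>Mask coefficients and the two-scale identity of the kernels\<close>

lemma sum_along_injection:
  fixes a :: "int \<Rightarrow> 'a::{banach, second_countable_topology}"
  assumes a: "integrable CI a" and \<sigma>: "inj \<sigma>"
  shows "integrable CI (\<lambda>l. a (\<sigma> l))"
    and "(LINT l|CI. a (\<sigma> l)) = (LINT k|CI. (if k \<in> range \<sigma> then a k else 0))"
    and "integrable CI (\<lambda>k. if k \<in> range \<sigma> then a k else 0)"
proof -
  \<comment> \<open>The array supported on the graph of \<open>\<sigma>\<close> is summed in both
    orders: columns give \<open>a (\<sigma> l)\<close>, rows give \<open>a\<close> restricted to the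
    range.\<close>
  let ?f = "\<lambda>k l. if k = \<sigma> l then a k else 0"
  have S: "(LINT l|CI. ?f k l) = (if k \<in> range \<sigma> then a k else 0)" "integrable CI (?f k)"
      "(LINT l|CI. norm (?f k l)) = (if k \<in> range \<sigma> then norm (a k) else 0)" for k
  proof -
    have "(LINT l|CI. ?f k l) = (if k \<in> range \<sigma> then a k else 0) \<and> integrable CI (?f k) \<and>
      (LINT l|CI. norm (?f k l)) = (if k \<in> range \<sigma> then norm (a k) else 0)"
    proof (cases "k \<in> range \<sigma>")
      case True
      then obtain m where m: "k = \<sigma> m" by auto
      have "?f k l = 0" "norm (?f k l) = 0" if "l \<noteq> m" for l using that m \<sigma> by (auto dest: injD)
      with m show ?thesis
        using integral_CI_single[of m "?f k"] integral_CI_single[of m "\<lambda>l. norm (?f k l)"] by auto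
    next
      case False
      then have "?f k = (\<lambda>_. 0)" "(\<lambda>l. norm (?f k l)) = (\<lambda>_. 0)" by (auto simp: fun_eq_iff)
      then show ?thesis using False by simp
    qed
    then show "(LINT l|CI. ?f k l) = (if k \<in> range \<sigma> then a k else 0)" "integrable CI (?f k)"
      "(LINT l|CI. norm (?f k l)) = (if k \<in> range \<sigma> then norm (a k) else 0)" by auto
  qed
  have T: "(LINT k|CI. ?f k l) = a (\<sigma> l)" for l
    using integral_CI_single(1)[of "\<sigma> l" "\<lambda>k. ?f k l"] by auto
  have m: "case_prod ?f \<in> borel_measurable (CI \<Otimes>\<^sub>M CI)"
    by (rule measurable_pair_CI) simp
  note D = Fubini_dom[OF sigma_finite_CI sigma_finite_CI m, where g="\<lambda>k l. norm (?f k l)" and h="\<lambda>k. norm (a k)"]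
  have "integrable CI (\<lambda>l. LINT k|CI. ?f k l)"
    by (rule D(5)) (use S a in auto)
  then show "integrable CI (\<lambda>l. a (\<sigma> l))" unfolding T .
  have "(LINT l|CI. LINT k|CI. ?f k l) = (LINT k|CI. LINT l|CI. ?f k l)"
    by (rule D(6)) (use S a in auto)
  then show "(LINT l|CI. a (\<sigma> l)) = (LINT k|CI. (if k \<in> range \<sigma> then a k else 0))" unfolding T S .
  have "integrable CI (\<lambda>k. LINT l|CI. ?f k l)"
    by (rule D(3)) (use S a in auto)
  then show "integrable CI (\<lambda>k. if k \<in> range \<sigma> then a k else 0)" unfolding S .
qed

lemma inj_sub_double: "inj (\<lambda>l. m - 2 * l :: int)" by (auto intro: injI)

lemma sum_sub_double_le:
  fixes a :: "int \<Rightarrow> complex"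
  assumes "integrable CI a"
  shows "(LINT l|CI. norm (a (m - 2 * l))) \<le> (LINT k|CI. norm (a k))"
  unfolding sum_along_injection(2)[OF integrable_norm[OF assms] inj_sub_double]
  by (rule integral_mono)
    (use sum_along_injection(3)[OF integrable_norm[OF assms] inj_sub_double] assms in auto)

text \<open>Both progressions have step 2, and as \<open>a + b\<close> is odd they run through
  complementary parity classes.\<close>

lemma sum_parity_split:
  fixes F :: "int \<Rightarrow> complex"
  assumes F: "integrable CI F" and "odd (a + b)"
  shows "(LINT l|CI. F (a - 2 * l)) + (LINT l|CI. F (b - 2 * l)) = (LINT k|CI. F k)"
proof -
  have r: "k \<in> range (\<lambda>l. a - 2 * l) \<longleftrightarrow> even (k + a)" for k a :: int
  proof
    assume "even (k + a)"
    then have "even (a - k)" by presburger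
    then obtain l where "a - k = 2 * l" by (elim evenE)
    then have "k = a - 2 * l" by simp
    then show "k \<in> range (\<lambda>l. a - 2 * l)" by blast
  qed auto
  have "(LINT l|CI. F (a - 2 * l)) + (LINT l|CI. F (b - 2 * l)) =
    (LINT k|CI. (if k \<in> range (\<lambda>l. a - 2 * l) then F k else 0) + (if k \<in> range (\<lambda>l. b - 2 * l) then F k else 0))"
    unfolding sum_along_injection(2)[OF F inj_sub_double]
    by (rule Bochner_Integration.integral_add[symmetric]) (rule sum_along_injection(3)[OF F inj_sub_double])+
  also have "\<dots> = (LINT k|CI. F k)"
    unfolding r using assms(2) by (intro Bochner_Integration.integral_cong) auto
  finally show ?thesis .
qed

definition kernel :: "(real \<Rightarrow> complex) \<Rightarrow> real \<Rightarrow> real \<Rightarrow> complex" where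
  "kernel f x y = (LINT k|CI. f (x - of_int k) * cnj (f (y - of_int k)))"

context wavelet_pair
begin

definition "h_norm = (LINT k|CI. norm (h k))"

lemma h_le: "norm (h k) \<le> h_norm"
proof -
  have "norm (h k) = (LINT j|CI. (if j = k then norm (h j) else 0))"
    using integral_CI_single(1)[of k "\<lambda>j. if j = k then norm (h j) else 0"] by simp
  also have "\<dots> \<le> h_norm" unfolding h_norm_def
    by (rule integral_mono) (use h_int integral_CI_single(2)[of k "\<lambda>j. if j = k then norm (h j) else 0"] in auto)
  finally show ?thesis .
qed

lemma \<phi>_affine_int: "integrable lborel (\<lambda>x. \<phi> (2 * x - t))" "integrable lborel (\<lambda>x. \<phi> (x - t))"
  using lborel_integrable_real_affine[OF \<phi>_int, of 2 "-t"] lborel_integrable_real_affine[OF \<phi>_int, of 1 "-t"] by auto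

lemma \<phi>_lattice: "integrable CI (\<lambda>k. \<phi> (x - of_int k))" "(LINT k|CI. norm (\<phi> (x - of_int k))) \<le> latC 1"
proof -
  have e: "integrable CI (\<lambda>k. E 1 (x - of_int k))" by simp
  show 1: "integrable CI (\<lambda>k. \<phi> (x - of_int k))"
    by (rule Bochner_Integration.integrable_bound[OF e]) (auto intro!: AE_I2 \<phi>_bd)
  show "(LINT k|CI. norm (\<phi> (x - of_int k))) \<le> latC 1"
    by (rule order_trans[OF integral_mono[OF integrable_norm[OF 1] e] lattice_le(2)]) (auto intro: \<phi>_bd)
qed

lemma ortho_double: "(LINT x|lborel. \<phi> (2 * x - of_int k) * cnj (\<phi> (2 * x - of_int l))) = (if k = l then 1/2 else 0)"
proof -
  have "(LINT x|lborel. \<phi> (2 * x - of_int k) * cnj (\<phi> (2 * x - of_int l)))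
    = (LINT x|lborel. \<phi> (x - of_int k) * cnj (\<phi> (x - of_int l))) / 2"
    by (subst (2) lborel_integral_real_affine[where c=2 and t=0]) (auto simp: scaleR_conv_of_real)
  then show ?thesis unfolding ortho by (auto split: if_splits)
qed

lemma cross_product: "(LINT x|lborel. \<phi> (2 * x - of_int k) * cnj (\<phi> (x - of_int l))) = cnj (h (k - 2 * l)) / 2"
proof -
  have eq: "\<phi> (x - of_int l) = (LINT m|CI. h m * \<phi> (2 * x - of_int (2 * l + m)))" for x
    by (subst refinement) (simp add: algebra_simps)
  have "(LINT x|lborel. \<phi> (x - of_int l) * cnj (\<phi> (2 * x - of_int k)))
    = (LINT m|CI. h m * (LINT x|lborel. \<phi> (2 * x - of_int (2 * l + m)) * cnj (\<phi> (2 * x - of_int k))))"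
    unfolding eq
    by (rule sum_integral_swap(1)[where B="\<Phi> 0", OF h_int]) (auto intro: \<phi>_le \<phi>_affine_int)
  also have "\<dots> = (LINT m|CI. h m * (if 2 * l + m = k then 1/2 else 0))"
    unfolding ortho_double ..
  also have "\<dots> = h (k - 2 * l) / 2"
    by (subst integral_CI_single(1)[of "k - 2 * l"]) auto
  finally have "cnj (LINT x|lborel. \<phi> (x - of_int l) * cnj (\<phi> (2 * x - of_int k))) = cnj (h (k - 2 * l) / 2)"
    by (rule arg_cong)
  then show ?thesis
    unfolding Bochner_Integration.integral_cnj[symmetric] by (simp add: mult.commute)
qed

text \<open>This is orthonormality of the translates read at the finer scale: one factor is expanded
  by the refinement equation and the cross terms are \<open>cross_product\<close>. The 2 compensates
  the squared norm 1/2 of \<open>\<phi> (2 * x - k)\<close>.\<close>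

lemma h_ortho: "(LINT k|CI. h k * cnj (h (k - 2 * l))) = (if l = 0 then 2 else 0)"
proof -
  have "(if l = 0 then 1 else 0) = (LINT x|lborel. \<phi> x * cnj (\<phi> (x - of_int l)))"
    by (rule ortho0[symmetric])
  also have "\<dots> = (LINT x|lborel. (LINT k|CI. h k * \<phi> (2 * x - of_int k)) * cnj (\<phi> (x - of_int l)))"
    by (subst refinement) simp
  also have "\<dots> = (LINT k|CI. h k * (LINT x|lborel. \<phi> (2 * x - of_int k) * cnj (\<phi> (x - of_int l))))"
    by (rule sum_integral_swap(1)[where B="\<Phi> 0", OF h_int]) (auto intro: \<phi>_le \<phi>_affine_int)
  also have "\<dots> = (LINT k|CI. h k * cnj (h (k - 2 * l))) / 2"
    unfolding cross_product by simp
  finally show ?thesis by (auto split: if_splits simp: field_simps)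
qed

text \<open>Series in translates are recognized through their transforms: the last conclusion
  factors the transform into a trigonometric series and \<open>fourier \<phi>\<close>, the others
  are what \<open>fourier_inject\<close> asks for.\<close>

lemma translates:
  fixes a :: "int \<Rightarrow> complex"
  assumes a: "integrable CI a"
  defines "F \<equiv> \<lambda>x. LINT k|CI. a k * \<phi> (x - of_int k)"
  shows "integrable lborel F" "continuous_on UNIV F" "\<And>x. norm (F x) \<le> (LINT k|CI. norm (a k)) * \<Phi> 0"
    "fourier F u = (LINT k|CI. a k * exp (- \<i> * of_real (u * of_int k))) * fourier \<phi> u"
proof -
  let ?f = "\<lambda>u k x. exp (- \<i> * of_real (u * x)) * (a k * \<phi> (x - of_int k))"
  have m: "(\<lambda>(k, x). ?f u k x) \<in> borel_measurable (CI \<Otimes>\<^sub>M lborel)" for u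
    by (rule measurable_pair_measure_countable1) auto
  have sh: "(LINT x|lborel. norm (\<phi> (x - of_int k))) = (LINT x|lborel. norm (\<phi> x))" for k :: int
    by (subst lborel_integral_real_affine[where c=1 and t="of_int k"]) auto
  note D = Fubini_dom[OF sigma_finite_CI lborel.sigma_finite_measure_axioms m,
      where g="\<lambda>k x. norm (a k) * norm (\<phi> (x - of_int k))" and h="\<lambda>k. norm (a k) * (LINT x|lborel. norm (\<phi> x))"]
  have "integrable lborel (\<lambda>x. LINT k|CI. ?f 0 k x)"
    by (rule D(5)) (use a \<phi>_affine_int sh in \<open>auto simp: norm_mult\<close>)
  then show "integrable lborel F" by (simp add: F_def)
  have sw: "(LINT x|lborel. LINT k|CI. ?f u k x) = (LINT k|CI. LINT x|lborel. ?f u k x)"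
    by (rule D(6)) (use a \<phi>_affine_int sh in \<open>auto simp: norm_mult\<close>)
  have "fourier F u = (LINT x|lborel. LINT k|CI. ?f u k x)"
    unfolding fourier_def F_def by (simp only: integral_mult_right_zero)
  also have "\<dots> = (LINT k|CI. a k * fourier (\<lambda>x. \<phi> (x - of_int k)) u)"
    unfolding sw fourier_def by (simp only: mult.left_commute[of _ "a _"] integral_mult_right_zero)
  also have "\<dots> = (LINT k|CI. a k * exp (- \<i> * of_real (u * of_int k))) * fourier \<phi> u"
    unfolding fourier_shift by (simp only: mult.assoc[symmetric] integral_mult_left_zero)
  finally show "fourier F u = (LINT k|CI. a k * exp (- \<i> * of_real (u * of_int k))) * fourier \<phi> u" .
  have w: "integrable CI (\<lambda>k. norm (a k) * \<Phi> 0)" using a by simp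
  have i: "integrable CI (\<lambda>k. a k * \<phi> (x - of_int k))" for x
    by (rule Bochner_Integration.integrable_bound[OF w]) (auto simp: norm_mult intro!: AE_I2 mult_left_mono \<phi>_le)
  show "norm (F x) \<le> (LINT k|CI. norm (a k)) * \<Phi> 0" for x
  proof -
    have "norm (F x) \<le> (LINT k|CI. norm (a k * \<phi> (x - of_int k)))"
      unfolding F_def by (rule integral_norm_bound)
    also have "\<dots> \<le> (LINT k|CI. norm (a k) * \<Phi> 0)"
      by (rule integral_mono[OF integrable_norm[OF i] w]) (auto simp: norm_mult intro!: mult_left_mono \<phi>_le)
    finally show ?thesis by simp
  qed
  show "continuous_on UNIV F" unfolding F_def
  proof (rule continuous_CI_sum)
    show "continuous_on UNIV (\<lambda>x. a k * \<phi> (x - of_int k))" for k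
      by (intro continuous_intros continuous_on_compose2[OF \<phi>_cont]) auto
    show "\<exists>w. integrable CI w \<and> (\<forall>x k. \<bar>x - x0\<bar> < 1 \<longrightarrow> norm (a k * \<phi> (x - of_int k)) \<le> w k)" for x0
      using w by (intro exI[of _ "\<lambda>k. norm (a k) * \<Phi> 0"]) (auto simp: norm_mult intro!: mult_left_mono \<phi>_le)
  qed
qed

text \<open>The absolutely convergent trigonometric series that turns out to be a version of
  \<open>m0\<close>.\<close>

definition symb :: "real \<Rightarrow> complex" where
  "symb u = (LINT k|CI. h k * exp (- \<i> * of_real (u * of_int k))) / 2"

lemma symb_refine: "fourier \<phi> (2 * u) = symb u * fourier \<phi> u"
proof -
  have "\<phi>2 = (\<lambda>x. LINT k|CI. (h k / 2) * \<phi> (x - of_int k))"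
    unfolding \<phi>2_def by (rule ext, subst refinement) simp
  then have "fourier \<phi>2 u = (LINT k|CI. (h k / 2) * exp (- \<i> * of_real (u * of_int k))) * fourier \<phi> u"
    using translates(4)[of "\<lambda>k. h k / 2" u] h_int by simp
  then show ?thesis by (simp add: fourier_\<phi>2 symb_def)
qed

lemma symb_per: "symb (u + 2 * pi * of_int k) = symb u"
proof -
  have "exp (- \<i> * of_real ((u + 2 * pi * of_int k) * of_int j)) = exp (- \<i> * of_real (u * of_int j))" for j :: int
  proof -
    have "- \<i> * of_real ((u + 2 * pi * of_int k) * of_int j) = - \<i> * of_real (u * of_int j) + \<i> * of_real (2 * pi * of_int (- k * j))"
      by (simp add: algebra_simps)
    then show ?thesis by (simp only: exp_add exp_2pi_int mult_1_right)
  qed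
  then show ?thesis unfolding symb_def by (simp only:)
qed

text \<open>Both masks multiply \<open>fourier \<phi>\<close> to the same function and both have
  period \<open>2 * pi\<close>. For almost every \<open>u\<close> the squares along
  \<open>u + 2 * pi * k\<close> sum to 1, so some translate of the transform is nonzero there and
  can be cancelled.\<close>

lemma m0_eq_symb: "AE u in lborel. m0 u = symb u"
  using refine_double \<phi>h_sum
proof eventually_elim
  case (elim u)
  have "\<exists>k::int. fourier \<phi> (u + 2 * pi * of_int k) \<noteq> 0"
  proof (rule ccontr)
    assume "\<not> ?thesis"
    with elim(2) show False by simp
  qed
  then obtain k :: int where k: "fourier \<phi> (u + 2 * pi * of_int k) \<noteq> 0" by auto
  have "m0 u * fourier \<phi> (u + 2 * pi * of_int k) = symb u * fourier \<phi> (u + 2 * pi * of_int k)"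
    using elim(1)[rule_format, of k] symb_refine[of "u + 2 * pi * of_int k"] unfolding symb_per by simp
  with k show ?case by simp
qed

text \<open>Read off from \<open>cnj (symb (u + pi)) * exp (- \<i> * u)\<close>: the shift by
  \<open>pi\<close> produces the alternating sign, conjugation reverses the index, and the
  exponential moves it by one.\<close>

definition g :: "int \<Rightarrow> complex" where
  "g k = (if even k then - 1 else 1) * cnj (h (1 - k))"

lemma g_int: "integrable CI g"
proof -
  have "integrable CI (\<lambda>k. h (1 - k))" using h_int by (simp add: integrable_CI_reindex)
  then have "integrable CI (\<lambda>k. cnj (h (1 - k)))" by simp
  then show ?thesis
    by (rule Bochner_Integration.integrable_bound) (auto simp: g_def)
qed

lemma exp_i_pi_int: "exp (\<i> * of_real (pi * of_int k)) = (if even k then 1 else - 1)"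
proof (cases "even k")
  case True
  then obtain l where "k = 2 * l" by (elim evenE)
  then show ?thesis using exp_2pi_int[of l] by (simp add: mult_ac)
next
  case False
  then obtain l where l: "k = 2 * l + 1" by (elim oddE)
  have "exp (\<i> * of_real (pi * of_int k)) = exp (\<i> * of_real (2 * pi * of_int l)) * exp (\<i> * of_real pi)"
    unfolding exp_add[symmetric] l by (simp add: algebra_simps)
  then show ?thesis using False exp_2pi_int[of l] by (simp add: exp_pi_i')
qed

lemma wavelet_equation: "\<psi> x = (LINT k|CI. g k * \<phi> (2 * x - of_int k))"
proof -
  define Q where "Q x = \<psi> (x / 2) / 2" for x
  define F where "F = (\<lambda>x. LINT k|CI. (g k / 2) * \<phi> (x - of_int k))"
  have g2: "integrable CI (\<lambda>k. g k / 2)" using g_int by simp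
  note T = translates[OF g2, folded F_def]
  have Fb: "norm (F x) \<le> (LINT k|CI. norm (g k / 2)) * \<Phi> 0" for x
    unfolding F_def by (rule translates(3)[OF g2])
  have Qi: "integrable lborel Q"
    unfolding Q_def using lborel_integrable_real_affine[OF \<psi>_int, of "1/2" 0] by simp
  have Qc: "continuous_on UNIV Q"
    unfolding Q_def by (intro continuous_intros continuous_on_compose2[OF \<psi>_cont]) auto
  have Qb: "norm (Q x) \<le> \<Phi> 0 / 2" for x unfolding Q_def using \<psi>_le[of "x/2"] by (simp add: norm_divide)
  have "AE u in lborel. fourier Q u = fourier F u"
  proof -
    have "AE u in lborel. fourier \<psi> (0 + 2 * u) = cnj (m0 ((0 + 2 * u) / 2 + pi)) * exp (- \<i> * of_real ((0 + 2 * u) / 2)) * fourier \<phi> ((0 + 2 * u) / 2)"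
      by (rule AE_lborel_affine[OF \<psi>h]) simp
    moreover have "AE u in lborel. m0 (pi + 1 * u) = symb (pi + 1 * u)"
      by (rule AE_lborel_affine[OF m0_eq_symb]) simp
    ultimately show ?thesis
    proof eventually_elim
      case (elim u)
      have "fourier Q u = cnj (symb (u + pi)) * exp (- \<i> * of_real u) * fourier \<phi> u"
        using elim unfolding Q_def fourier_scale by (simp add: add.commute)
      moreover have "cnj (symb (u + pi)) * exp (- \<i> * of_real u) = (LINT k|CI. (g k / 2) * exp (- \<i> * of_real (u * of_int k)))"
      proof -
        have "cnj (symb (u + pi)) * exp (- \<i> * of_real u) =
          (LINT k|CI. cnj (h k) * exp (\<i> * of_real ((u + pi) * of_int k)) / 2 * exp (- \<i> * of_real u))"
        proof -
          have "cnj (symb (u + pi)) = (LINT k|CI. cnj (h k * exp (- \<i> * of_real ((u + pi) * of_int k)))) / 2"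
            unfolding symb_def Bochner_Integration.integral_cnj by simp
          also have "\<dots> = (LINT k|CI. cnj (h k) * exp (\<i> * of_real ((u + pi) * of_int k)) / 2)"
            by (simp add: exp_cnj)
          finally show ?thesis by (simp only: integral_mult_left_zero)
        qed
        \<comment> \<open>Reflecting the index by \<open>k\<close> to \<open>1 - k\<close> absorbs
          the factor \<open>exp (- \<i> * u)\<close>.\<close>
        also have "\<dots> = (LINT k|CI. cnj (h (1 - k)) * exp (\<i> * of_real ((u + pi) * of_int (1 - k))) / 2 * exp (- \<i> * of_real u))"
          by (rule integral_CI_reindex[symmetric]) simp
        also have "\<dots> = (LINT k|CI. (g k / 2) * exp (- \<i> * of_real (u * of_int k)))"
        proof (rule Bochner_Integration.integral_cong)
          fix k :: int
          have "exp (\<i> * of_real ((u + pi) * of_int (1 - k))) * exp (- \<i> * of_real u)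
             = exp (\<i> * of_real (pi * of_int (1 - k))) * exp (- \<i> * of_real (u * of_int k))"
            unfolding exp_add[symmetric] by (simp add: algebra_simps)
          then show "cnj (h (1 - k)) * exp (\<i> * of_real ((u + pi) * of_int (1 - k))) / 2 * exp (- \<i> * of_real u) = (g k / 2) * exp (- \<i> * of_real (u * of_int k))"
            unfolding exp_i_pi_int g_def by (auto simp: field_simps)
        qed simp
        finally show ?thesis .
      qed
      ultimately show ?case unfolding T(4) by (simp only:)
    qed
  qed
  from fourier_inject[OF Qi Qc Qb T(1,2) Fb this] have "Q (2 * x) = F (2 * x)" .
  then show ?thesis by (simp add: Q_def F_def)
qed

text \<open>The coefficient at \<open>(m, n)\<close> when the kernel of the function with refinement
  coefficients \<open>a\<close> is expanded in the translates of \<open>\<phi>\<close> at the next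
  finer scale.\<close>

definition "mask_gram a m n = (LINT l|CI. a (m - 2 * l) * cnj (a (n - 2 * l)))" for a :: "int \<Rightarrow> complex"

text \<open>Up to the sign \<open>(-1)^(m + n)\<close>, the \<open>g\<close> part sums the same
  products \<open>F\<close> as the \<open>h\<close> part, but along the progression through
  \<open>1 - n\<close> instead of \<open>m\<close>. For even \<open>m + n\<close> the two
  progressions have opposite parity and together give the full sum, known from
  \<open>h_ortho\<close>; for odd \<open>m + n\<close> they coincide and the sign cancels
  them.\<close>

lemma completeness: "mask_gram h m n + mask_gram g m n = (if m = n then 2 else 0)"
proof -
  define F where "F j = h j * cnj (h (j - (m - n)))" for j
  have Fi: "integrable CI F"
  proof (rule Bochner_Integration.integrable_bound[OF integrable_mult_left[OF integrable_norm[OF h_int], of h_norm]])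
    have "norm (F j) \<le> norm (h j) * h_norm" for j
      unfolding F_def norm_mult complex_mod_cnj by (intro mult_left_mono h_le norm_ge_zero)
    then show "AE j in CI. norm (F j) \<le> norm (norm (h j) * h_norm)"
      by (intro AE_I2) (auto intro: order_trans[OF _ abs_ge_self])
  qed simp
  have A: "mask_gram h m n = (LINT l|CI. F (m - 2 * l))"
    unfolding mask_gram_def F_def by (simp add: algebra_simps)
  have B: "mask_gram g m n = (if even (m + n) then 1 else - 1) * (LINT l|CI. F ((1 - n) - 2 * l))"
  proof -
    have "mask_gram g m n = (LINT l|CI. (if even (m + n) then 1 else - 1) * F ((1 - n) - 2 * (- l)))"
      unfolding mask_gram_def F_def g_def by (intro Bochner_Integration.integral_cong) (auto simp: algebra_simps)
    also have "\<dots> = (if even (m + n) then 1 else - 1) * (LINT l|CI. F ((1 - n) - 2 * (- l)))" by simp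
    also have "(LINT l|CI. F ((1 - n) - 2 * (- l))) = (LINT l|CI. F ((1 - n) - 2 * l))"
      by (rule integral_CI_reindex[OF bij_uminus_int, of "\<lambda>l. F ((1 - n) - 2 * l)"])
    finally show ?thesis .
  qed
  show ?thesis
  proof (cases "even (m + n)")
    case True
    then have "mask_gram h m n + mask_gram g m n = (LINT k|CI. F k)"
      unfolding A B using sum_parity_split[OF Fi, of m "1 - n"] by simp
    also have "\<dots> = (if m = n then 2 else 0)"
    proof -
      from True have "even (m - n)" by presburger
      then obtain q where q: "m - n = 2 * q" by (elim evenE)
      show ?thesis unfolding F_def q h_ortho using q by auto
    qed
    finally show ?thesis .
  next
    case False
    have "m - 2 * l = (1 - n) - 2 * (l - (m + n - 1) div 2)" for l
      using False by presburger
    then have "(LINT l|CI. F (m - 2 * l)) = (LINT l|CI. F ((1 - n) - 2 * (l - (m + n - 1) div 2)))"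
      by (simp only:)
    also have "\<dots> = (LINT l|CI. F ((1 - n) - 2 * l))"
      by (rule integral_CI_reindex[of "\<lambda>l. l - (m + n - 1) div 2" "\<lambda>l. F ((1 - n) - 2 * l)"]) simp
    finally show ?thesis unfolding A B using False by auto
  qed
qed

text \<open>Absolute summability of \<open>a\<close> bounds every inner sum by \<open>N\<close>, and
  the lattice sums of \<open>\<phi>\<close> bound the outer ones; that allows two exchanges.
  Afterwards \<open>a\<close> enters only through \<open>mask_gram\<close>, so the expansions for
  \<open>\<phi>\<close> and \<open>\<psi>\<close> can be added termwise.\<close>

lemma kernel_expand:
  fixes a :: "int \<Rightarrow> complex"
  assumes a: "integrable CI a" and f: "\<And>x. f x = (LINT k|CI. a k * \<phi> (2 * x - of_int k))"
  shows "kernel f x y = (LINT m|CI. \<phi> (2 * x - of_int m) * (LINT n|CI. cnj (\<phi> (2 * y - of_int n)) * mask_gram a m n))"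
    and "integrable CI (\<lambda>m. \<phi> (2 * x - of_int m) * (LINT n|CI. cnj (\<phi> (2 * y - of_int n)) * mask_gram a m n))"
    and "\<And>m. integrable CI (\<lambda>n. cnj (\<phi> (2 * y - of_int n)) * mask_gram a m n)"
proof -
  define N where "N = (LINT k|CI. norm (a k))"
  have aN: "norm (a k) \<le> N" for k
  proof -
    have "norm (a k) = (LINT j|CI. (if j = k then norm (a j) else 0))"
      using integral_CI_single(1)[of k "\<lambda>j. if j = k then norm (a j) else 0"] by simp
    also have "\<dots> \<le> N" unfolding N_def
      by (rule integral_mono) (use a integral_CI_single(2)[of k "\<lambda>j. if j = k then norm (a j) else 0"] in auto)
    finally show ?thesis .
  qed
  have N: "N \<ge> 0" using aN[of 0] norm_ge_zero order_trans by blast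
  have a2: "integrable CI (\<lambda>l. a (m - 2 * l))" "(LINT l|CI. norm (a (m - 2 * l))) \<le> N" for m
    unfolding N_def by (rule sum_along_injection(1)[OF a inj_sub_double], rule sum_sub_double_le[OF a])
  have fl: "f (x - of_int l) = (LINT m|CI. a (m - 2 * l) * \<phi> (2 * x - of_int m))" for x and l :: int
  proof -
    have "f (x - of_int l) = (LINT k|CI. (\<lambda>m. a (m - 2 * l) * \<phi> (2 * x - of_int m)) (k + 2 * l))"
      unfolding f by (simp add: algebra_simps)
    also have "\<dots> = (LINT m|CI. a (m - 2 * l) * \<phi> (2 * x - of_int m))"
      by (rule integral_CI_reindex) simp
    finally show ?thesis .
  qed
  have fb: "norm (f x) \<le> N * \<Phi> 0" for x
  proof -
    have "f x = (LINT k|CI. a k * \<phi> (2 * x - of_int k))" by (rule f)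
    also have "norm \<dots> \<le> N * \<Phi> 0" unfolding N_def by (rule translates(3)[OF a])
    finally show ?thesis .
  qed
  have m: "case_prod u \<in> borel_measurable (CI \<Otimes>\<^sub>M CI)" for u :: "int \<Rightarrow> int \<Rightarrow> complex"
    using measurable_pair_CI[of "\<lambda>k x. u x k" CI] by simp
  let ?f1 = "\<lambda>m l. a (m - 2 * l) * \<phi> (2 * x - of_int m) * cnj (f (y - of_int l))"
  note D1 = Fubini_dom[OF sigma_finite_CI sigma_finite_CI m, of ?f1 "\<lambda>m l. norm (a (m - 2 * l)) * norm (\<phi> (2 * x - of_int m)) * (N * \<Phi> 0)"
      "\<lambda>m. N * norm (\<phi> (2 * x - of_int m)) * (N * \<Phi> 0)"]
  have D1': "norm (?f1 m l) \<le> norm (a (m - 2 * l)) * norm (\<phi> (2 * x - of_int m)) * (N * \<Phi> 0)"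
    "integrable CI (\<lambda>l. norm (a (m - 2 * l)) * norm (\<phi> (2 * x - of_int m)) * (N * \<Phi> 0))"
    "integrable CI (\<lambda>m. N * norm (\<phi> (2 * x - of_int m)) * (N * \<Phi> 0))"
    "(LINT l|CI. norm (a (m - 2 * l)) * norm (\<phi> (2 * x - of_int m)) * (N * \<Phi> 0)) \<le> N * norm (\<phi> (2 * x - of_int m)) * (N * \<Phi> 0)" for m l
    using a2 \<phi>_lattice(1)[of "2 * x"] N
    by (auto simp: norm_mult intro!: mult_left_mono fb mult_right_mono)
  have inner: "(LINT l|CI. ?f1 m l) = \<phi> (2 * x - of_int m) * (LINT n|CI. cnj (\<phi> (2 * y - of_int n)) * mask_gram a m n)"
    and inner_int: "integrable CI (\<lambda>n. cnj (\<phi> (2 * y - of_int n)) * mask_gram a m n)" for m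
  proof -
    let ?f2 = "\<lambda>n l. a (m - 2 * l) * cnj (a (n - 2 * l) * \<phi> (2 * y - of_int n))"
    note D2 = Fubini_dom[OF sigma_finite_CI sigma_finite_CI m, of ?f2 "\<lambda>n l. norm (a (m - 2 * l)) * (N * norm (\<phi> (2 * y - of_int n)))"
      "\<lambda>n. N * (N * norm (\<phi> (2 * y - of_int n)))"]
    have D2': "norm (?f2 n l) \<le> norm (a (m - 2 * l)) * (N * norm (\<phi> (2 * y - of_int n)))"
      "integrable CI (\<lambda>l. norm (a (m - 2 * l)) * (N * norm (\<phi> (2 * y - of_int n))))"
      "integrable CI (\<lambda>n. N * (N * norm (\<phi> (2 * y - of_int n))))"
      "(LINT l|CI. norm (a (m - 2 * l)) * (N * norm (\<phi> (2 * y - of_int n)))) \<le> N * (N * norm (\<phi> (2 * y - of_int n)))" for n l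
      using a2 \<phi>_lattice(1)[of "2 * y"] N
      by (auto simp: norm_mult intro!: mult_left_mono aN mult_right_mono)
    have G: "(LINT l|CI. ?f2 n l) = cnj (\<phi> (2 * y - of_int n)) * mask_gram a m n" for n
    proof -
      have "?f2 n l = cnj (\<phi> (2 * y - of_int n)) * (a (m - 2 * l) * cnj (a (n - 2 * l)))" for l by simp
      then show ?thesis unfolding mask_gram_def by (simp only: integral_mult_right_zero)
    qed
    have "(LINT l|CI. LINT n|CI. ?f2 n l) = (LINT n|CI. LINT l|CI. ?f2 n l)"
      by (rule D2(6)) (use D2' in auto)
    then have 1: "(LINT l|CI. LINT n|CI. ?f2 n l) = (LINT n|CI. cnj (\<phi> (2 * y - of_int n)) * mask_gram a m n)"
      unfolding G .
    have 2: "(LINT n|CI. ?f2 n l) = a (m - 2 * l) * cnj (f (y - of_int l))" for l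
      unfolding fl by (simp only: integral_mult_right_zero Bochner_Integration.integral_cnj)
    have "?f1 m l = \<phi> (2 * x - of_int m) * (a (m - 2 * l) * cnj (f (y - of_int l)))" for l by simp
    then show "(LINT l|CI. ?f1 m l) = \<phi> (2 * x - of_int m) * (LINT n|CI. cnj (\<phi> (2 * y - of_int n)) * mask_gram a m n)"
      unfolding 1[symmetric] 2 by (simp only: integral_mult_right_zero)
    have "integrable CI (\<lambda>n. LINT l|CI. ?f2 n l)"
      by (rule D2(3)) (use D2' in auto)
    then show "integrable CI (\<lambda>n. cnj (\<phi> (2 * y - of_int n)) * mask_gram a m n)" unfolding G .
  qed
  show "integrable CI (\<lambda>n. cnj (\<phi> (2 * y - of_int n)) * mask_gram a m n)" for m by (rule inner_int)
  have "(LINT l|CI. LINT m|CI. ?f1 m l) = (LINT m|CI. LINT l|CI. ?f1 m l)"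
    by (rule D1(6)) (use D1' in auto)
  moreover have "(LINT m|CI. ?f1 m l) = f (x - of_int l) * cnj (f (y - of_int l))" for l
    unfolding fl[of x] by (simp only: integral_mult_left_zero)
  ultimately show "kernel f x y = (LINT m|CI. \<phi> (2 * x - of_int m) * (LINT n|CI. cnj (\<phi> (2 * y - of_int n)) * mask_gram a m n))"
    unfolding kernel_def inner by (simp only:)
  have "integrable CI (\<lambda>m. LINT l|CI. ?f1 m l)"
    by (rule D1(3)) (use D1' in auto)
  then show "integrable CI (\<lambda>m. \<phi> (2 * x - of_int m) * (LINT n|CI. cnj (\<phi> (2 * y - of_int n)) * mask_gram a m n))"
    unfolding inner .
qed

text \<open>At the finer scale only the sum of the two Gram matrices matters, and by
  \<open>completeness\<close> it is twice the identity.\<close>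

lemma kernel_two_scale: "kernel \<phi> x y + kernel \<psi> x y = 2 * kernel \<phi> (2 * x) (2 * y)"
proof -
  note P = kernel_expand(1,2)[where x=x and y=y, OF h_int refinement]
  note Q = kernel_expand(1,2)[where x=x and y=y, OF g_int wavelet_equation]
  have "kernel \<phi> x y + kernel \<psi> x y = (LINT m|CI. \<phi> (2 * x - of_int m) * (LINT n|CI. cnj (\<phi> (2 * y - of_int n)) * mask_gram h m n)
     + \<phi> (2 * x - of_int m) * (LINT n|CI. cnj (\<phi> (2 * y - of_int n)) * mask_gram g m n))"
    unfolding P(1) Q(1) using P(2) Q(2) by (rule Bochner_Integration.integral_add[symmetric])
  also have "\<dots> = (LINT m|CI. 2 * (\<phi> (2 * x - of_int m) * cnj (\<phi> (2 * y - of_int m))))"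
  proof (rule Bochner_Integration.integral_cong)
    fix m :: int
    have "(LINT n|CI. cnj (\<phi> (2 * y - of_int n)) * mask_gram h m n) + (LINT n|CI. cnj (\<phi> (2 * y - of_int n)) * mask_gram g m n)
      = (LINT n|CI. cnj (\<phi> (2 * y - of_int n)) * mask_gram h m n + cnj (\<phi> (2 * y - of_int n)) * mask_gram g m n)"
      by (intro Bochner_Integration.integral_add[symmetric] kernel_expand(3)[OF h_int refinement] kernel_expand(3)[OF g_int wavelet_equation])
    also have "\<dots> = (LINT n|CI. cnj (\<phi> (2 * y - of_int n)) * (if m = n then 2 else 0))"
      unfolding distrib_left[symmetric] completeness ..
    also have "\<dots> = 2 * cnj (\<phi> (2 * y - of_int m))"
      by (subst integral_CI_single(1)[of m]) auto
    finally show "\<phi> (2 * x - of_int m) * (LINT n|CI. cnj (\<phi> (2 * y - of_int n)) * mask_gram h m n)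
     + \<phi> (2 * x - of_int m) * (LINT n|CI. cnj (\<phi> (2 * y - of_int n)) * mask_gram g m n) = 2 * (\<phi> (2 * x - of_int m) * cnj (\<phi> (2 * y - of_int m)))"
      unfolding distrib_left[symmetric] by simp
  qed simp
  also have "\<dots> = 2 * kernel \<phi> (2 * x) (2 * y)" unfolding kernel_def by simp
  finally show ?thesis .
qed

end


section \<open>Reproduction of constants by the kernel\<close>

context wavelet_pair
begin

lemma measurable_CI_pair [measurable]: "u \<in> borel_measurable (CI \<Otimes>\<^sub>M CI)" for u :: "int \<times> int \<Rightarrow> complex"
  using measurable_pair_CI[of "\<lambda>k x. u (x, k)" CI] by simp

definition "mask_sum n = (LINT l|CI. h (n - 2 * l))"

lemma h_sub_double: "integrable CI (\<lambda>l. h (n - 2 * l))" "(LINT l|CI. norm (h (n - 2 * l))) \<le> h_norm"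
  unfolding h_norm_def by (rule sum_along_injection(1)[OF h_int inj_sub_double], rule sum_sub_double_le[OF h_int])

lemma mask_sum_parity: "mask_sum (n - 2 * q) = mask_sum n"
proof -
  have "mask_sum (n - 2 * q) = (LINT l|CI. (\<lambda>l. h (n - 2 * l)) (q + l))"
    unfolding mask_sum_def by (simp add: algebra_simps)
  also have "\<dots> = mask_sum n" unfolding mask_sum_def by (rule integral_CI_reindex) simp
  finally show ?thesis .
qed

text \<open>The sums of the mask coefficients over the even and the odd integers satisfy
  \<open>a + b = 2\<close> and \<open>|a|^2 + |b|^2 = 2\<close>, so both are 1.\<close>

lemma mask_sum_eq_1: "mask_sum n = 1"
proof -
  have "fourier \<phi> (2 * 0) = symb 0 * fourier \<phi> 0" by (rule symb_refine)
  then have "symb 0 = 1" using \<phi>h_0 by simp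
  then have s: "(LINT k|CI. h k) = 2" by (simp add: symb_def)
  have sum: "mask_sum 0 + mask_sum 1 = 2" unfolding mask_sum_def using sum_parity_split[OF h_int, of 0 1] s by simp
  let ?f = "\<lambda>k l. h k * cnj (h (k - 2 * l))"
  \<comment> \<open>Summing \<open>h_ortho\<close> over \<open>l\<close> gives 2. In the other order
    the sum over \<open>l\<close> is the conjugate of \<open>mask_sum k\<close>, which depends only
    on the parity of \<open>k\<close>; splitting by parity then yields the relation between the
    squared moduli.\<close>
  have "(LINT l|CI. LINT k|CI. ?f k l) = (LINT k|CI. LINT l|CI. ?f k l)"
    by (rule Fubini_dom(6)[OF sigma_finite_CI sigma_finite_CI, where g="\<lambda>k l. norm (h k) * norm (h (k - 2 * l))" and h="\<lambda>k. norm (h k) * h_norm"])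
      (use h_sub_double h_int in \<open>auto simp: norm_mult intro!: mult_left_mono\<close>)
  also have "(LINT l|CI. LINT k|CI. ?f k l) = 2"
    unfolding h_ortho by (subst integral_CI_single(1)[of 0]) auto
  also have "(LINT k|CI. LINT l|CI. ?f k l) = (LINT k|CI. h k * cnj (mask_sum k))"
    unfolding mask_sum_def by (simp only: integral_mult_right_zero Bochner_Integration.integral_cnj)
  finally have e: "(LINT k|CI. h k * cnj (mask_sum k)) = 2" by simp
  have mask_sum_le: "norm (mask_sum k) \<le> h_norm" for k
    unfolding mask_sum_def by (rule order_trans[OF integral_norm_bound h_sub_double(2)])
  have "integrable CI (\<lambda>k. h k * cnj (mask_sum k))"
    by (rule Bochner_Integration.integrable_bound[OF integrable_mult_left[OF integrable_norm[OF h_int], of h_norm]])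
      (auto intro!: AE_I2 order_trans[OF _ abs_ge_self] mult_left_mono mask_sum_le simp: norm_mult)
  from sum_parity_split[OF this, of 0 1] e
  have "(LINT l|CI. h (0 - 2 * l) * cnj (mask_sum (0 - 2 * l))) + (LINT l|CI. h (1 - 2 * l) * cnj (mask_sum (1 - 2 * l))) = 2" by simp
  then have "mask_sum 0 * cnj (mask_sum 0) + mask_sum 1 * cnj (mask_sum 1) = 2"
    unfolding mask_sum_parity unfolding mask_sum_def by (simp only: integral_mult_left_zero)
  \<comment> \<open>With \<open>a = 1 + d\<close> and \<open>b = 1 - d\<close> the second relation
    reads \<open>2 + 2 * |d|^2 = 2\<close>.\<close>
  moreover define d where "d = mask_sum 0 - 1"
  moreover have "mask_sum 1 = 2 - mask_sum 0" using sum by (simp add: eq_diff_eq add.commute)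
  ultimately have "(1 + d) * cnj (1 + d) + (1 - d) * cnj (1 - d) = 2" and "mask_sum 0 = 1 + d" "mask_sum 1 = 1 - d"
    by simp_all
  then have "d * cnj d = 0" by (simp add: algebra_simps)
  then have "d = 0" by simp
  then have "mask_sum 0 = 1" "mask_sum 1 = 1" using \<open>mask_sum 0 = 1 + d\<close> \<open>mask_sum 1 = 1 - d\<close> by auto
  moreover have "mask_sum n = mask_sum 0 \<or> mask_sum n = mask_sum 1"
  proof (cases "even n")
    case True
    then obtain q where "n = 2 * q" by (elim evenE)
    then show ?thesis using mask_sum_parity[of n q] by simp
  next
    case False
    then obtain q where "n = 2 * q + 1" by (elim oddE)
    then show ?thesis using mask_sum_parity[of n q] by simp
  qed
  ultimately show ?thesis by auto
qed

text \<open>As the mask sums over each parity class are 1, the refinement equation gives the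
  periodization the same value at \<open>x\<close> and at \<open>2 * x\<close>. Iterating towards 0
  and using continuity makes it constant, and its mean over a unit interval is the integral of
  \<open>\<phi>\<close>.\<close>

lemma periodization_const: "(LINT k|CI. \<phi> (x - of_int k)) = (LINT y|lborel. \<phi> y)"
proof -
  define P where "P x = (LINT k|CI. \<phi> (x - of_int k))" for x
  have P': "P x = (LINT k|CI. \<phi> (x + of_int k))" for x
    unfolding P_def using integral_CI_reindex[OF bij_uminus_int, of "\<lambda>k. \<phi> (x - of_int k)"] by simp
  have double: "P x = P (2 * x)" for x
  proof -
    let ?f = "\<lambda>m l. h (m - 2 * l) * \<phi> (2 * x - of_int m)"
    have "\<phi> (x - of_int l) = (LINT m|CI. ?f m l)" for l :: int
    proof -
      have "\<phi> (x - of_int l) = (LINT k|CI. (\<lambda>m. ?f m l) (k + 2 * l))"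
        by (subst refinement) (simp add: algebra_simps)
      also have "\<dots> = (LINT m|CI. ?f m l)" by (rule integral_CI_reindex) simp
      finally show ?thesis .
    qed
    then have "P x = (LINT l|CI. LINT m|CI. ?f m l)" unfolding P_def by (simp only:)
    also have "\<dots> = (LINT m|CI. LINT l|CI. ?f m l)"
      by (rule Fubini_dom(6)[OF sigma_finite_CI sigma_finite_CI, where g="\<lambda>m l. norm (h (m - 2 * l)) * norm (\<phi> (2 * x - of_int m))" and h="\<lambda>m. h_norm * norm (\<phi> (2 * x - of_int m))"])
        (use h_sub_double \<phi>_lattice in \<open>auto simp: norm_mult intro!: mult_right_mono\<close>)
    also have "\<dots> = (LINT m|CI. mask_sum m * \<phi> (2 * x - of_int m))"
      unfolding mask_sum_def by (simp only: integral_mult_left_zero)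
    also have "\<dots> = P (2 * x)" unfolding mask_sum_eq_1 P_def by simp
    finally show ?thesis .
  qed
  have iter: "P (x / 2 ^ n) = P x" for n x
  proof (induction n)
    case (Suc n)
    have "P (x / 2 ^ Suc n) = P (2 * (x / 2 ^ Suc n))" by (rule double)
    then show ?case using Suc by simp
  qed simp
  have c: "continuous_on UNIV P" unfolding P'
    by (rule lattice_sum(3)[where C=1 and r=1]) (use \<phi>_bd \<phi>_cont in auto)
  have P0: "P x = P 0" for x
  proof -
    have "(\<lambda>n. x / 2 ^ n) \<longlonglongrightarrow> 0"
      by (rule LIMSEQ_divide_realpow_zero) simp
    then have "(\<lambda>n. P (x / 2 ^ n)) \<longlonglongrightarrow> P 0"
      by (intro continuous_on_tendsto_compose[OF c]) auto
    then have "(\<lambda>n::nat. P x) \<longlonglongrightarrow> P 0" unfolding iter .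
    then show ?thesis by (simp add: LIMSEQ_const_iff)
  qed
  have "(LINT y|lborel. \<phi> y) = (LINT y|lborel. indicator {0..<0 + 1} y * P y)"
    unfolding P' using periodize(1)[OF \<phi>_int, of 1 0] by simp
  also have "\<dots> = (LINT y|lborel. indicator {0..<0 + 1::real} y *\<^sub>R P 0)"
    by (rule Bochner_Integration.integral_cong, simp, subst P0) (auto simp: indicator_def)
  also have "\<dots> = P 0" by simp
  finally show ?thesis using P0[of x] unfolding P_def by simp
qed

text \<open>The inner products of \<open>\<phi>\<close> with all its translates sum to 1; summing
  under the integral replaces the second factor by the constant periodization.\<close>

lemma norm_integral_\<phi>: "(LINT y|lborel. \<phi> y) * cnj (LINT y|lborel. \<phi> y) = 1"
proof -
  let ?f = "\<lambda>x l. \<phi> x * cnj (\<phi> (x - of_int l))"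
  have m: "case_prod ?f \<in> borel_measurable (lborel \<Otimes>\<^sub>M CI)"
    by (rule measurable_pair_CI) measurable
  have "(LINT l|CI. LINT x|lborel. ?f x l) = (LINT x|lborel. LINT l|CI. ?f x l)"
    by (rule Fubini_dom(6)[OF lborel.sigma_finite_measure_axioms sigma_finite_CI m, where g="\<lambda>x l. norm (\<phi> x) * norm (\<phi> (x - of_int l))" and h="\<lambda>x. norm (\<phi> x) * latC 1"])
      (use \<phi>_int \<phi>_lattice in \<open>auto simp: norm_mult intro!: mult_left_mono\<close>)
  moreover have "(LINT l|CI. LINT x|lborel. ?f x l) = 1"
    unfolding ortho0 by (subst integral_CI_single(1)[of 0]) auto
  moreover have "(LINT l|CI. ?f x l) = \<phi> x * cnj (LINT y|lborel. \<phi> y)" for x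
    by (simp only: integral_mult_right_zero Bochner_Integration.integral_cnj periodization_const)
  ultimately show ?thesis by (simp only: integral_mult_left_zero)
qed

lemma kernel_measurable [measurable]:
  assumes [measurable]: "f \<in> borel_measurable borel" "u \<in> borel_measurable M" "v \<in> borel_measurable M"
  shows "(\<lambda>y. kernel f (u y) (v y)) \<in> borel_measurable M"
proof -
  interpret CI: sigma_finite_measure CI by (rule sigma_finite_CI)
  have "(\<lambda>(y, k). f (u y - of_int k) * cnj (f (v y - of_int k))) \<in> borel_measurable (M \<Otimes>\<^sub>M CI)"
    by (rule measurable_pair_CI) measurable
  from CI.borel_measurable_lebesgue_integral[OF this]
  show ?thesis unfolding kernel_def by simp
qed

lemma kernel_bound:
  assumes f: "\<And>x. norm (f x) \<le> E 1 x"
  shows "norm (kernel f x y) \<le> 2 * latC 1 * E 1 ((x - y) / 2)"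
proof -
  have "norm (kernel f x y) \<le> (LINT k|CI. norm (f (x - of_int k) * cnj (f (y - of_int k))))"
    unfolding kernel_def by (rule integral_norm_bound)
  also have "\<dots> \<le> (LINT k|CI. E 1 (x - of_int k) * E 1 (y - of_int k))"
  proof (rule integral_mono)
    show i: "integrable CI (\<lambda>k. E 1 (x - of_int k) * E 1 (y - of_int k))" by (rule lattice_mult) simp
    show "norm (f (x - of_int k) * cnj (f (y - of_int k))) \<le> E 1 (x - of_int k) * E 1 (y - of_int k)" for k
      by (auto simp: norm_mult intro!: mult_mono f)
    then show "integrable CI (\<lambda>k. norm (f (x - of_int k) * cnj (f (y - of_int k))))"
      by (intro Bochner_Integration.integrable_bound[OF i]) auto
  qed
  also have "\<dots> \<le> 2 * latC 1 * E 1 ((x - y) / 2)" by (rule lattice_mult) simp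
  finally show ?thesis .
qed

text \<open>Integration in \<open>y\<close> turns every second factor into the conjugate integral of
  \<open>\<phi>\<close>; the sum of the first factors is the periodization, hence the integral
  itself, and the product has value 1.\<close>

lemma kernel_integral: "(LINT y|lborel. kernel \<phi> x y) = 1"
proof -
  let ?f = "\<lambda>k y. \<phi> (x - of_int k) * cnj (\<phi> (y - of_int k))"
  have m: "case_prod ?f \<in> borel_measurable (CI \<Otimes>\<^sub>M lborel)"
    by (rule measurable_pair_measure_countable1) auto
  have sh: "(LINT x|lborel. \<phi> (x - of_int k)) = (LINT x|lborel. \<phi> x)" "(LINT x|lborel. norm (\<phi> (x - of_int k))) = (LINT x|lborel. norm (\<phi> x))" for k :: int
    by (subst lborel_integral_real_affine[where c=1 and t="of_int k"], auto)+
  have "(LINT y|lborel. LINT k|CI. ?f k y) = (LINT k|CI. LINT y|lborel. ?f k y)"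
    by (rule Fubini_dom(6)[OF sigma_finite_CI lborel.sigma_finite_measure_axioms m,
          where g="\<lambda>k y. norm (\<phi> (x - of_int k)) * norm (\<phi> (y - of_int k))" and h="\<lambda>k. norm (\<phi> (x - of_int k)) * (LINT x|lborel. norm (\<phi> x))"])
      (use \<phi>_lattice \<phi>_affine_int sh in \<open>auto simp: norm_mult\<close>)
  then show ?thesis
    unfolding kernel_def using norm_integral_\<phi>
    by (simp only: integral_mult_right_zero Bochner_Integration.integral_cnj sh integral_mult_left_zero periodization_const)
qed

end

section \<open>The kernels as an approximate identity on continuous functions of growth
  \<open>c\<close>\<close>

locale weighted_wavelet_pair = wavelet_pair + weighted_envelope
begin

context
  fixes F :: "real \<Rightarrow> complex" and B :: real
  assumes F_cont: "continuous_on UNIV F" and F_le: "\<And>s. norm (F s) \<le> B * c s"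
begin

lemma B_nonneg: "B \<ge> 0"
  using order_trans[OF norm_ge_zero F_le[of 0]] c0 by (simp add: zero_le_mult_iff)

lemma F_measurable [measurable]: "F \<in> borel_measurable borel"
  by (rule borel_measurable_continuous_onI[OF F_cont])

text \<open>Recentring the envelope at \<open>t\<close> only enlarges the plateau from 1 to
  \<open>1 + l * |t|\<close>, which \<open>weighted_integrable\<close> tolerates.\<close>

lemma c_E_integrable:
  assumes "l > 0" shows "integrable lborel (\<lambda>s. c s * E 1 (l * (s - t)))"
proof (rule Bochner_Integration.integrable_bound[OF weighted_integrable[of 1 l "1 + l * \<bar>t\<bar>"]])
  show "AE s in lborel. norm (c s * E 1 (l * (s - t))) \<le> norm (c (1 * s) * \<Phi> (max 0 (l * \<bar>s\<bar> - (1 + l * \<bar>t\<bar>))))"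
  proof (rule AE_I2)
    fix s
    have "l * \<bar>s\<bar> \<le> l * (\<bar>s - t\<bar> + \<bar>t\<bar>)" using assms by (intro mult_left_mono) auto
    then have "l * \<bar>s\<bar> - (1 + l * \<bar>t\<bar>) \<le> \<bar>l * (s - t)\<bar> - 1"
      using assms unfolding abs_mult by (simp add: distrib_left)
    then have "E 1 (l * (s - t)) \<le> \<Phi> (max 0 (l * \<bar>s\<bar> - (1 + l * \<bar>t\<bar>)))"
      unfolding E_def by (intro \<Phi>_le) auto
    then show "norm (c s * E 1 (l * (s - t))) \<le> norm (c (1 * s) * \<Phi> (max 0 (l * \<bar>s\<bar> - (1 + l * \<bar>t\<bar>))))"
      by (simp add: abs_mult mult_left_mono \<Phi>_nonneg)
  qed
qed (use assms in auto)

lemma F_dilate_integrable: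
  assumes f: "\<And>x. norm (f x) \<le> E 1 x" and [measurable]: "f \<in> borel_measurable borel" and l: "l > 0"
  shows "integrable lborel (\<lambda>s. F s * cnj (f (l * s - t)))"
proof (rule Bochner_Integration.integrable_bound[OF integrable_mult_right[OF c_E_integrable[OF l, of "t / l"], of B]])
  show "AE s in lborel. norm (F s * cnj (f (l * s - t))) \<le> norm (B * (c s * E 1 (l * (s - t / l))))"
  proof (rule AE_I2)
    fix s
    have "norm (F s * cnj (f (l * s - t))) \<le> (B * c s) * E 1 (l * s - t)"
      unfolding norm_mult complex_mod_cnj using B_nonneg by (intro mult_mono F_le f) auto
    also have "\<dots> = B * (c s * E 1 (l * (s - t / l)))" using l by (simp add: right_diff_distrib)
    finally show "norm (F s * cnj (f (l * s - t))) \<le> norm (B * (c s * E 1 (l * (s - t / l))))"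
      by (auto intro: order_trans[OF _ abs_ge_self])
  qed
qed measurable

text \<open>The exchange is dominated through \<open>lattice_mult\<close>: after summation over
  \<open>k\<close> the majorant decays in \<open>s - t\<close>, and this decay is integrable against
  \<open>c\<close>.\<close>

lemma series_eq_kernel_integral:
  assumes f: "\<And>x. norm (f x) \<le> E 1 x" and [measurable]: "f \<in> borel_measurable borel" and l: "l > 0"
  shows "(LINT k|CI. f (l * t - of_int k) * (LINT s|lborel. F s * cnj (f (l * s - of_int k)))) = (LINT s|lborel. F s * kernel f (l * t) (l * s))"
    and "integrable CI (\<lambda>k. f (l * t - of_int k) * (LINT s|lborel. F s * cnj (f (l * s - of_int k))))"
    and "integrable lborel (\<lambda>s. F s * kernel f (l * t) (l * s))"
proof -
  let ?f = "\<lambda>s k. f (l * t - of_int k) * (F s * cnj (f (l * s - of_int k)))"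
  have m: "case_prod ?f \<in> borel_measurable (lborel \<Otimes>\<^sub>M CI)"
    by (rule measurable_pair_CI) measurable
  let ?g = "\<lambda>s k. B * c s * (E 1 (l * t - of_int k) * E 1 (l * s - of_int k))"
  let ?h = "\<lambda>s. B * (2 * latC 1) * (c s * E 1 (l / 2 * (s - t)))"
  have b: "norm (?f s k) \<le> ?g s k" for s k
  proof -
    have "norm (?f s k) = norm (F s) * (norm (f (l * t - of_int k)) * norm (f (l * s - of_int k)))"
      by (simp add: norm_mult mult_ac)
    also have "\<dots> \<le> ?g s k" using B_nonneg by (intro mult_mono F_le f) auto
    finally show ?thesis .
  qed
  have gi: "integrable CI (?g s)" for s by (intro integrable_mult_right lattice_mult) simp
  have hi: "integrable lborel ?h" using l by (intro integrable_mult_right c_E_integrable) simp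
  have gh: "(LINT k|CI. ?g s k) \<le> ?h s" for s
  proof -
    have "(LINT k|CI. ?g s k) = B * c s * (LINT k|CI. E 1 (l * t - of_int k) * E 1 (l * s - of_int k))" by simp
    also have "\<dots> \<le> B * c s * (2 * latC 1 * E 1 ((l * t - l * s) / 2))"
      using B_nonneg by (intro mult_left_mono lattice_mult) auto
    also have "E 1 ((l * t - l * s) / 2) = E 1 (- (l / 2 * (s - t)))" by (simp add: algebra_simps diff_divide_distrib)
    also have "\<dots> = E 1 (l / 2 * (s - t))" by (rule E_minus)
    finally show ?thesis by (simp add: mult_ac)
  qed
  note D = Fubini_dom[OF lborel.sigma_finite_measure_axioms sigma_finite_CI m, where g="?g" and h="?h"]
  have k: "(LINT k|CI. ?f s k) = F s * kernel f (l * t) (l * s)" for s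
  proof -
    have "?f s k = F s * (f (l * t - of_int k) * cnj (f (l * s - of_int k)))" for k :: int by simp
    then show ?thesis unfolding kernel_def by (simp only: integral_mult_right_zero)
  qed
  have "(LINT k|CI. LINT s|lborel. ?f s k) = (LINT s|lborel. LINT k|CI. ?f s k)"
    by (rule D(6)) (use b gi hi gh in auto)
  then show "(LINT k|CI. f (l * t - of_int k) * (LINT s|lborel. F s * cnj (f (l * s - of_int k)))) = (LINT s|lborel. F s * kernel f (l * t) (l * s))"
    unfolding k by (simp only: integral_mult_right_zero)
  have "integrable CI (\<lambda>k. LINT s|lborel. ?f s k)"
    by (rule D(5)) (use b gi hi gh in auto)
  then show "integrable CI (\<lambda>k. f (l * t - of_int k) * (LINT s|lborel. F s * cnj (f (l * s - of_int k))))"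
    by (simp only: integral_mult_right_zero)
  have "integrable lborel (\<lambda>s. LINT k|CI. ?f s k)"
    by (rule D(3)) (use b gi hi gh in auto)
  then show "integrable lborel (\<lambda>s. F s * kernel f (l * t) (l * s))" unfolding k .
qed

text \<open>The substitution \<open>s = t + v / 2^n\<close> makes the majorant independent of
  \<open>n\<close>: the kernel is bounded by a constant times \<open>E 1 (v / 2)\<close>, and
  \<open>c (t + v / 2^n) <= c (2 * t) + c (2 * v)\<close> according to whether \<open>|t|\<close> or
  \<open>|v|\<close> is larger. As the kernel has integral 1, dominated convergence is applied to
  the differences \<open>F (t + v / 2^n) - F t\<close>.\<close>

lemma kernel_approximation:
  "(\<lambda>n. 2 ^ n * (LINT s|lborel. F s * kernel \<phi> (2 ^ n * t) (2 ^ n * s))) \<longlonglongrightarrow> F t"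
proof -
  let ?K = "\<lambda>n v. kernel \<phi> (2 ^ n * t) (2 ^ n * t + v)"
  let ?w = "\<lambda>v. (2 * latC 1) * (B * (c (2 * v) * \<Phi> (max 0 (1/2 * \<bar>v\<bar> - 1))) + (B * c (2 * t) + norm (F t)) * E 1 (0 + (1/2) * v))"
  have Kb: "norm (?K n v) \<le> 2 * latC 1 * E 1 (0 + (1/2) * v)" for n v
    using kernel_bound[OF \<phi>_bd, of "2 ^ n * t" "2 ^ n * t + v"] E_minus[of 1 "v / 2"] by simp
  have Ei: "integrable lborel (\<lambda>v. E 1 (0 + (1/2) * v))"
    by (rule lborel_integrable_real_affine) auto
  have wi: "integrable lborel ?w"
    by (intro integrable_mult_right Bochner_Integration.integrable_add weighted_integrable Ei) auto
  have bd: "norm (?K n v * (F (t + v / 2 ^ n) - F t)) \<le> ?w v" for n v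
  proof -
    have "\<bar>t + v / 2 ^ n\<bar> \<le> \<bar>t\<bar> + \<bar>v\<bar> / 2 ^ n" using abs_triangle_ineq[of t "v / 2 ^ n"] by (simp add: abs_divide)
    also have "\<bar>v\<bar> / 2 ^ n \<le> \<bar>v\<bar>" by (simp add: divide_le_eq mult_le_cancel_left1)
    finally have "\<bar>t + v / 2 ^ n\<bar> \<le> \<bar>2 * t\<bar> \<or> \<bar>t + v / 2 ^ n\<bar> \<le> \<bar>2 * v\<bar>" by linarith
    then have "c (t + v / 2 ^ n) \<le> c (2 * t) \<or> c (t + v / 2 ^ n) \<le> c (2 * v)" using c_le by blast
    then have "c (t + v / 2 ^ n) \<le> c (2 * t) + c (2 * v)"
      using c_nonneg[of "2 * t"] c_nonneg[of "2 * v"] by linarith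
    then have "B * c (t + v / 2 ^ n) \<le> B * (c (2 * t) + c (2 * v))" using B_nonneg by (rule mult_left_mono)
    then have 1: "norm (F (t + v / 2 ^ n) - F t) \<le> B * c (2 * v) + (B * c (2 * t) + norm (F t))"
      using norm_triangle_ineq4[of "F (t + v / 2 ^ n)" "F t"] F_le[of "t + v / 2 ^ n"] by (simp add: distrib_left)
    have "norm (?K n v * (F (t + v / 2 ^ n) - F t)) \<le> (2 * latC 1 * E 1 (0 + (1/2) * v)) * (B * c (2 * v) + (B * c (2 * t) + norm (F t)))"
      unfolding norm_mult by (intro mult_mono Kb 1) auto
    also have "\<dots> = ?w v"
      by (simp add: E_def algebra_simps)
    finally show ?thesis .
  qed
  have "(\<lambda>n. LINT v|lborel. ?K n v * (F (t + v / 2 ^ n) - F t)) \<longlonglongrightarrow> (LINT v|(lborel :: real measure). (0::complex))"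
  proof (rule integral_dominated_convergence[where w="?w"])
    show "AE v in lborel. (\<lambda>n. ?K n v * (F (t + v / 2 ^ n) - F t)) \<longlonglongrightarrow> 0"
    proof (rule AE_I2)
      fix v :: real
      have "(\<lambda>n. t + v / 2 ^ n) \<longlonglongrightarrow> t + 0"
        by (intro tendsto_intros LIMSEQ_divide_realpow_zero) simp
      then have "(\<lambda>n. F (t + v / 2 ^ n)) \<longlonglongrightarrow> F t"
        by (intro continuous_on_tendsto_compose[OF F_cont]) auto
      then have "(\<lambda>n. F (t + v / 2 ^ n) - F t) \<longlonglongrightarrow> 0" by (rule LIM_zero)
      then have z: "(\<lambda>n. (2 * latC 1 * E 1 (0 + (1/2) * v)) * norm (F (t + v / 2 ^ n) - F t)) \<longlonglongrightarrow> 0"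
        by (intro tendsto_mult_right_zero tendsto_norm_zero)
      show "(\<lambda>n. ?K n v * (F (t + v / 2 ^ n) - F t)) \<longlonglongrightarrow> 0"
        by (rule tendsto_norm_zero_cancel, rule tendsto_sandwich[OF _ _ tendsto_const z])
          (auto simp: norm_mult intro!: always_eventually mult_right_mono Kb[simplified])
    qed
  qed (use bd wi in auto)
  then have lim: "(\<lambda>n. LINT v|lborel. ?K n v * (F (t + v / 2 ^ n) - F t)) \<longlonglongrightarrow> 0" by simp
  have eq: "2 ^ n * (LINT s|lborel. F s * kernel \<phi> (2 ^ n * t) (2 ^ n * s)) = (LINT v|lborel. ?K n v * (F (t + v / 2 ^ n) - F t)) + F t" for n
  proof -
    have Ki: "integrable lborel (?K n)"
      by (rule Bochner_Integration.integrable_bound[OF integrable_mult_right[OF Ei, of "2 * latC 1"]])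
        (use Kb in auto)
    have K1: "(LINT v|lborel. ?K n v) = 1"
      using kernel_integral[of "2 ^ n * t"] by (subst (asm) lborel_integral_real_affine[where c=1 and t="2 ^ n * t"]) auto
    have i: "integrable lborel (\<lambda>v. ?K n v * (F (t + v / 2 ^ n) - F t))"
      by (rule Bochner_Integration.integrable_bound[OF wi]) (auto intro!: AE_I2 order_trans[OF bd] simp del: abs_mult)
    have "2 ^ n * (LINT s|lborel. F s * kernel \<phi> (2 ^ n * t) (2 ^ n * s)) = (LINT v|lborel. ?K n v * F (t + v / 2 ^ n))"
      by (subst lborel_integral_real_affine[where c="1 / 2 ^ n" and t=t]) (auto simp: scaleR_conv_of_real distrib_left mult_ac)
    also have "\<dots> = (LINT v|lborel. ?K n v * (F (t + v / 2 ^ n) - F t) + ?K n v * F t)"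
      by (simp add: algebra_simps)
    also have "\<dots> = (LINT v|lborel. ?K n v * (F (t + v / 2 ^ n) - F t)) + (LINT v|lborel. ?K n v * F t)"
      using i Ki by (intro Bochner_Integration.integral_add integrable_mult_left)
    finally show ?thesis using K1 by simp
  qed
  show ?thesis unfolding eq using tendsto_add[OF lim tendsto_const, of "F t"] by simp
qed

lemma kernel_telescope:
  "2 ^ n * (LINT s|lborel. F s * kernel \<phi> (2 ^ n * t) (2 ^ n * s)) =
   (LINT s|lborel. F s * kernel \<phi> t s) + (\<Sum>j<n. 2 ^ j * (LINT s|lborel. F s * kernel \<psi> (2 ^ j * t) (2 ^ j * s)))"
proof (induction n)
  case (Suc n)
  have "2 ^ Suc n * (LINT s|lborel. F s * kernel \<phi> (2 ^ Suc n * t) (2 ^ Suc n * s))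
    = 2 ^ n * (2 * (LINT s|lborel. F s * kernel \<phi> (2 * (2 ^ n * t)) (2 * (2 ^ n * s))))"
    by (simp add: mult_ac)
  also have "\<dots> = 2 ^ n * (LINT s|lborel. F s * (2 * kernel \<phi> (2 * (2 ^ n * t)) (2 * (2 ^ n * s))))"
    by (simp only: mult.left_commute[of _ 2] integral_mult_right_zero)
  also have "\<dots> = 2 ^ n * (LINT s|lborel. F s * kernel \<phi> (2 ^ n * t) (2 ^ n * s) + F s * kernel \<psi> (2 ^ n * t) (2 ^ n * s))"
    unfolding kernel_two_scale[symmetric] by (simp only: distrib_left)
  also have "\<dots> = 2 ^ n * ((LINT s|lborel. F s * kernel \<phi> (2 ^ n * t) (2 ^ n * s)) + (LINT s|lborel. F s * kernel \<psi> (2 ^ n * t) (2 ^ n * s)))"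
    by (subst Bochner_Integration.integral_add) (auto intro!: series_eq_kernel_integral(3) \<phi>_bd \<psi>_bd)
  finally show ?case using Suc by (simp add: algebra_simps)
qed simp

end

end


section \<open>Mean-square integrals of Gaussian processes\<close>

context prob_space
begin

definition L2 :: "('a \<Rightarrow> complex) \<Rightarrow> bool" where
  "L2 A \<longleftrightarrow> A \<in> borel_measurable M \<and> integrable M (\<lambda>\<omega>. (cmod (A \<omega>))\<^sup>2)"

lemma L2_measurable: "L2 A \<Longrightarrow> A \<in> borel_measurable M" by (simp add: L2_def)

lemma cmod_add_square_le: "(cmod (a + b))\<^sup>2 \<le> 2 * (cmod a)\<^sup>2 + 2 * (cmod b)\<^sup>2"
proof -
  have "(cmod (a + b))\<^sup>2 \<le> (cmod a + cmod b)\<^sup>2" by (intro power_mono norm_triangle_ineq) simp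
  also have "\<dots> \<le> 2 * (cmod a)\<^sup>2 + 2 * (cmod b)\<^sup>2"
    using zero_le_power2[of "cmod a - cmod b"] by (simp add: power2_eq_square algebra_simps)
  finally show ?thesis .
qed

lemma L2_add: assumes "L2 A" "L2 B" shows "L2 (\<lambda>\<omega>. A \<omega> + B \<omega>)"
  unfolding L2_def
proof
  have [measurable]: "A \<in> borel_measurable M" "B \<in> borel_measurable M" using assms by (auto simp: L2_def)
  show "(\<lambda>\<omega>. A \<omega> + B \<omega>) \<in> borel_measurable M" by measurable
  have i: "integrable M (\<lambda>\<omega>. 2 * (cmod (A \<omega>))\<^sup>2 + 2 * (cmod (B \<omega>))\<^sup>2)" using assms by (simp add: L2_def)
  show "integrable M (\<lambda>\<omega>. (cmod (A \<omega> + B \<omega>))\<^sup>2)"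
    by (rule Bochner_Integration.integrable_bound[OF i]) (auto intro!: AE_I2 cmod_add_square_le)
qed

lemma L2_cmult: "L2 A \<Longrightarrow> L2 (\<lambda>\<omega>. a * A \<omega>)" by (auto simp: L2_def norm_mult power_mult_distrib)

lemma L2_diff: "L2 A \<Longrightarrow> L2 B \<Longrightarrow> L2 (\<lambda>\<omega>. A \<omega> - B \<omega>)"
  using L2_add[of A "\<lambda>\<omega>. (-1) * B \<omega>"] L2_cmult[of B "-1"] by simp

lemma L2_sum: "(\<And>i. i \<in> I \<Longrightarrow> L2 (A i)) \<Longrightarrow> L2 (\<lambda>\<omega>. \<Sum>i\<in>I. A i \<omega>)"
proof (induction I rule: infinite_finite_induct)
  case (insert x F)
  then show ?case using L2_add[of "A x" "\<lambda>\<omega>. \<Sum>i\<in>F. A i \<omega>"] by simp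
qed (auto simp: L2_def)

lemma L2_integrable_mult:
  assumes A: "L2 A" and [measurable]: "Z \<in> borel_measurable M" and Z: "\<And>\<omega>. norm (Z \<omega>) \<le> 1"
  shows "integrable M (\<lambda>\<omega>. A \<omega> * Z \<omega>)"
proof -
  have [measurable]: "A \<in> borel_measurable M" using A by (simp add: L2_def)
  have i: "integrable M (\<lambda>\<omega>. 1 + (cmod (A \<omega>))\<^sup>2)" using A by (simp add: L2_def)
  show ?thesis
  proof (rule Bochner_Integration.integrable_bound[OF i])
    have "norm (A \<omega> * Z \<omega>) \<le> 1 + (cmod (A \<omega>))\<^sup>2" for \<omega>
    proof -
      have "norm (A \<omega> * Z \<omega>) \<le> norm (A \<omega>) * 1" unfolding norm_mult by (intro mult_left_mono Z) simp
      also have "\<dots> \<le> 1 + (cmod (A \<omega>))\<^sup>2"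
        using zero_le_power2[of "cmod (A \<omega>) - 1/2"] by (simp add: power2_eq_square algebra_simps)
      finally show ?thesis .
    qed
    then show "AE \<omega> in M. norm (A \<omega> * Z \<omega>) \<le> norm (1 + (cmod (A \<omega>))\<^sup>2)"
      by (intro AE_I2) (auto intro: order_trans[OF _ abs_ge_self])
  qed measurable
qed

lemma L2_integrable: "L2 A \<Longrightarrow> integrable M A"
  using L2_integrable_mult[of A "\<lambda>_. 1"] by simp

lemma ms_distance_L2:
  assumes "L2 A" "L2 B"
  shows "ms_distance M A B = ennreal (expectation (\<lambda>\<omega>. (cmod (A \<omega> - B \<omega>))\<^sup>2))"
  unfolding ms_distance_def using L2_diff[OF assms] by (intro nn_integral_eq_integral) (auto simp: L2_def)

text \<open>Since the distance takes values in \<open>ennreal\<close>, a finite bound on it is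
  genuine information; through it a mean-square limit inherits square integrability.\<close>

lemma L2_of_ms_distance:
  assumes A: "L2 A" and [measurable]: "B \<in> borel_measurable M" and d: "ms_distance M A B < ennreal e"
  shows "L2 B"
proof -
  have [measurable]: "A \<in> borel_measurable M" using A by (simp add: L2_def)
  have "L2 (\<lambda>\<omega>. A \<omega> - B \<omega>)"
    unfolding L2_def
  proof
    show "integrable M (\<lambda>\<omega>. (cmod (A \<omega> - B \<omega>))\<^sup>2)"
      using d by (intro integrableI_bounded) (auto simp: ms_distance_def less_top[symmetric])
  qed measurable
  from L2_diff[OF A this] show ?thesis by simp
qed

text \<open>The pointwise inequality \<open>x <= e / 2 + x^2 / (2 * e)\<close> does the work of
  Cauchy-Schwarz.\<close>

lemma expectation_diff_le:
  assumes "L2 A" "L2 B" and Z[measurable]: "Z \<in> borel_measurable M" "\<And>\<omega>. norm (Z \<omega>) \<le> 1"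
    and e: "e > 0" and d: "ms_distance M A B < ennreal (e\<^sup>2)"
  shows "norm (expectation (\<lambda>\<omega>. A \<omega> * Z \<omega>) - expectation (\<lambda>\<omega>. B \<omega> * Z \<omega>)) \<le> e"
proof -
  have D: "L2 (\<lambda>\<omega>. A \<omega> - B \<omega>)" using assms by (intro L2_diff)
  have i: "integrable M (\<lambda>\<omega>. e / 2 + (cmod (A \<omega> - B \<omega>))\<^sup>2 / (2 * e))" using D by (simp add: L2_def)
  have b: "norm ((A \<omega> - B \<omega>) * Z \<omega>) \<le> e / 2 + (cmod (A \<omega> - B \<omega>))\<^sup>2 / (2 * e)" for \<omega>
  proof -
    let ?x = "cmod (A \<omega> - B \<omega>)"
    have "norm ((A \<omega> - B \<omega>) * Z \<omega>) \<le> ?x * 1" unfolding norm_mult by (intro mult_left_mono Z) simp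
    also have "\<dots> \<le> e / 2 + ?x\<^sup>2 / (2 * e)"
    proof -
      have "0 \<le> (?x - e)\<^sup>2 / (2 * e)" using e by simp
      also have "\<dots> = e / 2 + ?x\<^sup>2 / (2 * e) - ?x" using e by (simp add: power2_eq_square field_simps)
      finally show ?thesis by simp
    qed
    finally show ?thesis .
  qed
  have "expectation (\<lambda>\<omega>. A \<omega> * Z \<omega>) - expectation (\<lambda>\<omega>. B \<omega> * Z \<omega>) = expectation (\<lambda>\<omega>. (A \<omega> - B \<omega>) * Z \<omega>)"
    unfolding left_diff_distrib using assms by (intro Bochner_Integration.integral_diff[symmetric] L2_integrable_mult)
  also have "norm \<dots> \<le> expectation (\<lambda>\<omega>. norm ((A \<omega> - B \<omega>) * Z \<omega>))" by (rule integral_norm_bound)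
  also have "\<dots> \<le> expectation (\<lambda>\<omega>. e / 2 + (cmod (A \<omega> - B \<omega>))\<^sup>2 / (2 * e))"
    using L2_integrable_mult[OF D Z] i b by (intro integral_mono) auto
  also have "\<dots> = e / 2 + expectation (\<lambda>\<omega>. (cmod (A \<omega> - B \<omega>))\<^sup>2) / (2 * e)"
    using D by (simp add: L2_def prob_space)
  also have "\<dots> \<le> e / 2 + e\<^sup>2 / (2 * e)"
  proof -
    have "expectation (\<lambda>\<omega>. (cmod (A \<omega> - B \<omega>))\<^sup>2) < e\<^sup>2"
      using d unfolding ms_distance_L2[OF assms(1,2)] by (simp add: ennreal_less_iff)
    then show ?thesis using e by (intro add_left_mono divide_right_mono) auto
  qed
  also have "\<dots> = e" using e by (simp add: power2_eq_square)
  finally show ?thesis .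
qed

lemma ms_distance_triangle:
  assumes [measurable]: "A \<in> borel_measurable M" "B \<in> borel_measurable M" "C \<in> borel_measurable M"
  shows "ms_distance M A C \<le> 2 * ms_distance M A B + 2 * ms_distance M B C"
proof -
  have "ms_distance M A C \<le> (\<integral>\<^sup>+ \<omega>. 2 * ennreal ((cmod (A \<omega> - B \<omega>))\<^sup>2) + 2 * ennreal ((cmod (B \<omega> - C \<omega>))\<^sup>2) \<partial>M)"
    unfolding ms_distance_def
  proof (rule nn_integral_mono)
    fix \<omega>
    have "ennreal ((cmod (A \<omega> - C \<omega>))\<^sup>2) \<le> ennreal (2 * (cmod (A \<omega> - B \<omega>))\<^sup>2 + 2 * (cmod (B \<omega> - C \<omega>))\<^sup>2)"
      using cmod_add_square_le[of "A \<omega> - B \<omega>" "B \<omega> - C \<omega>"] by (intro ennreal_leI) simp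
    also have "\<dots> = 2 * ennreal ((cmod (A \<omega> - B \<omega>))\<^sup>2) + 2 * ennreal ((cmod (B \<omega> - C \<omega>))\<^sup>2)"
      by (simp add: ennreal_plus ennreal_mult)
    finally show "ennreal ((cmod (A \<omega> - C \<omega>))\<^sup>2) \<le> \<dots>" .
  qed
  also have "\<dots> = 2 * ms_distance M A B + 2 * ms_distance M B C"
    unfolding ms_distance_def by (subst nn_integral_add) (auto simp: nn_integral_cmult)
  finally show ?thesis .
qed

text \<open>Against a density of variance \<open>\<tau>\<^sup>2 \<le> \<sigma>\<^sup>2\<close> the
  factor \<open>exp (x\<^sup>2 / (4 * \<tau>\<^sup>2))\<close> consumes half of the Gaussian
  exponent; what is left is \<open>sqrt 2\<close> times the density of variance
  \<open>2 * \<tau>\<^sup>2\<close>. A degenerate variable is almost surely 0 because its mean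
  is.\<close>

lemma gaussian_exp_moment:
  assumes Y: "gaussian_rv M Y" and m: "expectation Y = 0"
    and v: "expectation (\<lambda>\<omega>. (Y \<omega>)\<^sup>2) \<le> \<sigma>\<^sup>2" and \<sigma>: "\<sigma> > 0"
  shows "(\<integral>\<^sup>+\<omega>. ennreal (exp ((Y \<omega>)\<^sup>2 / (4 * \<sigma>\<^sup>2))) \<partial>M) \<le> 2"
proof -
  have [measurable]: "Y \<in> borel_measurable M" using Y by (simp add: gaussian_rv_def)
  from Y obtain \<mu> \<tau> where "\<tau> > 0 \<and> distributed M lborel Y (normal_density \<mu> \<tau>) \<or> (AE \<omega> in M. Y \<omega> = \<mu>)"
    by (auto simp: gaussian_rv_def)
  then show ?thesis
  proof
    assume "AE \<omega> in M. Y \<omega> = \<mu>"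
    then have c: "expectation Y = expectation (\<lambda>_. \<mu>)" by (intro integral_cong_AE) auto
    then have "\<mu> = 0" using m by (simp add: prob_space)
    with \<open>AE \<omega> in M. Y \<omega> = \<mu>\<close> have "(\<integral>\<^sup>+\<omega>. ennreal (exp ((Y \<omega>)\<^sup>2 / (4 * \<sigma>\<^sup>2))) \<partial>M) = (\<integral>\<^sup>+\<omega>. 1 \<partial>M)"
      by (intro nn_integral_cong_AE) (auto elim!: eventually_mono)
    then show ?thesis by (simp add: emeasure_space_1)
  next
    assume "\<tau> > 0 \<and> distributed M lborel Y (normal_density \<mu> \<tau>)"
    then have \<tau>: "\<tau> > 0" and D: "distributed M lborel Y (normal_density \<mu> \<tau>)" by auto
    have "\<mu> = 0" using normal_distributed_expectation[OF \<tau> D] m by simp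
    have "\<tau>\<^sup>2 \<le> \<sigma>\<^sup>2" using normal_distributed_variance[OF \<tau> D] v m by simp
    note D = D[unfolded \<open>\<mu> = 0\<close>]
    have "(\<integral>\<^sup>+\<omega>. ennreal (exp ((Y \<omega>)\<^sup>2 / (4 * \<sigma>\<^sup>2))) \<partial>M) = (\<integral>\<^sup>+x. ennreal (normal_density 0 \<tau> x) * ennreal (exp (x\<^sup>2 / (4 * \<sigma>\<^sup>2))) \<partial>lborel)"
      by (rule distributed_nn_integral[OF D, symmetric]) measurable
    also have "\<dots> \<le> (\<integral>\<^sup>+x. ennreal (sqrt 2) * ennreal (normal_density 0 (sqrt 2 * \<tau>) x) \<partial>lborel)"
    proof (rule nn_integral_mono)
      fix x :: real
      have "exp (x\<^sup>2 / (4 * \<sigma>\<^sup>2)) \<le> exp (x\<^sup>2 / (4 * \<tau>\<^sup>2))"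
        using \<open>\<tau>\<^sup>2 \<le> \<sigma>\<^sup>2\<close> \<tau> \<sigma> by (simp add: divide_left_mono)
      then have "normal_density 0 \<tau> x * exp (x\<^sup>2 / (4 * \<sigma>\<^sup>2)) \<le> normal_density 0 \<tau> x * exp (x\<^sup>2 / (4 * \<tau>\<^sup>2))"
        by (intro mult_left_mono) auto
      also have "\<dots> = 1 / sqrt (2 * pi * \<tau>\<^sup>2) * (exp (- (x\<^sup>2 / (2 * \<tau>\<^sup>2))) * exp (x\<^sup>2 / (4 * \<tau>\<^sup>2)))"
        by (simp add: normal_density_def)
      also have "exp (- (x\<^sup>2 / (2 * \<tau>\<^sup>2))) * exp (x\<^sup>2 / (4 * \<tau>\<^sup>2)) = exp (- (x\<^sup>2 / (4 * \<tau>\<^sup>2)))"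
        using \<tau> by (simp add: exp_add[symmetric] field_simps)
      also have "1 / sqrt (2 * pi * \<tau>\<^sup>2) * exp (- (x\<^sup>2 / (4 * \<tau>\<^sup>2))) = sqrt 2 * normal_density 0 (sqrt 2 * \<tau>) x"
      proof -
        have "sqrt (2 * pi * (sqrt 2 * \<tau>)\<^sup>2) = sqrt 2 * sqrt (2 * pi * \<tau>\<^sup>2)"
          by (simp add: power_mult_distrib real_sqrt_mult[symmetric] mult_ac)
        then show ?thesis by (simp add: normal_density_def power_mult_distrib)
      qed
      finally have "ennreal (normal_density 0 \<tau> x * exp (x\<^sup>2 / (4 * \<sigma>\<^sup>2))) \<le> ennreal (sqrt 2 * normal_density 0 (sqrt 2 * \<tau>) x)"
        by (rule ennreal_leI)
      then show "ennreal (normal_density 0 \<tau> x) * ennreal (exp (x\<^sup>2 / (4 * \<sigma>\<^sup>2))) \<le> ennreal (sqrt 2) * ennreal (normal_density 0 (sqrt 2 * \<tau>) x)"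
        by (simp add: ennreal_mult)
    qed
    also have "\<dots> = ennreal (sqrt 2)"
      using \<tau> by (subst nn_integral_cmult) (auto simp: nn_integral_eq_integral)
    also have "\<dots> \<le> ennreal 2" by (intro ennreal_leI) (simp add: sqrt2_less_2 less_imp_le)
    finally show ?thesis by simp
  qed
qed

end

locale gaussian_L2_process = prob_space +
  fixes X :: "real \<Rightarrow> 'a \<Rightarrow> complex"
  assumes gauss: "gaussian_process M X"
    and mean: "\<And>t. expectation (X t) = 0"
    and square: "\<And>t. integrable M (\<lambda>\<omega>. (cmod (X t \<omega>))\<^sup>2)"
    and cov_cont: "continuous_on UNIV (\<lambda>(t, s). covariance M X t s)"
begin

lemma X_measurable [measurable]: "X t \<in> borel_measurable M"
  using gauss by (simp add: gaussian_process_def)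

lemma X_L2: "L2 (X t)" using square by (simp add: L2_def)

lemma X_integrable: "integrable M (X t)" by (rule L2_integrable[OF X_L2])

definition lincomb :: "('a \<Rightarrow> complex) \<Rightarrow> bool" where
  "lincomb S \<longleftrightarrow> (\<exists>F w. finite F \<and> S = (\<lambda>\<omega>. \<Sum>t\<in>F. w t * X t \<omega>))"

lemma lincomb_L2: "lincomb S \<Longrightarrow> L2 S"
  unfolding lincomb_def by (auto intro!: L2_sum L2_cmult X_L2)

text \<open>Sample points may repeat, as tags of a division do, so the weights of equal points are
  collected first.\<close>

lemma lincomb_sum:
  assumes "finite I" shows "lincomb (\<lambda>\<omega>. \<Sum>i\<in>I. w i * X (\<tau> i) \<omega>)"
  unfolding lincomb_def
proof (intro exI conjI ext)
  fix \<omega>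
  have "(\<Sum>i\<in>I. w i * X (\<tau> i) \<omega>) = (\<Sum>t\<in>\<tau> ` I. \<Sum>i | i \<in> I \<and> \<tau> i = t. w i * X (\<tau> i) \<omega>)"
    using assms by (rule sum.image_gen)
  also have "\<dots> = (\<Sum>t\<in>\<tau> ` I. (\<Sum>i | i \<in> I \<and> \<tau> i = t. w i) * X t \<omega>)"
    by (simp add: sum_distrib_right)
  finally show "(\<Sum>i\<in>I. w i * X (\<tau> i) \<omega>) = (\<Sum>t\<in>\<tau> ` I. (\<Sum>i | i \<in> I \<and> \<tau> i = t. w i) * X t \<omega>)" .
qed (use assms in simp)

text \<open>Real and imaginary part may be dependent, so the product of their exponentials is split
  by \<open>a * b <= (a^2 + b^2) / 2\<close>. Squaring doubles the exponents, hence the constant 8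
  against the 4 of the real case.\<close>

lemma lincomb_exp_moment:
  assumes S: "lincomb S" and v: "expectation (\<lambda>\<omega>. (cmod (S \<omega>))\<^sup>2) \<le> \<sigma>\<^sup>2" and \<sigma>: "\<sigma> > 0"
  shows "(\<integral>\<^sup>+\<omega>. ennreal (exp ((cmod (S \<omega>))\<^sup>2 / (8 * \<sigma>\<^sup>2))) \<partial>M) \<le> 2"
proof -
  from S obtain F w where F: "finite F" and S_eq: "S = (\<lambda>\<omega>. \<Sum>t\<in>F. w t * X t \<omega>)"
    unfolding lincomb_def by auto
  have L: "L2 S" by (rule lincomb_L2[OF S])
  have [measurable]: "S \<in> borel_measurable M" using L by (simp add: L2_def)
  have gp: "gaussian_rv M (\<lambda>\<omega>. \<Sum>t\<in>F. a t * Re (X t \<omega>) + b t * Im (X t \<omega>))" for a b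
    using gauss F by (simp add: gaussian_process_def)
  have gr: "gaussian_rv M (\<lambda>\<omega>. Re (S \<omega>))"
  proof -
    have "(\<lambda>\<omega>. Re (S \<omega>)) = (\<lambda>\<omega>. \<Sum>t\<in>F. Re (w t) * Re (X t \<omega>) + (- Im (w t)) * Im (X t \<omega>))"
      unfolding S_eq by (simp add: fun_eq_iff)
    then show ?thesis using gp[of "\<lambda>t. Re (w t)" "\<lambda>t. - Im (w t)"] by (simp only:)
  qed
  have gi: "gaussian_rv M (\<lambda>\<omega>. Im (S \<omega>))"
  proof -
    have "(\<lambda>\<omega>. Im (S \<omega>)) = (\<lambda>\<omega>. \<Sum>t\<in>F. Im (w t) * Re (X t \<omega>) + Re (w t) * Im (X t \<omega>))"
      unfolding S_eq by (simp add: fun_eq_iff add.commute)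
    then show ?thesis using gp[of "\<lambda>t. Im (w t)" "\<lambda>t. Re (w t)"] by (simp only:)
  qed
  have "expectation S = (\<Sum>t\<in>F. expectation (\<lambda>\<omega>. w t * X t \<omega>))"
    unfolding S_eq by (rule Bochner_Integration.integral_sum) (auto intro: X_integrable)
  then have "expectation S = 0" by (simp add: mean)
  then have mr: "expectation (\<lambda>\<omega>. Re (S \<omega>)) = 0" and mi: "expectation (\<lambda>\<omega>. Im (S \<omega>)) = 0"
    using integral_Re[OF L2_integrable[OF L]] integral_Im[OF L2_integrable[OF L]] by auto
  have sq: "integrable M (\<lambda>\<omega>. (cmod (S \<omega>))\<^sup>2)" using L by (simp add: L2_def)
  have le: "(Re z)\<^sup>2 \<le> (cmod z)\<^sup>2" "(Im z)\<^sup>2 \<le> (cmod z)\<^sup>2" for z by (simp_all add: cmod_power2)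
  have vr: "expectation (\<lambda>\<omega>. (Re (S \<omega>))\<^sup>2) \<le> \<sigma>\<^sup>2"
    by (rule order_trans[OF integral_mono v], rule Bochner_Integration.integrable_bound[OF sq])
      (use sq le in auto)
  have vi: "expectation (\<lambda>\<omega>. (Im (S \<omega>))\<^sup>2) \<le> \<sigma>\<^sup>2"
    by (rule order_trans[OF integral_mono v], rule Bochner_Integration.integrable_bound[OF sq])
      (use sq le in auto)
  have "(\<integral>\<^sup>+\<omega>. ennreal (exp ((cmod (S \<omega>))\<^sup>2 / (8 * \<sigma>\<^sup>2))) \<partial>M) \<le>
     (\<integral>\<^sup>+\<omega>. ennreal (1/2) * ennreal (exp ((Re (S \<omega>))\<^sup>2 / (4 * \<sigma>\<^sup>2))) + ennreal (1/2) * ennreal (exp ((Im (S \<omega>))\<^sup>2 / (4 * \<sigma>\<^sup>2))) \<partial>M)"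
  proof (rule nn_integral_mono)
    fix \<omega>
    let ?a = "exp ((Re (S \<omega>))\<^sup>2 / (8 * \<sigma>\<^sup>2))" and ?b = "exp ((Im (S \<omega>))\<^sup>2 / (8 * \<sigma>\<^sup>2))"
    have "exp ((cmod (S \<omega>))\<^sup>2 / (8 * \<sigma>\<^sup>2)) = ?a * ?b"
      by (simp add: cmod_power2 exp_add[symmetric] add_divide_distrib)
    also have "\<dots> \<le> 1/2 * (?a * ?a) + 1/2 * (?b * ?b)"
      using zero_le_power2[of "?a - ?b"] by (simp add: power2_eq_square algebra_simps)
    also have "\<dots> = 1/2 * exp ((Re (S \<omega>))\<^sup>2 / (4 * \<sigma>\<^sup>2)) + 1/2 * exp ((Im (S \<omega>))\<^sup>2 / (4 * \<sigma>\<^sup>2))"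
      using \<sigma> by (simp add: exp_add[symmetric] field_simps)
    finally have "ennreal (exp ((cmod (S \<omega>))\<^sup>2 / (8 * \<sigma>\<^sup>2))) \<le> ennreal \<dots>" by (rule ennreal_leI)
    then show "ennreal (exp ((cmod (S \<omega>))\<^sup>2 / (8 * \<sigma>\<^sup>2))) \<le> ennreal (1/2) * ennreal (exp ((Re (S \<omega>))\<^sup>2 / (4 * \<sigma>\<^sup>2))) + ennreal (1/2) * ennreal (exp ((Im (S \<omega>))\<^sup>2 / (4 * \<sigma>\<^sup>2)))"
      by (simp only: ennreal_plus ennreal_mult mult_nonneg_nonneg exp_ge_zero zero_le_divide_1_iff zero_le_numeral)
  qed
  also have "\<dots> = ennreal (1/2) * (\<integral>\<^sup>+\<omega>. ennreal (exp ((Re (S \<omega>))\<^sup>2 / (4 * \<sigma>\<^sup>2))) \<partial>M) + ennreal (1/2) * (\<integral>\<^sup>+\<omega>. ennreal (exp ((Im (S \<omega>))\<^sup>2 / (4 * \<sigma>\<^sup>2))) \<partial>M)"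
    by (subst nn_integral_add) (auto simp: nn_integral_cmult)
  also have "\<dots> \<le> ennreal (1/2) * 2 + ennreal (1/2) * 2"
    by (intro add_mono mult_left_mono gaussian_exp_moment gr gi mr mi vr vi \<sigma>) auto
  also have "\<dots> = ennreal (1/2) * ennreal 2 + ennreal (1/2) * ennreal 2" by simp
  also have "\<dots> = 2" by (simp only: ennreal_mult[symmetric] ennreal_plus[symmetric]) simp
  finally show ?thesis .
qed

context
  fixes \<theta> :: "real \<Rightarrow> complex" and I :: "'a \<Rightarrow> complex"
  assumes I: "has_ms_integral M (\<lambda>t \<omega>. X t \<omega> * cnj (\<theta> t)) I"
begin

lemma I_measurable: "I \<in> borel_measurable M" using I by (simp add: has_ms_integral_def)

definition rsum :: "(real \<times> real set) set \<Rightarrow> 'a \<Rightarrow> complex" where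
  "rsum p \<omega> = (\<Sum>(x, K)\<in>p. of_real (measure lborel K) * (X x \<omega> * cnj (\<theta> x)))"

lemma rsum_lincomb: "finite p \<Longrightarrow> lincomb (rsum p)"
  using lincomb_sum[of p "\<lambda>(x, K). of_real (measure lborel K) * cnj (\<theta> x)" fst]
  unfolding rsum_def[abs_def] by (simp add: case_prod_unfold mult_ac)

lemma ms_integral_approx:
  obtains J where "\<And>a b. a \<le> b \<Longrightarrow> L2 (J a b)"
    "\<And>a b e. a \<le> b \<Longrightarrow> e > 0 \<Longrightarrow> \<exists>\<delta>>0. \<forall>p. p tagged_division_of {a..b} \<and> (\<lambda>x. ball x \<delta>) fine p \<longrightarrow> ms_distance M (rsum p) (J a b) < ennreal e"
    "(\<lambda>n. ms_distance M (J (- real n) (real n)) I) \<longlonglongrightarrow> 0"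
proof -
  from I obtain J where J: "\<And>a b. a \<le> b \<Longrightarrow> has_ms_integral_on M (\<lambda>t \<omega>. X t \<omega> * cnj (\<theta> t)) a b (J a b)"
    and lim: "((\<lambda>(a, b). ms_distance M (J a b) I) \<longlongrightarrow> 0) (at_bot \<times>\<^sub>F at_top)"
    unfolding has_ms_integral_def by auto
  have 2: "\<exists>\<delta>>0. \<forall>p. p tagged_division_of {a..b} \<and> (\<lambda>x. ball x \<delta>) fine p \<longrightarrow> ms_distance M (rsum p) (J a b) < ennreal e"
    if "a \<le> b" "e > 0" for a b e
    using J[OF that(1)] that(2) unfolding has_ms_integral_on_def rsum_def[abs_def] by blast
  show ?thesis
  proof (rule that[of J])
    show "L2 (J a b)" if ab: "a \<le> b" for a b
    proof -
      obtain \<delta> where \<delta>: "\<delta> > 0" "\<And>p. p tagged_division_of {a..b} \<Longrightarrow> (\<lambda>x. ball x \<delta>) fine p \<Longrightarrow> ms_distance M (rsum p) (J a b) < ennreal 1"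
        using 2[OF ab, of 1] by auto
      \<comment> \<open>A single fine division suffices: its Riemann sum is square-integrable and
        lies at finite distance from \<open>J a b\<close>.\<close>
      obtain p where p: "p tagged_division_of {a..b}" "(\<lambda>x. ball x \<delta>) fine p"
        using fine_division_exists_real[OF gauge_ball[OF \<delta>(1)]] by blast
      have "J a b \<in> borel_measurable M" using J[OF ab] by (simp add: has_ms_integral_on_def)
      then show ?thesis
        using L2_of_ms_distance[OF lincomb_L2[OF rsum_lincomb] _ \<delta>(2)[OF p]] p(1) by blast
    qed
    have "filterlim (\<lambda>n. (- real n, real n)) (at_bot \<times>\<^sub>F at_top) sequentially"
      by (intro filterlim_Pair filterlim_real_sequentially filterlim_compose[OF filterlim_uminus_at_bot_at_top])
    from filterlim_compose[OF lim this]
    show "(\<lambda>n. ms_distance M (J (- real n) (real n)) I) \<longlonglongrightarrow> 0" by simp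
  qed (use 2 in auto)
qed

lemma lincomb_approx:
  assumes "e > 0" obtains S where "lincomb S" "ms_distance M S I < ennreal e"
proof -
  obtain J where J: "\<And>a b. a \<le> b \<Longrightarrow> L2 (J a b)"
    "\<And>a b e. a \<le> b \<Longrightarrow> e > 0 \<Longrightarrow> \<exists>\<delta>>0. \<forall>p. p tagged_division_of {a..b} \<and> (\<lambda>x. ball x \<delta>) fine p \<longrightarrow> ms_distance M (rsum p) (J a b) < ennreal e"
    "(\<lambda>n. ms_distance M (J (- real n) (real n)) I) \<longlonglongrightarrow> 0"
    by (rule ms_integral_approx) blast
  \<comment> \<open>A quarter for each of the two errors, because squared distances satisfy the
    triangle inequality only up to the factor 2.\<close>
  have "\<forall>\<^sub>F n in sequentially. ms_distance M (J (- real n) (real n)) I < ennreal (e / 4)"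
    using order_tendstoD(2)[OF J(3), of "ennreal (e / 4)"] assms by simp
  then obtain n where n: "ms_distance M (J (- real n) (real n)) I < ennreal (e / 4)"
    by (auto simp: eventually_sequentially)
  obtain \<delta> where \<delta>: "\<delta> > 0" "\<And>p. p tagged_division_of {- real n..real n} \<Longrightarrow> (\<lambda>x. ball x \<delta>) fine p \<Longrightarrow> ms_distance M (rsum p) (J (- real n) (real n)) < ennreal (e / 4)"
    using J(2)[of "- real n" "real n" "e / 4"] assms by auto
  obtain p where p: "p tagged_division_of {- real n..real n}" "(\<lambda>x. ball x \<delta>) fine p"
    using fine_division_exists_real[OF gauge_ball[OF \<delta>(1)]] by blast
  have l: "lincomb (rsum p)" using p(1) by (intro rsum_lincomb) blast
  have "ms_distance M (rsum p) I \<le> 2 * ms_distance M (rsum p) (J (- real n) (real n)) + 2 * ms_distance M (J (- real n) (real n)) I"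
    using L2_measurable[OF lincomb_L2[OF l]] L2_measurable[OF J(1)] I_measurable
    by (intro ms_distance_triangle) auto
  also have "\<dots> < 2 * ennreal (e / 4) + 2 * ennreal (e / 4)"
    using \<delta>(2)[OF p] n by (intro add_strict_mono ennreal_mult_strict_left_mono) auto
  also have "\<dots> = ennreal 2 * ennreal (e / 4) + ennreal 2 * ennreal (e / 4)" by simp
  also have "\<dots> = ennreal e"
    using assms by (simp only: ennreal_mult[symmetric] ennreal_plus[symmetric]) simp
  finally show ?thesis using l that by blast
qed

lemma I_L2: "L2 I"
proof -
  obtain S where "lincomb S" "ms_distance M S I < ennreal 1" using lincomb_approx[of 1] by auto
  then show ?thesis using L2_of_ms_distance[OF lincomb_L2 I_measurable] by blast
qed

text \<open>Approximating linear combinations within squared distance \<open>v\<close> have second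
  moment at most \<open>2 * v + 2 * v = (2 * sqrt v)^2\<close>, so the constant for them is
  \<open>8 * 4 * v = 32 * v\<close>. A subsequence converges almost surely, and Fatou carries the
  moment bound to the limit, which need not be shown to be Gaussian.\<close>

lemma ms_integral_exp_moment:
  assumes v: "expectation (\<lambda>\<omega>. (cmod (I \<omega>))\<^sup>2) \<le> v" "v > 0"
  shows "(\<integral>\<^sup>+\<omega>. ennreal (exp ((cmod (I \<omega>))\<^sup>2 / (32 * v))) \<partial>M) \<le> 2"
proof -
  have [measurable]: "I \<in> borel_measurable M" by (rule I_measurable)
  have "\<exists>S. lincomb S \<and> ms_distance M S I < ennreal (min v (1 / Suc n))" for n
    using lincomb_approx[of "min v (1 / Suc n)"] v(2) by (metis min_less_iff_conj of_nat_0_less_iff zero_less_Suc zero_less_divide_1_iff)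
  then obtain S where S: "\<And>n. lincomb (S n)" "\<And>n. ms_distance M (S n) I < ennreal (min v (1 / Suc n))" by metis
  have SL: "L2 (S n)" for n by (rule lincomb_L2[OF S(1)])
  have [measurable]: "S n \<in> borel_measurable M" for n using SL[of n] by (rule L2_measurable)
  have dL: "L2 (\<lambda>\<omega>. S n \<omega> - I \<omega>)" for n by (intro L2_diff SL I_L2)
  have d: "expectation (\<lambda>\<omega>. (cmod (S n \<omega> - I \<omega>))\<^sup>2) < min v (1 / Suc n)" for n
    using S(2)[of n] unfolding ms_distance_L2[OF SL I_L2] by (simp add: ennreal_less_iff)
  have "(\<lambda>n. expectation (\<lambda>\<omega>. norm ((cmod (S n \<omega> - I \<omega>))\<^sup>2))) \<longlonglongrightarrow> 0"
  proof (rule tendsto_sandwich[OF _ _ tendsto_const])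
    show "(\<lambda>n. 1 / Suc n) \<longlonglongrightarrow> (0::real)" by (rule LIMSEQ_Suc[OF lim_inverse_n'])
    show "\<forall>\<^sub>F n in sequentially. expectation (\<lambda>\<omega>. norm ((cmod (S n \<omega> - I \<omega>))\<^sup>2)) \<le> 1 / Suc n"
      using d by (auto intro!: always_eventually less_imp_le)
  qed auto
  from tendsto_L1_AE_subseq[OF _ this] dL
  obtain r where r: "strict_mono r" "AE \<omega> in M. (\<lambda>n. (cmod (S (r n) \<omega> - I \<omega>))\<^sup>2) \<longlonglongrightarrow> 0"
    by (auto simp: L2_def)
  have conv: "AE \<omega> in M. (\<lambda>n. S (r n) \<omega>) \<longlonglongrightarrow> I \<omega>"
    using r(2)
  proof eventually_elim
    case (elim \<omega>)
    have "(\<lambda>n. cmod (S (r n) \<omega> - I \<omega>)) \<longlonglongrightarrow> 0" using tendsto_real_sqrt[OF elim] by simp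
    then have "(\<lambda>n. S (r n) \<omega> - I \<omega>) \<longlonglongrightarrow> 0" by (rule tendsto_norm_zero_cancel)
    then show ?case by (rule LIM_zero_cancel)
  qed
  have mom: "(\<integral>\<^sup>+\<omega>. ennreal (exp ((cmod (S n \<omega>))\<^sup>2 / (32 * v))) \<partial>M) \<le> 2" for n
  proof -
    have "expectation (\<lambda>\<omega>. (cmod (S n \<omega>))\<^sup>2) \<le> expectation (\<lambda>\<omega>. 2 * (cmod (S n \<omega> - I \<omega>))\<^sup>2 + 2 * (cmod (I \<omega>))\<^sup>2)"
    proof (rule integral_mono)
      show "(cmod (S n \<omega>))\<^sup>2 \<le> 2 * (cmod (S n \<omega> - I \<omega>))\<^sup>2 + 2 * (cmod (I \<omega>))\<^sup>2" for \<omega>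
        using cmod_add_square_le[of "S n \<omega> - I \<omega>" "I \<omega>"] by simp
    qed (use SL[of n] dL[of n] I_L2 in \<open>auto simp: L2_def\<close>)
    also have "\<dots> = 2 * expectation (\<lambda>\<omega>. (cmod (S n \<omega> - I \<omega>))\<^sup>2) + 2 * expectation (\<lambda>\<omega>. (cmod (I \<omega>))\<^sup>2)"
      using dL[of n] I_L2 by (simp add: L2_def)
    also have "\<dots> \<le> (2 * sqrt v)\<^sup>2" using d[of n] v by (simp add: power_mult_distrib)
    finally show ?thesis using lincomb_exp_moment[OF S(1)[of n], of "2 * sqrt v"] v(2)
      by (simp add: power_mult_distrib)
  qed
  have "(\<integral>\<^sup>+\<omega>. ennreal (exp ((cmod (I \<omega>))\<^sup>2 / (32 * v))) \<partial>M)
     = (\<integral>\<^sup>+\<omega>. liminf (\<lambda>n. ennreal (exp ((cmod (S (r n) \<omega>))\<^sup>2 / (32 * v)))) \<partial>M)"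
  proof (rule nn_integral_cong_AE)
    show "AE \<omega> in M. ennreal (exp ((cmod (I \<omega>))\<^sup>2 / (32 * v))) = liminf (\<lambda>n. ennreal (exp ((cmod (S (r n) \<omega>))\<^sup>2 / (32 * v))))"
      using conv
    proof eventually_elim
      case (elim \<omega>)
      show ?case
        using v(2) by (intro lim_imp_Liminf[symmetric] tendsto_ennrealI tendsto_intros elim) auto
    qed
  qed
  also have "\<dots> \<le> liminf (\<lambda>n. \<integral>\<^sup>+\<omega>. ennreal (exp ((cmod (S (r n) \<omega>))\<^sup>2 / (32 * v))) \<partial>M)"
    by (rule nn_integral_liminf) measurable
  also have "\<dots> \<le> liminf (\<lambda>n. 2)" by (intro Liminf_mono always_eventually allI mom)
  also have "\<dots> = 2" by (simp add: Liminf_const)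
  finally show ?thesis .
qed

text \<open>Pairing with a bounded \<open>Z\<close> is continuous for the mean-square distance and
  turns Riemann sums of the process into Riemann sums of the continuous deterministic function
  \<open>G\<close>. The random integral is thereby reduced to an ordinary one, first on bounded
  intervals and then on the line.\<close>

lemma ms_integral_test:
  assumes Z[measurable]: "Z \<in> borel_measurable M" "\<And>\<omega>. norm (Z \<omega>) \<le> 1"
    and fc: "continuous_on UNIV (\<lambda>s. expectation (\<lambda>\<omega>. X s \<omega> * Z \<omega>))" and \<theta>c: "continuous_on UNIV \<theta>"
    and fi: "integrable lborel (\<lambda>s. expectation (\<lambda>\<omega>. X s \<omega> * Z \<omega>) * cnj (\<theta> s))"
  shows "expectation (\<lambda>\<omega>. I \<omega> * Z \<omega>) = (LINT s|lborel. expectation (\<lambda>\<omega>. X s \<omega> * Z \<omega>) * cnj (\<theta> s))"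
proof -
  define f where "f s = expectation (\<lambda>\<omega>. X s \<omega> * Z \<omega>)" for s
  define G where "G s = f s * cnj (\<theta> s)" for s
  have Gc: "continuous_on UNIV G" unfolding G_def f_def using fc \<theta>c by (intro continuous_intros)
  have Gi: "integrable lborel G" using fi unfolding G_def f_def .
  have [measurable]: "G \<in> borel_measurable borel" by (rule borel_measurable_continuous_onI[OF Gc])
  obtain J where J: "\<And>a b. a \<le> b \<Longrightarrow> L2 (J a b)"
    "\<And>a b e. a \<le> b \<Longrightarrow> e > 0 \<Longrightarrow> \<exists>\<delta>>0. \<forall>p. p tagged_division_of {a..b} \<and> (\<lambda>x. ball x \<delta>) fine p \<longrightarrow> ms_distance M (rsum p) (J a b) < ennreal e"
    "(\<lambda>n. ms_distance M (J (- real n) (real n)) I) \<longlonglongrightarrow> 0"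
    by (rule ms_integral_approx) blast
  have JE: "expectation (\<lambda>\<omega>. J a b \<omega> * Z \<omega>) = integral {a..b} G" if ab: "a \<le> b" for a b
  proof -
    have "norm (expectation (\<lambda>\<omega>. J a b \<omega> * Z \<omega>) - integral {a..b} G) \<le> e" if e: "e > 0" for e
    proof -
      have e2: "(e/2)\<^sup>2 > 0" "e / 2 > 0" using e by auto
      obtain \<delta> where \<delta>: "\<delta> > 0" "\<And>p. p tagged_division_of {a..b} \<Longrightarrow> (\<lambda>x. ball x \<delta>) fine p \<Longrightarrow> ms_distance M (rsum p) (J a b) < ennreal ((e/2)\<^sup>2)"
        using J(2)[OF ab e2(1)] by auto
      have "G integrable_on {a..b}" by (rule integrable_continuous_real[OF continuous_on_subset[OF Gc]]) simp
      then have "(G has_integral integral {a..b} G) (cbox a b)" by (simp add: has_integral_integral)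
      then obtain \<gamma> where \<gamma>: "gauge \<gamma>" "\<And>p. p tagged_division_of (cbox a b) \<Longrightarrow> \<gamma> fine p \<Longrightarrow>
          norm ((\<Sum>(x, k)\<in>p. measure lborel k *\<^sub>R G x) - integral {a..b} G) < e / 2"
        unfolding has_integral using e2(2) by meson
      \<comment> \<open>Fine for both gauges at once, so that the mean-square integral and the gauge
        integral of \<open>G\<close> are compared through the same Riemann sum.\<close>
      obtain p where p: "p tagged_division_of {a..b}" "(\<lambda>x. ball x \<delta> \<inter> \<gamma> x) fine p"
        using fine_division_exists_real[OF gauge_Int[OF gauge_ball[OF \<delta>(1)] \<gamma>(1)]] by blast
      have fin: "finite p" using p(1) by blast
      have "norm (expectation (\<lambda>\<omega>. rsum p \<omega> * Z \<omega>) - expectation (\<lambda>\<omega>. J a b \<omega> * Z \<omega>)) \<le> e / 2"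
        using p e2 \<delta>(2) fin by (intro expectation_diff_le Z J(1) ab lincomb_L2 rsum_lincomb) (auto simp: fine_Int)
      moreover have "expectation (\<lambda>\<omega>. rsum p \<omega> * Z \<omega>) = (\<Sum>(x, k)\<in>p. measure lborel k *\<^sub>R G x)"
      proof -
        have "expectation (\<lambda>\<omega>. rsum p \<omega> * Z \<omega>) = expectation (\<lambda>\<omega>. \<Sum>q\<in>p. (of_real (measure lborel (snd q)) * cnj (\<theta> (fst q))) * (X (fst q) \<omega> * Z \<omega>))"
          unfolding rsum_def sum_distrib_right case_prod_unfold by (simp only: mult_ac)
        also have "\<dots> = (\<Sum>q\<in>p. expectation (\<lambda>\<omega>. (of_real (measure lborel (snd q)) * cnj (\<theta> (fst q))) * (X (fst q) \<omega> * Z \<omega>)))"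
          by (rule Bochner_Integration.integral_sum) (intro integrable_mult_right L2_integrable_mult X_L2 Z)
        also have "\<dots> = (\<Sum>(x, k)\<in>p. measure lborel k *\<^sub>R G x)"
          unfolding integral_mult_right_zero G_def f_def case_prod_unfold scaleR_conv_of_real
          by (simp only: mult_ac)
        finally show ?thesis .
      qed
      moreover have "norm ((\<Sum>(x, k)\<in>p. measure lborel k *\<^sub>R G x) - integral {a..b} G) < e / 2"
        using p by (intro \<gamma>(2)) (auto simp: fine_Int)
      ultimately show ?thesis
        using norm_triangle_ineq[of "expectation (\<lambda>\<omega>. J a b \<omega> * Z \<omega>) - expectation (\<lambda>\<omega>. rsum p \<omega> * Z \<omega>)" "expectation (\<lambda>\<omega>. rsum p \<omega> * Z \<omega>) - integral {a..b} G"]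
        by (simp add: norm_minus_commute)
    qed
    then have "norm (expectation (\<lambda>\<omega>. J a b \<omega> * Z \<omega>) - integral {a..b} G) \<le> 0"
      by (rule dense_ge)
    then show ?thesis by simp
  qed
  have 1: "(\<lambda>n. expectation (\<lambda>\<omega>. J (- real n) (real n) \<omega> * Z \<omega>)) \<longlonglongrightarrow> expectation (\<lambda>\<omega>. I \<omega> * Z \<omega>)"
  proof (rule LIMSEQ_I)
    fix e :: real assume e: "e > 0"
    then have "\<forall>\<^sub>F n in sequentially. ms_distance M (J (- real n) (real n)) I < ennreal ((e / 2)\<^sup>2)"
      by (intro order_tendstoD(2)[OF J(3)]) simp
    then obtain N where N: "\<And>n. n \<ge> N \<Longrightarrow> ms_distance M (J (- real n) (real n)) I < ennreal ((e / 2)\<^sup>2)"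
      by (auto simp: eventually_sequentially)
    have "norm (expectation (\<lambda>\<omega>. J (- real n) (real n) \<omega> * Z \<omega>) - expectation (\<lambda>\<omega>. I \<omega> * Z \<omega>)) \<le> e / 2" if "n \<ge> N" for n
      using e N[OF that] by (intro expectation_diff_le J(1) I_L2 Z) auto
    with e show "\<exists>N. \<forall>n\<ge>N. norm (expectation (\<lambda>\<omega>. J (- real n) (real n) \<omega> * Z \<omega>) - expectation (\<lambda>\<omega>. I \<omega> * Z \<omega>)) < e"
      by (intro exI[of _ N]) fastforce
  qed
  have 2: "(\<lambda>n. LINT s|lborel. indicator {- real n..real n} s *\<^sub>R G s) \<longlonglongrightarrow> (LINT s|lborel. G s)"
  proof (rule integral_dominated_convergence[where w="\<lambda>s. norm (G s)"])
    show "AE s in lborel. (\<lambda>n. indicator {- real n..real n} s *\<^sub>R G s) \<longlonglongrightarrow> G s"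
    proof (rule AE_I2, rule tendsto_eventually)
      fix s :: real
      have "\<forall>\<^sub>F n in sequentially. \<bar>s\<bar> \<le> real n"
        by (rule eventually_sequentiallyI[of "nat \<lceil>\<bar>s\<bar>\<rceil>"]) linarith
      then show "\<forall>\<^sub>F n in sequentially. indicator {- real n..real n} s *\<^sub>R G s = G s"
        by eventually_elim (auto simp: indicator_def)
    qed
  qed (use Gi in \<open>auto simp: indicator_def\<close>)
  have "(LINT s|lborel. indicator {- real n..real n} s *\<^sub>R G s) = integral {- real n..real n} G" for n
    using set_borel_integral_eq_integral(2)[of "{- real n..real n}" G]
      integrable_mult_indicator[of "{- real n..real n}" lborel G] Gi
    by (simp add: set_integrable_def set_lebesgue_integral_def)
  with 2 JE have "(\<lambda>n. expectation (\<lambda>\<omega>. J (- real n) (real n) \<omega> * Z \<omega>)) \<longlonglongrightarrow> (LINT s|lborel. G s)" by simp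
  from LIMSEQ_unique[OF 1 this] show ?thesis by (simp add: G_def f_def)
qed

end

lemma test_function:
  assumes Z[measurable]: "Z \<in> borel_measurable M" "\<And>\<omega>. norm (Z \<omega>) \<le> 1"
  shows "continuous_on UNIV (\<lambda>s. expectation (\<lambda>\<omega>. X s \<omega> * Z \<omega>))"
    and "norm (expectation (\<lambda>\<omega>. X s \<omega> * Z \<omega>)) \<le> sqrt (cmod (covariance M X s s))"
proof -
  have cov: "covariance M X s t = expectation (\<lambda>\<omega>. X s \<omega> * cnj (X t \<omega>))" for s t by (simp add: covariance_def)
  have ci: "integrable M (\<lambda>\<omega>. X s \<omega> * cnj (X t \<omega>))" for s t
  proof (rule Bochner_Integration.integrable_bound)
    show "integrable M (\<lambda>\<omega>. (cmod (X s \<omega>))\<^sup>2 + (cmod (X t \<omega>))\<^sup>2)" using square by simp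
    have "norm (X s \<omega> * cnj (X t \<omega>)) \<le> (cmod (X s \<omega>))\<^sup>2 + (cmod (X t \<omega>))\<^sup>2" for \<omega>
    proof -
      have "2 * (cmod (X s \<omega>) * cmod (X t \<omega>)) \<le> (cmod (X s \<omega>))\<^sup>2 + (cmod (X t \<omega>))\<^sup>2"
        using sum_squares_bound[of "cmod (X s \<omega>)" "cmod (X t \<omega>)"] by (simp add: mult.assoc)
      then show ?thesis unfolding norm_mult complex_mod_cnj
        using mult_nonneg_nonneg[OF norm_ge_zero norm_ge_zero, of "X s \<omega>" "X t \<omega>"] by linarith
    qed
    then show "AE \<omega> in M. norm (X s \<omega> * cnj (X t \<omega>)) \<le> norm ((cmod (X s \<omega>))\<^sup>2 + (cmod (X t \<omega>))\<^sup>2)"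
      by (intro AE_I2) (auto intro: order_trans[OF _ abs_ge_self])
  qed measurable
  have sqe: "expectation (\<lambda>\<omega>. (cmod (X s \<omega>))\<^sup>2) = cmod (covariance M X s s)" for s
  proof -
    have "covariance M X s s = of_real (expectation (\<lambda>\<omega>. (cmod (X s \<omega>))\<^sup>2))"
      unfolding cov complex_norm_square[symmetric] by (rule integral_complex_of_real)
    then show ?thesis by simp
  qed
  \<comment> \<open>The mean-square increment in terms of the covariance. It is continuous in
    \<open>s\<close> and vanishes at \<open>s = t\<close>, which is mean-square continuity of the
    process.\<close>
  define D where "D s t = Re (covariance M X s s - covariance M X s t - covariance M X t s + covariance M X t t)" for s t
  have D: "expectation (\<lambda>\<omega>. (cmod (X s \<omega> - X t \<omega>))\<^sup>2) = D s t" for s t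
  proof -
    have "of_real ((cmod (X s \<omega> - X t \<omega>))\<^sup>2) = X s \<omega> * cnj (X s \<omega>) - X s \<omega> * cnj (X t \<omega>) - X t \<omega> * cnj (X s \<omega>) + X t \<omega> * cnj (X t \<omega>)" for \<omega>
      unfolding complex_norm_square by (simp add: algebra_simps)
    then have "of_real (expectation (\<lambda>\<omega>. (cmod (X s \<omega> - X t \<omega>))\<^sup>2)) = covariance M X s s - covariance M X s t - covariance M X t s + covariance M X t t"
      unfolding integral_complex_of_real[symmetric] cov using ci by simp
    then show ?thesis unfolding D_def by (metis Re_complex_of_real)
  qed
  have pc: "continuous_on UNIV (\<lambda>s. covariance M X (u s) (w s))" if "continuous_on UNIV u" "continuous_on UNIV w" for u w
    using continuous_on_compose2[OF cov_cont continuous_on_Pair[OF that]] by auto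
  have Dc: "continuous_on UNIV (\<lambda>s. D s t)" for t
    unfolding D_def by (intro continuous_intros pc)
  show "continuous_on UNIV (\<lambda>s. expectation (\<lambda>\<omega>. X s \<omega> * Z \<omega>))"
    unfolding continuous_on_iff
  proof (intro ballI allI impI)
    fix t e :: real assume e: "e > 0"
    have "D t t = 0" unfolding D_def by simp
    moreover obtain d where "d > 0" "\<And>s. dist s t < d \<Longrightarrow> dist (D s t) (D t t) < (e / 2)\<^sup>2"
      using Dc[of t, unfolded continuous_on_iff] e by (metis UNIV_I zero_less_power half_gt_zero)
    ultimately have d: "d > 0" "\<And>s. dist s t < d \<Longrightarrow> D s t < (e / 2)\<^sup>2"
      by (fastforce simp: dist_real_def)+
    have "dist (expectation (\<lambda>\<omega>. X s \<omega> * Z \<omega>)) (expectation (\<lambda>\<omega>. X t \<omega> * Z \<omega>)) < e" if "dist s t < d" for s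
    proof -
      have "ms_distance M (X s) (X t) < ennreal ((e / 2)\<^sup>2)"
        unfolding ms_distance_L2[OF X_L2 X_L2] D using d(2)[OF that] e by (intro ennreal_lessI) auto
      then have "norm (expectation (\<lambda>\<omega>. X s \<omega> * Z \<omega>) - expectation (\<lambda>\<omega>. X t \<omega> * Z \<omega>)) \<le> e / 2"
        using e by (intro expectation_diff_le X_L2 Z) auto
      then show ?thesis using e by (simp add: dist_norm)
    qed
    with d(1) show "\<exists>d>0. \<forall>s\<in>UNIV. dist s t < d \<longrightarrow> dist (expectation (\<lambda>\<omega>. X s \<omega> * Z \<omega>)) (expectation (\<lambda>\<omega>. X t \<omega> * Z \<omega>)) < e" by blast
  qed
  have "norm (expectation (\<lambda>\<omega>. X s \<omega> * Z \<omega>)) \<le> expectation (\<lambda>\<omega>. norm (X s \<omega> * Z \<omega>))" by (rule integral_norm_bound)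
  also have "\<dots> \<le> expectation (\<lambda>\<omega>. cmod (X s \<omega>))"
    using Z(2) by (intro integral_mono integrable_norm L2_integrable_mult X_L2 X_integrable Z)
      (simp add: norm_mult mult_left_le)
  also have "\<dots> \<le> sqrt (cmod (covariance M X s s))"
  proof (rule real_le_rsqrt)
    have "0 \<le> variance (\<lambda>\<omega>. cmod (X s \<omega>))" by (rule variance_positive)
    also have "\<dots> = expectation (\<lambda>\<omega>. (cmod (X s \<omega>))\<^sup>2) - (expectation (\<lambda>\<omega>. cmod (X s \<omega>)))\<^sup>2"
      using X_integrable square by (intro variance_eq) auto
    finally show "(expectation (\<lambda>\<omega>. cmod (X s \<omega>)))\<^sup>2 \<le> cmod (covariance M X s s)" by (simp add: sqe)
  qed
  finally show "norm (expectation (\<lambda>\<omega>. X s \<omega> * Z \<omega>)) \<le> sqrt (cmod (covariance M X s s))" .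
qed

end


section \<open>Uniform convergence of the wavelet series\<close>

lemma card_int_le:
  assumes "x \<ge> 0"
  shows "emeasure CI {k::int. \<bar>real_of_int k\<bar> \<le> x} \<le> ennreal (2 * x + 1)"
proof -
  have eq: "{k::int. \<bar>real_of_int k\<bar> \<le> x} = {- \<lfloor>x\<rfloor>..\<lfloor>x\<rfloor>}"
    by (auto simp: abs_le_iff le_floor_iff) linarith+
  have "emeasure CI {- \<lfloor>x\<rfloor>..\<lfloor>x\<rfloor>} = ennreal (real (card {- \<lfloor>x\<rfloor>..\<lfloor>x\<rfloor>}))"
    by (subst emeasure_count_space_finite) (auto simp: ennreal_of_nat_eq_real_of_nat)
  also have "\<dots> \<le> ennreal (2 * x + 1)"
  proof (rule ennreal_leI)
    have "real (card {- \<lfloor>x\<rfloor>..\<lfloor>x\<rfloor>}) = of_int (2 * \<lfloor>x\<rfloor> + 1)"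
      using assms by (simp add: of_nat_nat)
    then show "real (card {- \<lfloor>x\<rfloor>..\<lfloor>x\<rfloor>}) \<le> 2 * x + 1" by simp
  qed
  finally show ?thesis unfolding eq .
qed

locale wavelet_process = weighted_wavelet_pair \<Phi> \<phi> \<psi> m0 c A a0 x0 + gaussian_L2_process M X
  for \<Phi> :: "real \<Rightarrow> real" and \<phi> \<psi> m0 :: "real \<Rightarrow> complex" and c A :: "real \<Rightarrow> real" and a0 x0 :: real
    and M :: "'a measure" and X :: "real \<Rightarrow> 'a \<Rightarrow> complex"
begin

text \<open>Free of \<open>t\<close> and measurable by construction, so it stands in for a supremum
  over \<open>t\<close> whose measurability would have to be argued separately.\<close>

definition "level_majorant R lam L u \<omega> = ennreal (L * latC 1)
   + (\<integral>\<^sup>+k. indicator {k. \<bar>real_of_int k\<bar> \<le> 2 * lam * R} k * ennreal (L * \<Phi> 0 * exp ((u k \<omega>)\<^sup>2 - L\<^sup>2)) \<partial>CI)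
   + (\<integral>\<^sup>+k. ennreal (u k \<omega> * E 1 (of_int k / 2)) \<partial>CI)" for u :: "int \<Rightarrow> 'a \<Rightarrow> real"

text \<open>\<open>10 = 2 * 5\<close>: an exponential moment is at most 2, and at most
  \<open>4 * lam * R + 1 <= 5 * lam * R\<close> indices are in range. The factor 2 of the last
  summand is again the exponential moment.\<close>

definition "level_const R = latC 1 + 10 * \<Phi> 0 * R + 2 * (LINT k|CI. E 1 (of_int k / 2))"

lemma level_const_nonneg: "R \<ge> 0 \<Longrightarrow> level_const R \<ge> 0"
  unfolding level_const_def by (intro add_nonneg_nonneg mult_nonneg_nonneg integral_nonneg_AE) auto

text \<open>The variables with \<open>|k|\<close> at most \<open>2 lam R\<close>, about \<open>lam\<close> many, are controlled by
  \<open>u \<le> L + L exp (u^2 - L^2)\<close>, which costs only the factor \<open>L\<close> when \<open>lam exp (- L^2) \<le> 1\<close>;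
  the others are damped by the decay of the envelope.\<close>

lemma level_bound:
  fixes u :: "int \<Rightarrow> 'a \<Rightarrow> real"
  assumes [measurable]: "\<And>k. u k \<in> borel_measurable M" and u0: "\<And>k \<omega>. 0 \<le> u k \<omega>"
    and mom: "\<And>k. (\<integral>\<^sup>+\<omega>. ennreal (exp ((u k \<omega>)\<^sup>2)) \<partial>M) \<le> 2"
    and lam: "lam \<ge> 1" and L: "L \<ge> 1" and lamL: "exp (- (L\<^sup>2)) * lam \<le> 1" and R: "R \<ge> 1"
  shows "level_majorant R lam L u \<in> borel_measurable M"
    and "(\<integral>\<^sup>+\<omega>. level_majorant R lam L u \<omega> \<partial>M) \<le> ennreal (level_const R * L)"
    and "\<bar>t\<bar> \<le> R \<Longrightarrow> (\<integral>\<^sup>+k. ennreal (u k \<omega> * E 1 (lam * t - of_int k)) \<partial>CI) \<le> level_majorant R lam L u \<omega>"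
proof -
  interpret CI: sigma_finite_measure CI by (rule sigma_finite_CI)
  interpret P: pair_sigma_finite M CI
    by (simp add: pair_sigma_finite_def sigma_finite_CI sigma_finite_measure_axioms)
  let ?N = "{k. \<bar>real_of_int k\<bar> \<le> 2 * lam * R}"
  let ?f1 = "\<lambda>k \<omega>. indicator ?N k * ennreal (L * \<Phi> 0 * exp ((u k \<omega>)\<^sup>2 - L\<^sup>2))"
  let ?f2 = "\<lambda>k \<omega>. ennreal (u k \<omega> * E 1 (of_int k / 2))"
  have m1[measurable]: "(\<lambda>(\<omega>, k). ?f1 k \<omega>) \<in> borel_measurable (M \<Otimes>\<^sub>M CI)" by (rule measurable_pair_CI) measurable
  have m2[measurable]: "(\<lambda>(\<omega>, k). ?f2 k \<omega>) \<in> borel_measurable (M \<Otimes>\<^sub>M CI)" by (rule measurable_pair_CI) measurable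
  show "level_majorant R lam L u \<in> borel_measurable M"
    unfolding level_majorant_def[abs_def] by measurable
  have A1: "(\<integral>\<^sup>+\<omega>. \<integral>\<^sup>+k. ?f1 k \<omega> \<partial>CI \<partial>M) \<le> ennreal (10 * \<Phi> 0 * R * L)"
  proof -
    have "(\<integral>\<^sup>+\<omega>. \<integral>\<^sup>+k. ?f1 k \<omega> \<partial>CI \<partial>M) = (\<integral>\<^sup>+k. \<integral>\<^sup>+\<omega>. ?f1 k \<omega> \<partial>M \<partial>CI)"
      by (rule P.Fubini'[symmetric]) (rule m1)
    also have "\<dots> \<le> (\<integral>\<^sup>+k. ennreal (2 * (L * \<Phi> 0 * exp (- (L\<^sup>2)))) * indicator ?N k \<partial>CI)"
    proof (rule nn_integral_mono)
      fix k :: int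
      have "(\<integral>\<^sup>+\<omega>. ennreal (L * \<Phi> 0 * exp ((u k \<omega>)\<^sup>2 - L\<^sup>2)) \<partial>M) = (\<integral>\<^sup>+\<omega>. ennreal (L * \<Phi> 0 * exp (- (L\<^sup>2))) * ennreal (exp ((u k \<omega>)\<^sup>2)) \<partial>M)"
        using L by (intro nn_integral_cong) (simp add: ennreal_mult[symmetric] exp_diff exp_minus divide_inverse mult_ac)
      also have "\<dots> = ennreal (L * \<Phi> 0 * exp (- (L\<^sup>2))) * (\<integral>\<^sup>+\<omega>. ennreal (exp ((u k \<omega>)\<^sup>2)) \<partial>M)"
        by (rule nn_integral_cmult) measurable
      also have "\<dots> \<le> ennreal (L * \<Phi> 0 * exp (- (L\<^sup>2))) * ennreal 2" using mom[of k] by (intro mult_left_mono) auto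
      also have "\<dots> = ennreal (2 * (L * \<Phi> 0 * exp (- (L\<^sup>2))))" using L by (subst ennreal_mult[symmetric]) (auto simp: mult_ac)
      finally have le: "(\<integral>\<^sup>+\<omega>. ennreal (L * \<Phi> 0 * exp ((u k \<omega>)\<^sup>2 - L\<^sup>2)) \<partial>M) \<le> \<dots>" .
      have "(\<integral>\<^sup>+\<omega>. ?f1 k \<omega> \<partial>M) = indicator ?N k * (\<integral>\<^sup>+\<omega>. ennreal (L * \<Phi> 0 * exp ((u k \<omega>)\<^sup>2 - L\<^sup>2)) \<partial>M)"
        by (rule nn_integral_cmult) measurable
      also have "\<dots> \<le> indicator ?N k * ennreal (2 * (L * \<Phi> 0 * exp (- (L\<^sup>2))))" using le by (rule mult_left_mono) simp
      finally show "(\<integral>\<^sup>+\<omega>. ?f1 k \<omega> \<partial>M) \<le> ennreal (2 * (L * \<Phi> 0 * exp (- (L\<^sup>2)))) * indicator ?N k" by (simp add: mult.commute)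
    qed
    also have "\<dots> = ennreal (2 * (L * \<Phi> 0 * exp (- (L\<^sup>2)))) * emeasure CI ?N"
      by (rule nn_integral_cmult_indicator) simp
    also have "\<dots> \<le> ennreal (2 * (L * \<Phi> 0 * exp (- (L\<^sup>2)))) * ennreal (2 * (2 * lam * R) + 1)"
      using lam R by (intro mult_left_mono card_int_le) auto
    also have "\<dots> = ennreal (2 * (L * \<Phi> 0 * exp (- (L\<^sup>2))) * (2 * (2 * lam * R) + 1))"
      using L lam R by (intro ennreal_mult[symmetric]) auto
    also have "\<dots> \<le> ennreal (10 * \<Phi> 0 * R * L)"
    proof (rule ennreal_leI)
      have "1 \<le> lam * R" using mult_mono[of 1 lam 1 R] lam R by simp
      then have "2 * (2 * lam * R) + 1 \<le> 5 * (lam * R)" unfolding mult.assoc by linarith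
      then have "2 * (L * \<Phi> 0 * exp (- (L\<^sup>2))) * (2 * (2 * lam * R) + 1) \<le> 2 * (L * \<Phi> 0 * exp (- (L\<^sup>2))) * (5 * (lam * R))"
        using L by (intro mult_left_mono) auto
      also have "\<dots> = (10 * L * \<Phi> 0 * R) * (exp (- (L\<^sup>2)) * lam)" by simp
      also have "\<dots> \<le> (10 * L * \<Phi> 0 * R) * 1" using L R by (intro mult_left_mono lamL) auto
      finally show "2 * (L * \<Phi> 0 * exp (- (L\<^sup>2))) * (2 * (2 * lam * R) + 1) \<le> 10 * \<Phi> 0 * R * L" by simp
    qed
    finally show ?thesis .
  qed
  have A2: "(\<integral>\<^sup>+\<omega>. \<integral>\<^sup>+k. ?f2 k \<omega> \<partial>CI \<partial>M) \<le> ennreal (2 * (LINT k|CI. E 1 (of_int k / 2)))"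
  proof -
    have "(\<integral>\<^sup>+\<omega>. \<integral>\<^sup>+k. ?f2 k \<omega> \<partial>CI \<partial>M) = (\<integral>\<^sup>+k. \<integral>\<^sup>+\<omega>. ?f2 k \<omega> \<partial>M \<partial>CI)"
      by (rule P.Fubini'[symmetric]) (rule m2)
    also have "\<dots> \<le> (\<integral>\<^sup>+k. ennreal (2 * E 1 (of_int k / 2)) \<partial>CI)"
    proof (rule nn_integral_mono)
      fix k :: int
      have "(\<integral>\<^sup>+\<omega>. ?f2 k \<omega> \<partial>M) \<le> (\<integral>\<^sup>+\<omega>. ennreal (E 1 (of_int k / 2)) * ennreal (exp ((u k \<omega>)\<^sup>2)) \<partial>M)"
      proof (rule nn_integral_mono)
        fix \<omega>
        have "u k \<omega> \<le> 1 + (u k \<omega>)\<^sup>2"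
          using zero_le_power2[of "u k \<omega> - 1/2"] by (simp add: power2_eq_square algebra_simps)
        also have "\<dots> \<le> exp ((u k \<omega>)\<^sup>2)" by (rule exp_ge_add_one_self)
        finally show "?f2 k \<omega> \<le> ennreal (E 1 (of_int k / 2)) * ennreal (exp ((u k \<omega>)\<^sup>2))"
          by (auto simp: ennreal_mult[symmetric] mult.commute intro!: ennreal_leI mult_right_mono)
      qed
      also have "\<dots> = ennreal (E 1 (of_int k / 2)) * (\<integral>\<^sup>+\<omega>. ennreal (exp ((u k \<omega>)\<^sup>2)) \<partial>M)"
        by (rule nn_integral_cmult) measurable
      also have "\<dots> \<le> ennreal (E 1 (of_int k / 2)) * ennreal 2" using mom[of k] by (intro mult_left_mono) auto
      finally show "(\<integral>\<^sup>+\<omega>. ?f2 k \<omega> \<partial>M) \<le> ennreal (2 * E 1 (of_int k / 2))"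
        by (subst (asm) ennreal_mult[symmetric]) (auto simp: mult.commute)
    qed
    also have "\<dots> = ennreal (LINT k|CI. 2 * E 1 (of_int k / 2))"
      using half_lattice_integrable[of 1] by (intro nn_integral_eq_integral) auto
    finally show ?thesis by simp
  qed
  have "(\<integral>\<^sup>+\<omega>. level_majorant R lam L u \<omega> \<partial>M) = ennreal (L * latC 1) + (\<integral>\<^sup>+\<omega>. \<integral>\<^sup>+k. ?f1 k \<omega> \<partial>CI \<partial>M) + (\<integral>\<^sup>+\<omega>. \<integral>\<^sup>+k. ?f2 k \<omega> \<partial>CI \<partial>M)"
    unfolding level_majorant_def by (subst nn_integral_add, measurable)+ (simp add: emeasure_space_1)
  also have "\<dots> \<le> ennreal (L * latC 1) + ennreal (10 * \<Phi> 0 * R * L) + ennreal (2 * (LINT k|CI. E 1 (of_int k / 2)))"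
    by (intro add_mono A1 A2 order_refl)
  also have "\<dots> = ennreal (L * latC 1 + 10 * \<Phi> 0 * R * L + 2 * (LINT k|CI. E 1 (of_int k / 2)))"
  proof -
    have "0 \<le> L * latC 1" "0 \<le> 10 * \<Phi> 0 * R * L" "0 \<le> 2 * (LINT k|CI. E 1 (of_int k / 2))"
      using L R by (auto intro!: integral_nonneg_AE)
    then show ?thesis by (simp only: ennreal_plus add_nonneg_nonneg)
  qed
  also have "\<dots> \<le> ennreal (level_const R * L)"
  proof (rule ennreal_leI)
    have "0 \<le> (LINT k|CI. E 1 (of_int k / 2))" by (intro integral_nonneg_AE) simp
    from mult_left_mono[OF L this] have "(LINT k|CI. E 1 (of_int k / 2)) \<le> (LINT k|CI. E 1 (of_int k / 2)) * L" by simp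
    then show "L * latC 1 + 10 * \<Phi> 0 * R * L + 2 * (LINT k|CI. E 1 (of_int k / 2)) \<le> level_const R * L"
      by (simp add: level_const_def algebra_simps)
  qed
  finally show "(\<integral>\<^sup>+\<omega>. level_majorant R lam L u \<omega> \<partial>M) \<le> ennreal (level_const R * L)" .
  assume t: "\<bar>t\<bar> \<le> R"
  have pt: "ennreal (u k \<omega> * E 1 (lam * t - of_int k)) \<le> ennreal (L * E 1 (lam * t - of_int k)) + ?f1 k \<omega> + ?f2 k \<omega>" for k
  proof (cases "k \<in> ?N")
    case True
    have uL: "u k \<omega> \<le> L + L * exp ((u k \<omega>)\<^sup>2 - L\<^sup>2)"
    proof (cases "u k \<omega> \<le> L")
      case False
      let ?x = "u k \<omega>"
      \<comment> \<open>Above \<open>L\<close> the exponential term alone dominates: as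
        \<open>1 / L <= 1 <= ?x + L\<close>, the quotient \<open>?x / L\<close> is at most
        \<open>1 + (?x^2 - L^2)\<close>.\<close>
      have "?x / L - 1 = (?x - L) * (1 / L)" using L by (simp add: field_simps)
      also have "\<dots> \<le> (?x - L) * (?x + L)"
      proof (rule mult_left_mono)
        have "1 / L \<le> 1" using L by simp
        then show "1 / L \<le> ?x + L" using False L by linarith
      qed (use False in simp)
      also have "\<dots> = ?x\<^sup>2 - L\<^sup>2" by (simp add: power2_eq_square algebra_simps)
      finally have "?x / L \<le> 1 + (?x\<^sup>2 - L\<^sup>2)" by simp
      also have "\<dots> \<le> exp (?x\<^sup>2 - L\<^sup>2)" by (rule exp_ge_add_one_self)
      finally have "?x \<le> L * exp (?x\<^sup>2 - L\<^sup>2)" using L by (simp add: pos_divide_le_eq mult.commute)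
      then show ?thesis using L by simp
    qed (use L in \<open>auto intro: add_increasing2\<close>)
    have "u k \<omega> * E 1 (lam * t - of_int k) \<le> (L + L * exp ((u k \<omega>)\<^sup>2 - L\<^sup>2)) * E 1 (lam * t - of_int k)"
      by (rule mult_right_mono[OF uL]) simp
    also have "\<dots> \<le> L * E 1 (lam * t - of_int k) + L * \<Phi> 0 * exp ((u k \<omega>)\<^sup>2 - L\<^sup>2)"
    proof -
      have "L * exp ((u k \<omega>)\<^sup>2 - L\<^sup>2) * E 1 (lam * t - of_int k) \<le> L * exp ((u k \<omega>)\<^sup>2 - L\<^sup>2) * \<Phi> 0"
        using L by (intro mult_left_mono) auto
      then show ?thesis by (simp add: algebra_simps)
    qed
    finally have "ennreal (u k \<omega> * E 1 (lam * t - of_int k)) \<le> ennreal \<dots>" by (rule ennreal_leI)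
    also have "\<dots> = ennreal (L * E 1 (lam * t - of_int k)) + ?f1 k \<omega>"
      using True L by (simp add: ennreal_plus)
    finally show ?thesis by (rule order_trans) simp
  next
    case False
    \<comment> \<open>For these indices \<open>lam * t\<close> is less than half of \<open>k\<close>
      in modulus, so its distance from \<open>k\<close> is at least \<open>|k| / 2\<close>, whatever
      \<open>t\<close> is.\<close>
    have "\<bar>lam * t\<bar> \<le> lam * R" using t lam by (simp add: abs_mult mult_left_mono)
    moreover have "2 * (lam * R) < \<bar>real_of_int k\<bar>" using False by (simp add: mult.assoc not_le)
    ultimately have "\<bar>of_int k / 2\<bar> \<le> \<bar>lam * t - of_int k\<bar>" by linarith
    then have "E 1 (lam * t - of_int k) \<le> E 1 (of_int k / 2)" by (rule E_abs_mono)
    then have "ennreal (u k \<omega> * E 1 (lam * t - of_int k)) \<le> ?f2 k \<omega>" by (intro ennreal_leI mult_left_mono u0)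
    then show ?thesis by (rule order_trans) simp
  qed
  have "(\<integral>\<^sup>+k. ennreal (u k \<omega> * E 1 (lam * t - of_int k)) \<partial>CI) \<le> (\<integral>\<^sup>+k. ennreal (L * E 1 (lam * t - of_int k)) + ?f1 k \<omega> + ?f2 k \<omega> \<partial>CI)"
    by (rule nn_integral_mono) (rule pt)
  also have "\<dots> = (\<integral>\<^sup>+k. ennreal (L * E 1 (lam * t - of_int k)) \<partial>CI) + (\<integral>\<^sup>+k. ?f1 k \<omega> \<partial>CI) + (\<integral>\<^sup>+k. ?f2 k \<omega> \<partial>CI)"
    by (subst nn_integral_add, simp, simp)+ simp
  also have "(\<integral>\<^sup>+k. ennreal (L * E 1 (lam * t - of_int k)) \<partial>CI) = ennreal (LINT k|CI. L * E 1 (lam * t - of_int k))"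
    using L by (intro nn_integral_eq_integral) auto
  also have "\<dots> \<le> ennreal (L * latC 1)" using L by (intro ennreal_leI) (simp add: mult_left_mono lattice_le)
  finally show "(\<integral>\<^sup>+k. ennreal (u k \<omega> * E 1 (lam * t - of_int k)) \<partial>CI) \<le> level_majorant R lam L u \<omega>"
    unfolding level_majorant_def by (simp add: add_right_mono)
qed

end

section \<open>Truncation errors and convergence of a single realization\<close>

lemma LINT_CI_finite:
  fixes f :: "int \<Rightarrow> 'b::{banach, second_countable_topology}"
  assumes "finite F"
  shows "(LINT k|CI. (if k \<in> F then f k else 0)) = (\<Sum>k\<in>F. f k)" "integrable CI (\<lambda>k. if k \<in> F then f k else 0)"
proof -
  have "integrable CI (\<lambda>k. if k \<in> F then f k else 0) \<and> (LINT k|CI. (if k \<in> F then f k else 0)) = (\<Sum>k\<in>F. f k)"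
    using assms
  proof (induction F)
    case (insert x F)
    have eq: "(\<lambda>k. if k \<in> insert x F then f k else 0) = (\<lambda>k. (if k = x then f k else 0) + (if k \<in> F then f k else 0))"
      using insert.hyps by (auto simp: fun_eq_iff)
    show ?case unfolding eq
      using insert integral_CI_single[of x "\<lambda>k. if k = x then f k else 0"] by simp
  qed simp
  then show "(LINT k|CI. (if k \<in> F then f k else 0)) = (\<Sum>k\<in>F. f k)" "integrable CI (\<lambda>k. if k \<in> F then f k else 0)" by auto
qed

lemma finite_abs_int_le [simp]: "finite {l::int. \<bar>l\<bar> \<le> int n}"
proof -
  have "{l::int. \<bar>l\<bar> \<le> int n} = {- int n..int n}" by auto
  then show ?thesis by simp
qed

text \<open>Two bounds for the same remainder: the first tends to 0 as \<open>n\<close> grows, the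
  second does not depend on \<open>n\<close> and can be summed over the levels.\<close>

lemma CI_sum_tail:
  fixes f :: "int \<Rightarrow> complex" and w :: "int \<Rightarrow> real"
  assumes w: "integrable CI w" and f: "\<And>k. norm (f k) \<le> w k"
  shows "integrable CI f"
    and "norm ((LINT k|CI. f k) - (\<Sum>k | \<bar>k\<bar> \<le> int n. f k)) \<le> (LINT k|CI. (if \<bar>k\<bar> \<le> int n then 0 else w k))"
    and "norm ((LINT k|CI. f k) - (\<Sum>k | \<bar>k\<bar> \<le> int n. f k)) \<le> (LINT k|CI. norm (f k))"
proof -
  show fi: "integrable CI f"
    by (rule Bochner_Integration.integrable_bound[OF w]) (auto intro!: AE_I2 order_trans[OF f])
  have w0: "0 \<le> w k" for k using order_trans[OF norm_ge_zero f] .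
  note F = LINT_CI_finite[of "{k. \<bar>k\<bar> \<le> int n}" f]
  have eq: "(LINT k|CI. f k) - (\<Sum>k | \<bar>k\<bar> \<le> int n. f k) = (LINT k|CI. (if \<bar>k\<bar> \<le> int n then 0 else f k))"
  proof -
    have "(LINT k|CI. f k) - (\<Sum>k | \<bar>k\<bar> \<le> int n. f k) = (LINT k|CI. f k - (if k \<in> {k. \<bar>k\<bar> \<le> int n} then f k else 0))"
      using F fi by (subst Bochner_Integration.integral_diff) auto
    also have "\<dots> = (LINT k|CI. (if \<bar>k\<bar> \<le> int n then 0 else f k))"
      by (rule Bochner_Integration.integral_cong) auto
    finally show ?thesis .
  qed
  have ti: "integrable CI (\<lambda>k. if \<bar>k\<bar> \<le> int n then 0 else f k)"
    by (rule Bochner_Integration.integrable_bound[OF fi]) auto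
  have wi: "integrable CI (\<lambda>k. if \<bar>k\<bar> \<le> int n then 0 else w k)"
    by (rule Bochner_Integration.integrable_bound[OF w]) auto
  have "norm (LINT k|CI. (if \<bar>k\<bar> \<le> int n then 0 else f k)) \<le> (LINT k|CI. norm (if \<bar>k\<bar> \<le> int n then 0 else f k))"
    by (rule integral_norm_bound)
  moreover have "(LINT k|CI. norm (if \<bar>k\<bar> \<le> int n then 0 else f k)) \<le> (LINT k|CI. (if \<bar>k\<bar> \<le> int n then 0 else w k))"
    by (rule integral_mono[OF integrable_norm[OF ti] wi]) (auto intro: f)
  moreover have "(LINT k|CI. norm (if \<bar>k\<bar> \<le> int n then 0 else f k)) \<le> (LINT k|CI. norm (f k))"
    by (rule integral_mono[OF integrable_norm[OF ti] integrable_norm[OF fi]]) auto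
  ultimately show "norm ((LINT k|CI. f k) - (\<Sum>k | \<bar>k\<bar> \<le> int n. f k)) \<le> (LINT k|CI. (if \<bar>k\<bar> \<le> int n then 0 else w k))"
    "norm ((LINT k|CI. f k) - (\<Sum>k | \<bar>k\<bar> \<le> int n. f k)) \<le> (LINT k|CI. norm (f k))"
    unfolding eq by linarith+
qed

lemma CI_tail_tendsto_0:
  fixes w :: "int \<Rightarrow> real"
  assumes w: "integrable CI w" and n: "filterlim n at_top sequentially"
  shows "(\<lambda>m. LINT k|CI. (if \<bar>k\<bar> \<le> int (n m) then 0 else w k)) \<longlonglongrightarrow> 0"
proof -
  have "(\<lambda>m. LINT k|CI. (if \<bar>k\<bar> \<le> int (n m) then 0 else w k)) \<longlonglongrightarrow> (LINT k|CI. (0::real))"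
  proof (rule integral_dominated_convergence[where w="\<lambda>k. norm (w k)"])
    show "AE k in CI. (\<lambda>m. if \<bar>k\<bar> \<le> int (n m) then 0 else w k) \<longlonglongrightarrow> 0"
    proof (rule AE_I2, rule tendsto_eventually)
      fix k :: int
      have "\<forall>\<^sub>F m in sequentially. nat \<bar>k\<bar> \<le> n m" using n by (simp add: filterlim_at_top)
      then show "\<forall>\<^sub>F m in sequentially. (if \<bar>k\<bar> \<le> int (n m) then 0 else w k) = 0"
        by eventually_elim auto
    qed
  qed (use w in auto)
  then show ?thesis by simp
qed

text \<open>Tannery's theorem for one realization: \<open>a j\<close> bounds the level \<open>j\<close> uniformly in \<open>t\<close>, and
  \<open>d j\<close> bounds its terms.\<close>

lemma approximants_converge:
  fixes \<phi> \<psi> :: "real \<Rightarrow> complex"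
  assumes d0: "integrable CI d0" "\<And>k t. t \<in> S \<Longrightarrow> norm (\<xi> k \<omega> * dilate \<phi> 0 k t) \<le> d0 k"
    and d: "\<And>j. integrable CI (d j)" "\<And>j k t. t \<in> S \<Longrightarrow> norm (\<eta> j k \<omega> * dilate \<psi> (int j) k t) \<le> d j k"
    and a: "summable a" "\<And>j t. t \<in> S \<Longrightarrow> (LINT k|CI. norm (\<eta> j k \<omega> * dilate \<psi> (int j) k t)) \<le> a j"
  obtains Y where "\<And>N K0 K. filterlim N at_top sequentially \<Longrightarrow> filterlim K0 at_top sequentially \<Longrightarrow>
      (\<And>j. filterlim (\<lambda>m. K m j) at_top sequentially) \<Longrightarrow>
      uniform_limit S (\<lambda>m t. approximant \<phi> \<psi> \<xi> \<eta> (N m) (K0 m) (K m) t \<omega>) Y sequentially"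
proof -
  define f0 where "f0 k t = \<xi> k \<omega> * dilate \<phi> 0 k t" for k t
  define f where "f j k t = \<eta> j k \<omega> * dilate \<psi> (int j) k t" for j k t
  define Y where "Y t = (LINT k|CI. f0 k t) + (\<Sum>j. LINT k|CI. f j k t)" for t
  show ?thesis
  proof (rule that[of Y])
    fix N K0 :: "nat \<Rightarrow> nat" and K :: "nat \<Rightarrow> nat \<Rightarrow> nat"
    assume N: "filterlim N at_top sequentially" and K0: "filterlim K0 at_top sequentially"
      and K: "\<And>j. filterlim (\<lambda>m. K m j) at_top sequentially"
    define tail0 where "tail0 m = (LINT k|CI. (if \<bar>k\<bar> \<le> int (K0 m) then 0 else d0 k))" for m
    define tail where "tail m j = (LINT k|CI. (if \<bar>k\<bar> \<le> int (K m j) then 0 else d j k))" for m j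
    \<comment> \<open>The error charged to level \<open>j\<close>: the better of the two remainder
      bounds if the level is included, the whole level if it is not. It never exceeds
      \<open>a j\<close> and tends to 0 for each fixed \<open>j\<close>, as dominated convergence of
      the series requires.\<close>
    define D where "D j m = (if j < N m then min (a j) (tail m j) else a j)" for j m
    show "uniform_limit S (\<lambda>m t. approximant \<phi> \<psi> \<xi> \<eta> (N m) (K0 m) (K m) t \<omega>) Y sequentially"
    proof (cases "S = {}")
      case False
      then obtain t0 where t0: "t0 \<in> S" by auto
      have a0: "0 \<le> a j" for j
        by (rule order_trans[OF _ a(2)[OF t0]]) simp
      have tail_nonneg: "0 \<le> tail m j" for m j
        unfolding tail_def using order_trans[OF norm_ge_zero d(2)[OF t0]] by (intro integral_nonneg_AE) auto
      have D0: "0 \<le> D j m" "D j m \<le> a j" for j m using a0 tail_nonneg by (auto simp: D_def)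
      have Dlim: "(\<lambda>m. D j m) \<longlonglongrightarrow> 0" for j
      proof (rule tendsto_sandwich[OF _ _ tendsto_const])
        show "(\<lambda>m. tail m j) \<longlonglongrightarrow> 0" unfolding tail_def by (rule CI_tail_tendsto_0[OF d(1) K])
        have "\<forall>\<^sub>F m in sequentially. Suc j \<le> N m" using N by (simp add: filterlim_at_top)
        then show "\<forall>\<^sub>F m in sequentially. D j m \<le> tail m j" by eventually_elim (auto simp: D_def)
      qed (use D0 in auto)
      have sumD: "(\<lambda>m. \<Sum>j. D j m) \<longlonglongrightarrow> (\<Sum>j::nat. 0)"
        using tannerys_theorem[where a=D and b="\<lambda>_. 0" and M=a and F=sequentially, OF Dlim] D0 a(1)
        by (auto intro!: always_eventually)
      have Ds: "summable (\<lambda>j. D j m)" for m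
        using D0 a(1) by (intro summable_comparison_test[OF _ a(1)]) auto
      have bound: "dist (approximant \<phi> \<psi> \<xi> \<eta> (N m) (K0 m) (K m) t \<omega>) (Y t) \<le> tail0 m + (\<Sum>j. D j m)" if t: "t \<in> S" for t m
      proof -
        have n0: "norm ((LINT k|CI. f0 k t) - (\<Sum>k | \<bar>k\<bar> \<le> int (K0 m). f0 k t)) \<le> tail0 m"
          unfolding tail0_def by (rule CI_sum_tail(2)[OF d0(1)]) (use d0(2)[OF t] in \<open>simp add: f0_def\<close>)
        define u where "u j = (LINT k|CI. f j k t) - (if j < N m then \<Sum>k | \<bar>k\<bar> \<le> int (K m j). f j k t else 0)" for j
        have fn: "norm (f j k t) \<le> d j k" for j k using d(2)[OF t] by (simp add: f_def)
        have fa: "(LINT k|CI. norm (f j k t)) \<le> a j" for j using a(2)[OF t] by (simp add: f_def)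
        have S: "summable (\<lambda>j. LINT k|CI. f j k t)"
          by (rule summable_comparison_test[OF _ a(1)]) (use order_trans[OF integral_norm_bound fa] in auto)
        have uD: "norm (u j) \<le> D j m" for j
        proof (cases "j < N m")
          case True
          then show ?thesis
            using CI_sum_tail(2)[OF d(1)[of j] fn[of j], of "K m j"] order_trans[OF CI_sum_tail(3)[OF d(1)[of j] fn[of j], of "K m j"] fa]
            by (simp add: u_def D_def tail_def)
        next
          case False
          then show ?thesis using order_trans[OF integral_norm_bound fa] by (simp add: u_def D_def)
        qed
        have fin: "summable (\<lambda>j. if j < N m then \<Sum>k | \<bar>k\<bar> \<le> int (K m j). f j k t else 0)"
          "(\<Sum>j. if j < N m then \<Sum>k | \<bar>k\<bar> \<le> int (K m j). f j k t else 0) = (\<Sum>j<N m. \<Sum>k | \<bar>k\<bar> \<le> int (K m j). f j k t)"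
        proof -
          show "summable (\<lambda>j. if j < N m then \<Sum>k | \<bar>k\<bar> \<le> int (K m j). f j k t else 0)"
            by (rule summable_finite[of "{..<N m}"]) auto
          show "(\<Sum>j. if j < N m then \<Sum>k | \<bar>k\<bar> \<le> int (K m j). f j k t else 0) = (\<Sum>j<N m. \<Sum>k | \<bar>k\<bar> \<le> int (K m j). f j k t)"
            by (subst suminf_finite[of "{..<N m}"]) auto
        qed
        have "Y t - approximant \<phi> \<psi> \<xi> \<eta> (N m) (K0 m) (K m) t \<omega> = ((LINT k|CI. f0 k t) - (\<Sum>k | \<bar>k\<bar> \<le> int (K0 m). f0 k t)) + (\<Sum>j. u j)"
          unfolding u_def suminf_diff[OF S fin(1), symmetric] fin(2)
          by (simp add: Y_def approximant_def f_def f0_def)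
        also have "norm \<dots> \<le> tail0 m + (\<Sum>j. D j m)"
        proof (rule norm_triangle_mono[OF n0])
          have su: "summable (\<lambda>j. norm (u j))"
            using uD by (intro summable_comparison_test[OF _ Ds[of m]]) auto
          have "norm (\<Sum>j. u j) \<le> (\<Sum>j. norm (u j))" by (rule summable_norm[OF su])
          also have "\<dots> \<le> (\<Sum>j. D j m)" by (rule suminf_le[OF uD su Ds])
          finally show "norm (\<Sum>j. u j) \<le> (\<Sum>j. D j m)" .
        qed
        finally show ?thesis by (simp add: dist_norm norm_minus_commute)
      qed
      have lim: "(\<lambda>m. tail0 m + (\<Sum>j. D j m)) \<longlonglongrightarrow> 0"
        using tendsto_add[OF CI_tail_tendsto_0[OF d0(1) K0] sumD] by (simp add: tail0_def)
      show ?thesis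
      proof (rule uniform_limitI)
        fix e :: real assume "e > 0"
        with lim have "\<forall>\<^sub>F m in sequentially. tail0 m + (\<Sum>j. D j m) < e" by (rule order_tendstoD)
        then show "\<forall>\<^sub>F m in sequentially. \<forall>t\<in>S. dist (approximant \<phi> \<psi> \<xi> \<eta> (N m) (K0 m) (K m) t \<omega>) (Y t) < e"
          by eventually_elim (use bound in \<open>auto intro: le_less_trans\<close>)
      qed
    qed (simp add: uniform_limit_iff)
  qed
qed


lemma dilate_nat: "dilate f (int j) k t = of_real (2 powr (real j / 2)) * f (2 ^ j * t - of_int k)"
  by (simp add: dilate_def)

lemma dilate_0: "dilate f 0 k t = f (t - of_int k)"
  by (simp add: dilate_def)

lemma sum_le_nn_integral_CI:
  assumes "finite F" shows "(\<Sum>k\<in>F. f k) \<le> (\<integral>\<^sup>+k. f k \<partial>CI)"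
proof -
  have "(\<Sum>k\<in>F. f k) = (\<integral>\<^sup>+k. f k * indicator F k \<partial>CI)"
    using assms by (subst nn_integral_indicator_finite) auto
  also have "\<dots> \<le> (\<integral>\<^sup>+k. f k \<partial>CI)" by (intro nn_integral_mono) (auto simp: indicator_def)
  finally show ?thesis .
qed

section \<open>Majorants of the coefficients\<close>

context wavelet_process
begin

lemma coeff_level:
  fixes I :: "int \<Rightarrow> 'a \<Rightarrow> complex"
  assumes I: "\<And>k. has_ms_integral M (\<lambda>t \<omega>. X t \<omega> * cnj (\<theta> k t)) (I k)"
    and le: "\<And>k. expectation (\<lambda>\<omega>. (cmod (I k \<omega>))\<^sup>2) \<le> s\<^sup>2" and s: "s > 0"
    and f: "\<And>x. norm (f x) \<le> E 1 x" and R: "R \<ge> 1"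
  obtains H where "H \<in> borel_measurable M"
    "(\<integral>\<^sup>+\<omega>. H \<omega> \<partial>M) \<le> ennreal (level_const R * sqrt 32 * (s * 2 powr (real j / 2) * sqrt (real j + 1)))"
    "\<And>t \<omega>. \<bar>t\<bar> \<le> R \<Longrightarrow> (\<integral>\<^sup>+k. ennreal (norm (I k \<omega> * dilate f (int j) k t)) \<partial>CI) \<le> H \<omega>"
proof -
  \<comment> \<open>Scaled so that the exponential moment bound with constant
    \<open>32 * s^2\<close> applies to \<open>exp (u^2)\<close> itself.\<close>
  define u where "u k \<omega> = cmod (I k \<omega>) / (sqrt 32 * s)" for k \<omega>
  \<comment> \<open>About \<open>2^j\<close> variables compete at this level, and
    \<open>2^j <= exp j <= exp (L^2)\<close>; the logarithm of their number therefore enters the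
    bound only as \<open>sqrt (j + 1)\<close>.\<close>
  define L where "L = sqrt (real j + 1)"
  define \<kappa> where "\<kappa> = sqrt 32 * s * 2 powr (real j / 2)"
  have \<kappa>: "\<kappa> \<ge> 0" using s by (simp add: \<kappa>_def)
  have [measurable]: "I k \<in> borel_measurable M" for k by (rule I_measurable[OF I])
  have um: "u k \<in> borel_measurable M" for k unfolding u_def by measurable
  have u0: "0 \<le> u k \<omega>" for k \<omega> using s by (simp add: u_def)
  have mom: "(\<integral>\<^sup>+\<omega>. ennreal (exp ((u k \<omega>)\<^sup>2)) \<partial>M) \<le> 2" for k
    using ms_integral_exp_moment[OF I le] s unfolding u_def by (simp add: power_divide power_mult_distrib)
  have lam: "(2::real) ^ j \<ge> 1" by simp
  have L1: "L \<ge> 1" by (simp add: L_def)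
  have lamL: "exp (- (L\<^sup>2)) * 2 ^ j \<le> 1"
  proof -
    have "(2::real) ^ j \<le> exp 1 ^ j" using exp_ge_add_one_self[of 1] by (intro power_mono) auto
    also have "\<dots> = exp (real j)" by (simp add: exp_of_nat_mult[symmetric])
    also have "\<dots> \<le> exp (L\<^sup>2)" by (simp add: L_def)
    finally show ?thesis by (simp add: exp_minus field_simps)
  qed
  note B = level_bound[OF um u0 mom lam L1 lamL R]
  show ?thesis
  proof (rule that[of "\<lambda>\<omega>. ennreal \<kappa> * level_majorant R (2 ^ j) L u \<omega>"])
    show "(\<lambda>\<omega>. ennreal \<kappa> * level_majorant R (2 ^ j) L u \<omega>) \<in> borel_measurable M" using B(1) by measurable
    have "(\<integral>\<^sup>+\<omega>. ennreal \<kappa> * level_majorant R (2 ^ j) L u \<omega> \<partial>M) = ennreal \<kappa> * (\<integral>\<^sup>+\<omega>. level_majorant R (2 ^ j) L u \<omega> \<partial>M)"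
      by (rule nn_integral_cmult) (rule B(1))
    also have "\<dots> \<le> ennreal \<kappa> * ennreal (level_const R * L)" by (intro mult_left_mono B(2)) simp
    also have "\<dots> = ennreal (\<kappa> * (level_const R * L))"
      using \<kappa> level_const_nonneg[of R] R L1 by (intro ennreal_mult[symmetric]) auto
    also have "\<kappa> * (level_const R * L) = level_const R * sqrt 32 * (s * 2 powr (real j / 2) * sqrt (real j + 1))"
      by (simp add: \<kappa>_def L_def)
    finally show "(\<integral>\<^sup>+\<omega>. ennreal \<kappa> * level_majorant R (2 ^ j) L u \<omega> \<partial>M) \<le> ennreal (level_const R * sqrt 32 * (s * 2 powr (real j / 2) * sqrt (real j + 1)))" .
    fix t \<omega> assume t: "\<bar>t\<bar> \<le> R"
    have "(\<integral>\<^sup>+k. ennreal (norm (I k \<omega> * dilate f (int j) k t)) \<partial>CI) \<le> (\<integral>\<^sup>+k. ennreal \<kappa> * ennreal (u k \<omega> * E 1 (2 ^ j * t - of_int k)) \<partial>CI)"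
    proof (rule nn_integral_mono)
      fix k :: int
      have "norm (I k \<omega> * dilate f (int j) k t) \<le> cmod (I k \<omega>) * (2 powr (real j / 2) * E 1 (2 ^ j * t - of_int k))"
        unfolding dilate_nat norm_mult by (intro mult_left_mono) (auto intro!: mult_left_mono f)
      also have "\<dots> = \<kappa> * (u k \<omega> * E 1 (2 ^ j * t - of_int k))" using s by (simp add: \<kappa>_def u_def)
      finally show "ennreal (norm (I k \<omega> * dilate f (int j) k t)) \<le> ennreal \<kappa> * ennreal (u k \<omega> * E 1 (2 ^ j * t - of_int k))"
        using \<kappa> u0 by (subst ennreal_mult[symmetric]) (auto intro: ennreal_leI)
    qed
    also have "\<dots> = ennreal \<kappa> * (\<integral>\<^sup>+k. ennreal (u k \<omega> * E 1 (2 ^ j * t - of_int k)) \<partial>CI)"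
      by (rule nn_integral_cmult) simp
    also have "\<dots> \<le> ennreal \<kappa> * level_majorant R (2 ^ j) L u \<omega>" by (intro mult_left_mono B(3) t) simp
    finally show "(\<integral>\<^sup>+k. ennreal (norm (I k \<omega> * dilate f (int j) k t)) \<partial>CI) \<le> ennreal \<kappa> * level_majorant R (2 ^ j) L u \<omega>" .
  qed
qed

text \<open>It supplies a majorant for the tails inside one level. No rate in \<open>j\<close> is
  asked for, so the second moments and the lattice summability of the envelope are enough.\<close>

lemma coeff_summable:
  fixes I :: "int \<Rightarrow> 'a \<Rightarrow> complex"
  assumes I: "\<And>k. has_ms_integral M (\<lambda>t \<omega>. X t \<omega> * cnj (\<theta> k t)) (I k)"
    and le: "\<And>k. expectation (\<lambda>\<omega>. (cmod (I k \<omega>))\<^sup>2) \<le> v" and r: "r \<ge> 0"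
  shows "AE \<omega> in M. integrable CI (\<lambda>k. cmod (I k \<omega>) * E r (of_int k))"
proof -
  interpret CI: sigma_finite_measure CI by (rule sigma_finite_CI)
  interpret P: pair_sigma_finite M CI
    by (simp add: pair_sigma_finite_def sigma_finite_CI sigma_finite_measure_axioms)
  have [measurable]: "I k \<in> borel_measurable M" for k by (rule I_measurable[OF I])
  have v: "v \<ge> 0" using order_trans[OF integral_nonneg_AE le[of 0]] by simp
  have L: "L2 (I k)" for k by (rule I_L2[OF I])
  let ?f = "\<lambda>\<omega> k. ennreal (cmod (I k \<omega>) * E r (of_int k))"
  have m[measurable]: "(\<lambda>(\<omega>, k). ?f \<omega> k) \<in> borel_measurable (M \<Otimes>\<^sub>M CI)" by (rule measurable_pair_CI) measurable
  have "(\<integral>\<^sup>+\<omega>. \<integral>\<^sup>+k. ?f \<omega> k \<partial>CI \<partial>M) = (\<integral>\<^sup>+k. \<integral>\<^sup>+\<omega>. ?f \<omega> k \<partial>M \<partial>CI)"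
    by (rule P.Fubini'[symmetric]) (rule m)
  also have "\<dots> \<le> (\<integral>\<^sup>+k. ennreal ((1 + v) * E r (of_int k)) \<partial>CI)"
  proof (rule nn_integral_mono)
    fix k :: int
    have i: "integrable M (\<lambda>\<omega>. 1 + (cmod (I k \<omega>))\<^sup>2)" using L[of k] by (simp add: L2_def)
    have "(\<integral>\<^sup>+\<omega>. ?f \<omega> k \<partial>M) \<le> (\<integral>\<^sup>+\<omega>. ennreal ((1 + (cmod (I k \<omega>))\<^sup>2) * E r (of_int k)) \<partial>M)"
    proof (intro nn_integral_mono ennreal_leI mult_right_mono)
      fix \<omega>
      show "cmod (I k \<omega>) \<le> 1 + (cmod (I k \<omega>))\<^sup>2"
        using zero_le_power2[of "cmod (I k \<omega>) - 1/2"] by (simp add: power2_eq_square algebra_simps)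
    qed simp
    also have "\<dots> = ennreal (expectation (\<lambda>\<omega>. (1 + (cmod (I k \<omega>))\<^sup>2) * E r (of_int k)))"
      using i by (intro nn_integral_eq_integral integrable_mult_left) auto
    also have "expectation (\<lambda>\<omega>. (1 + (cmod (I k \<omega>))\<^sup>2) * E r (of_int k)) = (1 + expectation (\<lambda>\<omega>. (cmod (I k \<omega>))\<^sup>2)) * E r (of_int k)"
      using L[of k] by (simp add: L2_def prob_space)
    also have "ennreal \<dots> \<le> ennreal ((1 + v) * E r (of_int k))"
      using le[of k] by (intro ennreal_leI mult_right_mono) auto
    finally show "(\<integral>\<^sup>+\<omega>. ?f \<omega> k \<partial>M) \<le> ennreal ((1 + v) * E r (of_int k))" .
  qed
  also have "\<dots> = ennreal (LINT k|CI. (1 + v) * E r (of_int k))"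
    using lattice_integrable(1)[OF r, of 0] v by (intro nn_integral_eq_integral) auto
  finally have "(\<integral>\<^sup>+\<omega>. \<integral>\<^sup>+k. ?f \<omega> k \<partial>CI \<partial>M) \<noteq> \<infinity>" by (auto simp: top_unique)
  then have "AE \<omega> in M. (\<integral>\<^sup>+k. ?f \<omega> k \<partial>CI) \<noteq> \<infinity>" by (intro nn_integral_PInf_AE) measurable
  then show ?thesis
  proof eventually_elim
    case (elim \<omega>)
    then show ?case by (intro integrableI_nonneg) (auto simp: less_top[symmetric])
  qed
qed

end

section \<open>The limit of the series and its identification with the process\<close>

locale wavelet_expansion = wavelet_process \<Phi> \<phi> \<psi> m0 c A a0 x0 M X
  for \<Phi> :: "real \<Rightarrow> real" and \<phi> \<psi> m0 :: "real \<Rightarrow> complex" and c A :: "real \<Rightarrow> real" and a0 x0 :: real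
    and M :: "'a measure" and X :: "real \<Rightarrow> 'a \<Rightarrow> complex" +
  fixes \<xi> :: "int \<Rightarrow> 'a \<Rightarrow> complex" and \<eta> :: "nat \<Rightarrow> int \<Rightarrow> 'a \<Rightarrow> complex" and b0 :: real and cj :: "nat \<Rightarrow> real"
  assumes cov_le: "\<And>t. sqrt (cmod (covariance M X t t)) \<le> c t"
    and \<xi>: "\<And>k. has_ms_integral M (\<lambda>t \<omega>. X t \<omega> * cnj (dilate \<phi> 0 k t)) (\<xi> k)"
    and \<eta>: "\<And>j k. has_ms_integral M (\<lambda>t \<omega>. X t \<omega> * cnj (dilate \<psi> (int j) k t)) (\<eta> j k)"
    and \<xi>_le: "\<And>k. expectation (\<lambda>\<omega>. (cmod (\<xi> k \<omega>))\<^sup>2) \<le> b0"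
    and \<eta>_le: "\<And>j k. expectation (\<lambda>\<omega>. (cmod (\<eta> j k \<omega>))\<^sup>2) \<le> cj j"
    and cj_summable: "summable (\<lambda>j. sqrt (cj j) * 2 powr (real j / 2) * sqrt (real j + 1))"
begin

lemma \<xi>_measurable [measurable]: "\<xi> k \<in> borel_measurable M" by (rule I_measurable[OF \<xi>])
lemma \<eta>_measurable [measurable]: "\<eta> j k \<in> borel_measurable M" by (rule I_measurable[OF \<eta>])

lemma approximant_measurable [measurable]: "approximant \<phi> \<psi> \<xi> \<eta> n k0 k t \<in> borel_measurable M"
  unfolding approximant_def[abs_def] by measurable

lemma approximant_continuous: "continuous_on S (\<lambda>t. approximant \<phi> \<psi> \<xi> \<eta> n k0 k t \<omega>)"
  unfolding approximant_def dilate_nat dilate_0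
  by (intro continuous_intros continuous_on_compose2[OF \<phi>_cont] continuous_on_compose2[OF \<psi>_cont]) auto

lemma majorants:
  assumes R: "R \<ge> 1"
  obtains H0 H where "H0 \<in> borel_measurable M" "\<And>j. H j \<in> borel_measurable M"
    "(\<integral>\<^sup>+\<omega>. H0 \<omega> + (\<Sum>j. H j \<omega>) \<partial>M) < \<infinity>"
    "\<And>t \<omega>. \<bar>t\<bar> \<le> R \<Longrightarrow> (\<integral>\<^sup>+k. ennreal (norm (\<xi> k \<omega> * dilate \<phi> 0 k t)) \<partial>CI) \<le> H0 \<omega>"
    "\<And>j t \<omega>. \<bar>t\<bar> \<le> R \<Longrightarrow> (\<integral>\<^sup>+k. ennreal (norm (\<eta> j k \<omega> * dilate \<psi> (int j) k t)) \<partial>CI) \<le> H j \<omega>"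
proof -
  have b0: "b0 \<ge> 0" using order_trans[OF integral_nonneg_AE \<xi>_le[of 0]] by simp
  have cj0: "cj j \<ge> 0" for j using order_trans[OF integral_nonneg_AE \<eta>_le[of j 0]] by simp
  \<comment> \<open>The additions keep the scales positive when a variance bound is 0, as
    \<open>coeff_level\<close> demands. The power \<open>(1/8)^j\<close> is small enough not to
    spoil summability, since \<open>2^(j/2) * sqrt (j + 1) <= 4^j\<close>.\<close>
  define s0 where "s0 = sqrt b0 + 1"
  define s where "s j = sqrt (cj j) + (1/8) ^ j" for j
  have sp: "s0 > 0" "s j > 0" for j using b0 cj0[of j] by (auto simp: s0_def s_def add_nonneg_pos)
  have s0b: "b0 \<le> s0\<^sup>2"
  proof -
    have "b0 = (sqrt b0)\<^sup>2" using b0 by simp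
    also have "\<dots> \<le> s0\<^sup>2" using b0 unfolding s0_def by (intro power_mono) auto
    finally show ?thesis .
  qed
  have sb: "cj j \<le> (s j)\<^sup>2" for j
  proof -
    have "cj j = (sqrt (cj j))\<^sup>2" using cj0 by simp
    also have "\<dots> \<le> (s j)\<^sup>2" using cj0 unfolding s_def by (intro power_mono) auto
    finally show ?thesis .
  qed
  let ?b = "\<lambda>s j. level_const R * sqrt 32 * (s * 2 powr (real j / 2) * sqrt (real j + 1))"
  obtain H0 where H0: "H0 \<in> borel_measurable M" "(\<integral>\<^sup>+\<omega>. H0 \<omega> \<partial>M) \<le> ennreal (?b s0 0)"
    "\<And>t \<omega>. \<bar>t\<bar> \<le> R \<Longrightarrow> (\<integral>\<^sup>+k. ennreal (norm (\<xi> k \<omega> * dilate \<phi> (int 0) k t)) \<partial>CI) \<le> H0 \<omega>"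
    by (rule coeff_level[where I=\<xi> and \<theta>="dilate \<phi> 0" and f=\<phi> and j=0, OF \<xi> order_trans[OF \<xi>_le s0b] sp(1) \<phi>_bd R]) blast
  have "\<exists>H. \<forall>j. H j \<in> borel_measurable M \<and> (\<integral>\<^sup>+\<omega>. H j \<omega> \<partial>M) \<le> ennreal (?b (s j) j) \<and>
    (\<forall>t \<omega>. \<bar>t\<bar> \<le> R \<longrightarrow> (\<integral>\<^sup>+k. ennreal (norm (\<eta> j k \<omega> * dilate \<psi> (int j) k t)) \<partial>CI) \<le> H j \<omega>)"
  proof (intro choice allI)
    fix j
    show "\<exists>H. H \<in> borel_measurable M \<and> (\<integral>\<^sup>+\<omega>. H \<omega> \<partial>M) \<le> ennreal (?b (s j) j) \<and>
      (\<forall>t \<omega>. \<bar>t\<bar> \<le> R \<longrightarrow> (\<integral>\<^sup>+k. ennreal (norm (\<eta> j k \<omega> * dilate \<psi> (int j) k t)) \<partial>CI) \<le> H \<omega>)"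
      by (rule coeff_level[where I="\<eta> j" and \<theta>="dilate \<psi> (int j)" and f=\<psi> and j=j, OF \<eta> order_trans[OF \<eta>_le sb] sp(2) \<psi>_bd R]) blast
  qed
  then obtain H where "\<forall>j. H j \<in> borel_measurable M \<and> (\<integral>\<^sup>+\<omega>. H j \<omega> \<partial>M) \<le> ennreal (?b (s j) j) \<and>
    (\<forall>t \<omega>. \<bar>t\<bar> \<le> R \<longrightarrow> (\<integral>\<^sup>+k. ennreal (norm (\<eta> j k \<omega> * dilate \<psi> (int j) k t)) \<partial>CI) \<le> H j \<omega>)" ..
  then have H: "\<And>j. H j \<in> borel_measurable M" "\<And>j. (\<integral>\<^sup>+\<omega>. H j \<omega> \<partial>M) \<le> ennreal (?b (s j) j)"
    "\<And>j t \<omega>. \<bar>t\<bar> \<le> R \<Longrightarrow> (\<integral>\<^sup>+k. ennreal (norm (\<eta> j k \<omega> * dilate \<psi> (int j) k t)) \<partial>CI) \<le> H j \<omega>"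
    by (simp_all only: simp_thms)
  have [measurable]: "H0 \<in> borel_measurable M" "H j \<in> borel_measurable M" for j using H0 H by auto
  have sum1: "summable (\<lambda>j. (1/8) ^ j * 2 powr (real j / 2) * sqrt (real j + 1))"
  proof (rule summable_comparison_test)
    have "norm ((1/8) ^ j * 2 powr (real j / 2) * sqrt (real j + 1)) \<le> (1/2) ^ j" for j
    proof -
      have "2 powr (real j / 2) \<le> 2 powr (real j)" by (intro powr_mono) auto
      then have 1: "2 powr (real j / 2) \<le> 2 ^ j" by (simp add: powr_realpow)
      have "real j + 1 \<le> 2 ^ j"
        by (induction j) auto
      moreover have "sqrt (real j + 1) \<le> real j + 1" by (rule real_le_lsqrt) (auto simp: power2_eq_square)
      ultimately have 2: "sqrt (real j + 1) \<le> 2 ^ j" by linarith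
      have "(1/8) ^ j * 2 powr (real j / 2) * sqrt (real j + 1) \<le> (1/8) ^ j * 2 ^ j * 2 ^ j"
        by (intro mult_mono 1 2) auto
      also have "\<dots> = ((1/8) * 2 * 2) ^ j" by (simp only: power_mult_distrib)
      also have "\<dots> = (1/2::real) ^ j" by simp
      finally show ?thesis by simp
    qed
    then show "\<exists>N. \<forall>j\<ge>N. norm ((1/8) ^ j * 2 powr (real j / 2) * sqrt (real j + 1)) \<le> (1/2) ^ j" by blast
  qed (simp add: summable_geometric)
  have sumb: "summable (\<lambda>j. ?b (s j) j)"
    using summable_mult[OF summable_add[OF cj_summable sum1], of "level_const R * sqrt 32"]
    unfolding s_def by (simp only: distrib_right)
  have b_nonneg: "0 \<le> ?b (s j) j" for j using sp(2)[of j] level_const_nonneg[of R] R by simp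
  have "(\<integral>\<^sup>+\<omega>. H0 \<omega> + (\<Sum>j. H j \<omega>) \<partial>M) = (\<integral>\<^sup>+\<omega>. H0 \<omega> \<partial>M) + (\<Sum>j. \<integral>\<^sup>+\<omega>. H j \<omega> \<partial>M)"
    by (subst nn_integral_add) (auto simp: nn_integral_suminf)
  also have "\<dots> \<le> ennreal (?b s0 0) + (\<Sum>j. ennreal (?b (s j) j))"
    by (intro add_mono H0(2) suminf_le H(2)) auto
  also have "\<dots> = ennreal (?b s0 0) + ennreal (\<Sum>j. ?b (s j) j)"
    by (subst suminf_ennreal2[OF b_nonneg sumb]) simp
  also have "\<dots> < \<infinity>" by simp
  finally have fin: "(\<integral>\<^sup>+\<omega>. H0 \<omega> + (\<Sum>j. H j \<omega>) \<partial>M) < \<infinity>" .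
  show ?thesis by (rule that[OF H0(1) H(1) fin]) (use H0(3) H(3) in auto)
qed

lemma approximant_dominated:
  assumes "(\<integral>\<^sup>+k. ennreal (norm (\<xi> k \<omega> * dilate \<phi> 0 k t)) \<partial>CI) \<le> H0 \<omega>"
    and "\<And>j. (\<integral>\<^sup>+k. ennreal (norm (\<eta> j k \<omega> * dilate \<psi> (int j) k t)) \<partial>CI) \<le> H j \<omega>"
  shows "ennreal (norm (approximant \<phi> \<psi> \<xi> \<eta> n k0 k t \<omega>)) \<le> H0 \<omega> + (\<Sum>j. H j \<omega>)"
proof -
  have fin: "ennreal (norm (\<Sum>k\<in>F. f k)) \<le> (\<integral>\<^sup>+k. ennreal (norm (f k)) \<partial>CI)" if "finite F" for F and f :: "int \<Rightarrow> complex"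
  proof -
    have "ennreal (norm (\<Sum>k\<in>F. f k)) \<le> ennreal (\<Sum>k\<in>F. norm (f k))" by (intro ennreal_leI norm_sum)
    also have "\<dots> = (\<Sum>k\<in>F. ennreal (norm (f k)))" by (rule sum_ennreal[symmetric]) simp
    also have "\<dots> \<le> (\<integral>\<^sup>+k. ennreal (norm (f k)) \<partial>CI)" by (rule sum_le_nn_integral_CI[OF that])
    finally show ?thesis .
  qed
  have "ennreal (norm (approximant \<phi> \<psi> \<xi> \<eta> n k0 k t \<omega>)) \<le>
    ennreal (norm (\<Sum>l | \<bar>l\<bar> \<le> int k0. \<xi> l \<omega> * dilate \<phi> 0 l t) + (\<Sum>j<n. norm (\<Sum>l | \<bar>l\<bar> \<le> int (k j). \<eta> j l \<omega> * dilate \<psi> (int j) l t)))"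
    unfolding approximant_def by (intro ennreal_leI norm_triangle_mono norm_sum order_refl)
  also have "\<dots> = ennreal (norm (\<Sum>l | \<bar>l\<bar> \<le> int k0. \<xi> l \<omega> * dilate \<phi> 0 l t)) + (\<Sum>j<n. ennreal (norm (\<Sum>l | \<bar>l\<bar> \<le> int (k j). \<eta> j l \<omega> * dilate \<psi> (int j) l t)))"
    by (subst ennreal_plus) (auto intro: sum_nonneg simp: sum_ennreal)
  also have "\<dots> \<le> H0 \<omega> + (\<Sum>j<n. H j \<omega>)"
    by (intro add_mono sum_mono order_trans[OF fin assms(1)] order_trans[OF fin assms(2)]) auto
  also have "\<dots> \<le> H0 \<omega> + (\<Sum>j. H j \<omega>)"
    by (intro add_left_mono sum_le_suminf) auto
  finally show ?thesis .
qed

text \<open>The exceptional set and the limit come before the truncations in the quantifier order: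
  the majorants of a realization do not know how the sums are cut. Hence all admissible sequences of
  truncations have a common limit.\<close>

lemma uniform_convergence:
  assumes R: "R \<ge> 1"
  shows "AE \<omega> in M. \<exists>Y. \<forall>N K0 K. filterlim N at_top sequentially \<longrightarrow> filterlim K0 at_top sequentially \<longrightarrow>
      (\<forall>j. filterlim (\<lambda>m. K m j) at_top sequentially) \<longrightarrow>
      uniform_limit {-R..R} (\<lambda>m t. approximant \<phi> \<psi> \<xi> \<eta> (N m) (K0 m) (K m) t \<omega>) Y sequentially"
proof -
  obtain H0 H where H: "H0 \<in> borel_measurable M" "\<And>j. H j \<in> borel_measurable M"
    "(\<integral>\<^sup>+\<omega>. H0 \<omega> + (\<Sum>j. H j \<omega>) \<partial>M) < \<infinity>"
    "\<And>t \<omega>. \<bar>t\<bar> \<le> R \<Longrightarrow> (\<integral>\<^sup>+k. ennreal (norm (\<xi> k \<omega> * dilate \<phi> 0 k t)) \<partial>CI) \<le> H0 \<omega>"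
    "\<And>j t \<omega>. \<bar>t\<bar> \<le> R \<Longrightarrow> (\<integral>\<^sup>+k. ennreal (norm (\<eta> j k \<omega> * dilate \<psi> (int j) k t)) \<partial>CI) \<le> H j \<omega>"
    by (rule majorants[OF R]) blast
  note [measurable] = H(1,2)
  have fin: "AE \<omega> in M. H0 \<omega> + (\<Sum>j. H j \<omega>) \<noteq> \<infinity>"
  proof (rule nn_integral_PInf_AE)
    show "(\<integral>\<^sup>+\<omega>. H0 \<omega> + (\<Sum>j. H j \<omega>) \<partial>M) \<noteq> \<infinity>" using H(3) by auto
  qed measurable
  have e0: "AE \<omega> in M. integrable CI (\<lambda>k. cmod (\<xi> k \<omega>) * E (1 + R) (of_int k))"
    by (rule coeff_summable[OF \<xi> \<xi>_le]) (use R in simp)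
  have e: "AE \<omega> in M. \<forall>j. integrable CI (\<lambda>k. cmod (\<eta> j k \<omega>) * E (1 + 2 ^ j * R) (of_int k))"
    by (subst AE_all_countable, rule allI, rule coeff_summable[OF \<eta> \<eta>_le]) (use R in simp)
  show ?thesis using fin e0 e
  proof eventually_elim
    case (elim \<omega>)
    have H_fin: "H j \<omega> \<noteq> \<infinity>" for j
    proof
      assume "H j \<omega> = \<infinity>"
      moreover have "H j \<omega> \<le> (\<Sum>j. H j \<omega>)" using sum_le_suminf[of "\<lambda>j. H j \<omega>" "{j}"] by simp
      ultimately have "(\<Sum>j. H j \<omega>) = top" by (simp add: top_unique)
      then show False using elim(1) by simp
    qed
    have "(\<Sum>j. ennreal (enn2real (H j \<omega>))) \<noteq> top"
      using elim(1) H_fin by (auto simp: less_top[symmetric])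
    then have sm: "summable (\<lambda>j. enn2real (H j \<omega>))" by (rule summable_suminf_not_top[rotated]) simp
    have Et: "E 1 (l * t - of_int k) \<le> E (1 + l * R) (of_int k)" if "\<bar>t\<bar> \<le> R" "l \<ge> 1" for l t and k :: int
    proof (rule E_mono)
      have "\<bar>l * t\<bar> \<le> l * R" using that by (simp add: abs_mult mult_left_mono)
      then show "\<bar>real_of_int k\<bar> - (1 + l * R) \<le> \<bar>l * t - real_of_int k\<bar> - 1" by linarith
    qed
    let ?p = "\<lambda>k. cmod (\<xi> k \<omega>) * E (1 + R) (of_int k)"
    let ?q = "\<lambda>j k. 2 powr (real j / 2) * (cmod (\<eta> j k \<omega>) * E (1 + 2 ^ j * R) (of_int k))"
    obtain Y where "\<And>N K0 K. filterlim N at_top sequentially \<Longrightarrow> filterlim K0 at_top sequentially \<Longrightarrow>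
      (\<And>j. filterlim (\<lambda>m. K m j) at_top sequentially) \<Longrightarrow>
      uniform_limit {-R..R} (\<lambda>m t. approximant \<phi> \<psi> \<xi> \<eta> (N m) (K0 m) (K m) t \<omega>) Y sequentially"
    proof (rule approximants_converge[where S="{-R..R}" and \<phi>=\<phi> and \<psi>=\<psi> and \<xi>=\<xi> and \<eta>=\<eta> and \<omega>=\<omega> and ?d0.0="?p" and d="?q" and a="\<lambda>j. enn2real (H j \<omega>)"])
      show "norm (\<xi> k \<omega> * dilate \<phi> 0 k t) \<le> ?p k" if "t \<in> {-R..R}" for k t
        unfolding norm_mult dilate_0 using order_trans[OF \<phi>_bd Et[of t 1 k]] that by (intro mult_left_mono) auto
      show "norm (\<eta> j k \<omega> * dilate \<psi> (int j) k t) \<le> ?q j k" if "t \<in> {-R..R}" for j k t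
      proof -
        have "norm (\<eta> j k \<omega> * dilate \<psi> (int j) k t) = 2 powr (real j / 2) * (cmod (\<eta> j k \<omega>) * norm (\<psi> (2 ^ j * t - of_int k)))"
          unfolding dilate_nat by (simp add: norm_mult)
        also have "\<dots> \<le> ?q j k"
          using order_trans[OF \<psi>_bd Et[of t "2 ^ j" k]] that by (intro mult_left_mono) auto
        finally show ?thesis .
      qed
      show "(LINT k|CI. norm (\<eta> j k \<omega> * dilate \<psi> (int j) k t)) \<le> enn2real (H j \<omega>)" if "t \<in> {-R..R}" for j t
        using that H_fin[of j] by (subst integral_eq_nn_integral) (auto intro!: enn2real_mono H(5) simp: less_top[symmetric])
    qed (use elim sm in auto)
    then show ?case by blast
  qed
qed

text \<open>The diagonal truncation is one admissible choice among many; taking \<open>lim\<close>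
  along it yields a definite, measurable version of the limit.\<close>

definition Y where "Y t \<omega> = lim (\<lambda>n. approximant \<phi> \<psi> \<xi> \<eta> n n (\<lambda>_. n) t \<omega>)"

lemma Y_measurable [measurable]: "Y t \<in> borel_measurable M" unfolding Y_def[abs_def] by measurable

lemma uniform_convergence_Y:
  assumes R: "R \<ge> 1"
  shows "AE \<omega> in M. \<forall>N K0 K. filterlim N at_top sequentially \<longrightarrow> filterlim K0 at_top sequentially \<longrightarrow>
      (\<forall>j. filterlim (\<lambda>m. K m j) at_top sequentially) \<longrightarrow>
      uniform_limit {-R..R} (\<lambda>m t. approximant \<phi> \<psi> \<xi> \<eta> (N m) (K0 m) (K m) t \<omega>) (\<lambda>t. Y t \<omega>) sequentially"
  using uniform_convergence[OF R]
proof eventually_elim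
  case (elim \<omega>)
  then obtain Y' where Y': "\<And>N K0 K. filterlim N at_top sequentially \<Longrightarrow> filterlim K0 at_top sequentially \<Longrightarrow>
      \<forall>j. filterlim (\<lambda>m. K m j) at_top sequentially \<Longrightarrow>
      uniform_limit {-R..R} (\<lambda>m t. approximant \<phi> \<psi> \<xi> \<eta> (N m) (K0 m) (K m) t \<omega>) Y' sequentially" by blast
  have "Y t \<omega> = Y' t" if "t \<in> {-R..R}" for t
  proof -
    have "uniform_limit {-R..R} (\<lambda>m t. approximant \<phi> \<psi> \<xi> \<eta> m m (\<lambda>_. m) t \<omega>) Y' sequentially"
      using Y'[of "\<lambda>m. m" "\<lambda>m. m" "\<lambda>m _. m"] by (simp add: filterlim_ident)
    from tendsto_uniform_limitI[OF this that] show ?thesis unfolding Y_def by (rule limI)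
  qed
  then have "uniform_limit {-R..R} F Y' sequentially \<longleftrightarrow> uniform_limit {-R..R} F (\<lambda>t. Y t \<omega>) sequentially" for F :: "nat \<Rightarrow> real \<Rightarrow> complex"
    by (intro uniform_limit_cong) auto
  with Y' show ?case by blast
qed

text \<open>Both variables have the same expectation against every bounded \<open>Z\<close>: for
  \<open>Y\<close> it is the limit of expected approximants, which the kernel identities evaluate as
  \<open>F t = E (X t Z)\<close>. The coefficients enter this computation only through ordinary
  integrals of \<open>F\<close> against the wavelets.\<close>

lemma X_eq_Y: "AE \<omega> in M. X t \<omega> = Y t \<omega>"
proof -
  define R where "R = \<bar>t\<bar> + 1"
  have R: "R \<ge> 1" "\<bar>t\<bar> \<le> R" by (auto simp: R_def)
  obtain H0 H where H: "H0 \<in> borel_measurable M" "\<And>j. H j \<in> borel_measurable M"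
    "(\<integral>\<^sup>+\<omega>. H0 \<omega> + (\<Sum>j. H j \<omega>) \<partial>M) < \<infinity>"
    "\<And>t \<omega>. \<bar>t\<bar> \<le> R \<Longrightarrow> (\<integral>\<^sup>+k. ennreal (norm (\<xi> k \<omega> * dilate \<phi> 0 k t)) \<partial>CI) \<le> H0 \<omega>"
    "\<And>j t \<omega>. \<bar>t\<bar> \<le> R \<Longrightarrow> (\<integral>\<^sup>+k. ennreal (norm (\<eta> j k \<omega> * dilate \<psi> (int j) k t)) \<partial>CI) \<le> H j \<omega>"
    by (rule majorants[OF R(1)]) blast
  note [measurable] = H(1,2)
  \<comment> \<open>\<open>enn2real\<close> sends infinity to 0, so \<open>W\<close> dominates only
    where the sum is finite; that is almost everywhere.\<close>
  define W where "W \<omega> = enn2real (H0 \<omega> + (\<Sum>j. H j \<omega>))" for \<omega>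
  have [measurable]: "W \<in> borel_measurable M" unfolding W_def by measurable
  have fin: "AE \<omega> in M. H0 \<omega> + (\<Sum>j. H j \<omega>) \<noteq> \<infinity>"
  proof (rule nn_integral_PInf_AE)
    show "(\<integral>\<^sup>+\<omega>. H0 \<omega> + (\<Sum>j. H j \<omega>) \<partial>M) \<noteq> \<infinity>" using H(3) by auto
  qed measurable
  have Wi: "integrable M W"
  proof (rule integrableI_nonneg)
    have le: "(\<integral>\<^sup>+\<omega>. ennreal (W \<omega>) \<partial>M) \<le> (\<integral>\<^sup>+\<omega>. H0 \<omega> + (\<Sum>j. H j \<omega>) \<partial>M)"
      unfolding W_def by (intro nn_integral_mono) (simp add: ennreal_enn2real_if)
    show "(\<integral>\<^sup>+\<omega>. ennreal (W \<omega>) \<partial>M) < \<infinity>" by (rule le_less_trans[OF le H(3)])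
  qed (auto simp: W_def)
  have dom: "AE \<omega> in M. norm (approximant \<phi> \<psi> \<xi> \<eta> n k0 k t \<omega>) \<le> W \<omega>" for n k0 k
    using fin
  proof eventually_elim
    case (elim \<omega>)
    have "ennreal (norm (approximant \<phi> \<psi> \<xi> \<eta> n k0 k t \<omega>)) \<le> H0 \<omega> + (\<Sum>j. H j \<omega>)"
      by (rule approximant_dominated) (use H(4,5) R in auto)
    then have "enn2real (ennreal (norm (approximant \<phi> \<psi> \<xi> \<eta> n k0 k t \<omega>))) \<le> W \<omega>"
      unfolding W_def using elim by (intro enn2real_mono) (auto simp: less_top[symmetric])
    then show ?case by simp
  qed
  have conv: "AE \<omega> in M. (\<lambda>m. approximant \<phi> \<psi> \<xi> \<eta> (N m) (K0 m) (K m) t \<omega>) \<longlonglongrightarrow> Y t \<omega>"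
    if "filterlim N at_top sequentially" "filterlim K0 at_top sequentially" "\<And>j. filterlim (\<lambda>m. K m j) at_top sequentially" for N K0 K
    using uniform_convergence_Y[OF R(1)]
  proof eventually_elim
    case (elim \<omega>)
    then have "uniform_limit {-R..R} (\<lambda>m t. approximant \<phi> \<psi> \<xi> \<eta> (N m) (K0 m) (K m) t \<omega>) (\<lambda>t. Y t \<omega>) sequentially"
      using that by blast
    from tendsto_uniform_limitI[OF this, of t] show ?case using R by (simp add: abs_le_iff)
  qed
  have Yi: "integrable M (Y t)"
    by (rule integrable_dominated_convergence[OF _ _ Wi conv[OF filterlim_ident filterlim_ident filterlim_ident] dom]) measurable
  have test: "expectation (\<lambda>\<omega>. Y t \<omega> * Z \<omega>) = expectation (\<lambda>\<omega>. X t \<omega> * Z \<omega>)"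
    if Z[measurable]: "Z \<in> borel_measurable M" "\<And>\<omega>. norm (Z \<omega>) \<le> 1" for Z
  proof -
    define F where "F s = expectation (\<lambda>\<omega>. X s \<omega> * Z \<omega>)" for s
    have Fc: "continuous_on UNIV F" unfolding F_def by (rule test_function(1)[OF Z])
    have Fle: "norm (F s) \<le> 1 * c s" for s
      unfolding F_def using order_trans[OF test_function(2)[OF Z] cov_le] by simp
    note SK = series_eq_kernel_integral[OF Fc Fle]
    have cd: "continuous_on UNIV (\<lambda>s. dilate f (int j) k s)" if "continuous_on UNIV f" for f j k
      unfolding dilate_nat by (intro continuous_intros continuous_on_compose2[OF that]) auto
    have di: "integrable lborel (\<lambda>s. F s * cnj (dilate f (int j) k s))" 
      if "\<And>x. norm (f x) \<le> E 1 x" "f \<in> borel_measurable borel" for f j k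
    proof -
      have "integrable lborel (\<lambda>s. of_real (2 powr (real j / 2)) * (F s * cnj (f (2 ^ j * s - of_int k))))"
        by (intro integrable_mult_right F_dilate_integrable[OF Fc Fle] that) simp
      then show ?thesis unfolding dilate_nat by (simp add: mult_ac)
    qed
    have E\<xi>: "expectation (\<lambda>\<omega>. \<xi> l \<omega> * Z \<omega>) * dilate \<phi> 0 l t = \<phi> (2 ^ 0 * t - of_int l) * (LINT s|lborel. F s * cnj (\<phi> (2 ^ 0 * s - of_int l)))" for l
    proof -
      have "expectation (\<lambda>\<omega>. \<xi> l \<omega> * Z \<omega>) = (LINT s|lborel. F s * cnj (dilate \<phi> 0 l s))"
        unfolding F_def using Fc di[OF \<phi>_bd \<phi>_measurable, of 0 l] cd[OF \<phi>_cont, of 0 l] unfolding F_def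
        by (intro ms_integral_test[OF \<xi> Z]) auto
      then show ?thesis unfolding dilate_0 by simp
    qed
    have E\<eta>: "expectation (\<lambda>\<omega>. \<eta> j l \<omega> * Z \<omega>) * dilate \<psi> (int j) l t = 2 ^ j * (\<psi> (2 ^ j * t - of_int l) * (LINT s|lborel. F s * cnj (\<psi> (2 ^ j * s - of_int l))))" for j l
    proof -
      have p: "complex_of_real (2 powr (real j / 2)) * of_real (2 powr (real j / 2)) = 2 ^ j"
        by (simp only: of_real_mult[symmetric] powr_add[symmetric]) (simp add: powr_realpow)
      have "expectation (\<lambda>\<omega>. \<eta> j l \<omega> * Z \<omega>) = (LINT s|lborel. F s * cnj (dilate \<psi> (int j) l s))"
        unfolding F_def using Fc di[OF \<psi>_bd \<psi>_measurable, of j l] cd[OF \<psi>_cont, of j l] unfolding F_def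
        by (intro ms_integral_test[OF \<eta> Z]) auto
      also have "\<dots> = (LINT s|lborel. of_real (2 powr (real j / 2)) * (F s * cnj (\<psi> (2 ^ j * s - of_int l))))"
        unfolding dilate_nat by (simp add: mult_ac)
      also have "\<dots> = of_real (2 powr (real j / 2)) * (LINT s|lborel. F s * cnj (\<psi> (2 ^ j * s - of_int l)))" by simp
      finally have "expectation (\<lambda>\<omega>. \<eta> j l \<omega> * Z \<omega>) * dilate \<psi> (int j) l t = (of_real (2 powr (real j / 2)) * of_real (2 powr (real j / 2))) *
        (\<psi> (2 ^ j * t - of_int l) * (LINT s|lborel. F s * cnj (\<psi> (2 ^ j * s - of_int l))))"
        unfolding dilate_nat by (simp only: mult_ac)
      then show ?thesis unfolding p .
    qed
    define Q where "Q n = 2 ^ n * (LINT s|lborel. F s * kernel \<phi> (2 ^ n * t) (2 ^ n * s))" for n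
    have part: "(\<lambda>m. \<Sum>l | \<bar>l\<bar> \<le> int m. f (2 ^ j * t - of_int l) * (LINT s|lborel. F s * cnj (f (2 ^ j * s - of_int l)))) \<longlonglongrightarrow> (LINT s|lborel. F s * kernel f (2 ^ j * t) (2 ^ j * s))"
      if f: "\<And>x. norm (f x) \<le> E 1 x" "f \<in> borel_measurable borel" for f j
    proof -
      let ?u = "\<lambda>l. f (2 ^ j * t - of_int l) * (LINT s|lborel. F s * cnj (f (2 ^ j * s - of_int l)))"
      have ui: "integrable CI ?u" by (rule SK(2)[OF f]) simp
      have "(\<lambda>m. (LINT l|CI. ?u l) - (\<Sum>l | \<bar>l\<bar> \<le> int m. ?u l)) \<longlonglongrightarrow> 0"
      proof (rule tendsto_norm_zero_cancel, rule tendsto_sandwich[OF _ _ tendsto_const])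
        show "(\<lambda>m. LINT l|CI. (if \<bar>l\<bar> \<le> int m then 0 else norm (?u l))) \<longlonglongrightarrow> 0"
          by (rule CI_tail_tendsto_0[OF integrable_norm[OF ui]]) (simp add: filterlim_ident)
        show "\<forall>\<^sub>F m in sequentially. norm ((LINT l|CI. ?u l) - (\<Sum>l | \<bar>l\<bar> \<le> int m. ?u l)) \<le> (LINT l|CI. (if \<bar>l\<bar> \<le> int m then 0 else norm (?u l)))"
          by (intro always_eventually allI CI_sum_tail(2)[OF integrable_norm[OF ui]]) simp
      qed auto
      from tendsto_diff[OF tendsto_const[of "LINT l|CI. ?u l"] this]
      show ?thesis using SK(1)[OF f, of "2 ^ j" t] by simp
    qed
    have Ea: "expectation (\<lambda>\<omega>. approximant \<phi> \<psi> \<xi> \<eta> n m (\<lambda>_. m) t \<omega> * Z \<omega>) =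
      (\<Sum>l | \<bar>l\<bar> \<le> int m. \<phi> (2 ^ 0 * t - of_int l) * (LINT s|lborel. F s * cnj (\<phi> (2 ^ 0 * s - of_int l)))) +
      (\<Sum>j<n. 2 ^ j * (\<Sum>l | \<bar>l\<bar> \<le> int m. \<psi> (2 ^ j * t - of_int l) * (LINT s|lborel. F s * cnj (\<psi> (2 ^ j * s - of_int l)))))" for n m
    proof -
      have i1: "integrable M (\<lambda>\<omega>. \<xi> l \<omega> * Z \<omega>)" for l by (intro L2_integrable_mult I_L2[OF \<xi>] Z)
      have i2: "integrable M (\<lambda>\<omega>. \<eta> j l \<omega> * Z \<omega>)" for j l by (intro L2_integrable_mult I_L2[OF \<eta>] Z)
      have "approximant \<phi> \<psi> \<xi> \<eta> n m (\<lambda>_. m) t \<omega> * Z \<omega> =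
        (\<Sum>l | \<bar>l\<bar> \<le> int m. (\<xi> l \<omega> * Z \<omega>) * dilate \<phi> 0 l t) + (\<Sum>j<n. \<Sum>l | \<bar>l\<bar> \<le> int m. (\<eta> j l \<omega> * Z \<omega>) * dilate \<psi> (int j) l t)" for \<omega>
        unfolding approximant_def distrib_right sum_distrib_right by (simp only: mult_ac)
      then have "expectation (\<lambda>\<omega>. approximant \<phi> \<psi> \<xi> \<eta> n m (\<lambda>_. m) t \<omega> * Z \<omega>) =
        (\<Sum>l | \<bar>l\<bar> \<le> int m. expectation (\<lambda>\<omega>. \<xi> l \<omega> * Z \<omega>) * dilate \<phi> 0 l t) + (\<Sum>j<n. \<Sum>l | \<bar>l\<bar> \<le> int m. expectation (\<lambda>\<omega>. \<eta> j l \<omega> * Z \<omega>) * dilate \<psi> (int j) l t)"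
        using i1 i2 by (simp add: Bochner_Integration.integral_sum Bochner_Integration.integral_add Bochner_Integration.integrable_sum)
      then show ?thesis unfolding E\<xi> E\<eta> sum_distrib_left .
    qed
    have limQ: "(\<lambda>m. expectation (\<lambda>\<omega>. approximant \<phi> \<psi> \<xi> \<eta> n m (\<lambda>_. m) t \<omega> * Z \<omega>)) \<longlonglongrightarrow> Q n" for n
    proof -
      have "Q n = (LINT s|lborel. F s * kernel \<phi> (2 ^ 0 * t) (2 ^ 0 * s)) + (\<Sum>j<n. 2 ^ j * (LINT s|lborel. F s * kernel \<psi> (2 ^ j * t) (2 ^ j * s)))"
        unfolding Q_def kernel_telescope[OF Fc Fle] by simp
      then show ?thesis unfolding Ea
        by (simp only:) (intro tendsto_intros part \<phi>_bd \<psi>_bd \<phi>_measurable \<psi>_measurable)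
    qed
    \<comment> \<open>For fixed \<open>n\<close> the truncation in \<open>k\<close> is relaxed until
      the expectation is within \<open>1 / (n + 1)\<close> of \<open>Q n\<close>. Requiring
      \<open>m >= n\<close> keeps the resulting sequence admissible, so the same expectations
      converge both to the value for \<open>Y\<close> and to \<open>F t\<close>.\<close>
    have "\<exists>m\<ge>n. norm (expectation (\<lambda>\<omega>. approximant \<phi> \<psi> \<xi> \<eta> n m (\<lambda>_. m) t \<omega> * Z \<omega>) - Q n) < 1 / Suc n" for n
    proof -
      obtain m0 where "\<And>m. m \<ge> m0 \<Longrightarrow> norm (expectation (\<lambda>\<omega>. approximant \<phi> \<psi> \<xi> \<eta> n m (\<lambda>_. m) t \<omega> * Z \<omega>) - Q n) < 1 / Suc n"
        using LIMSEQ_D[OF limQ[of n], of "1 / Suc n"] by auto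
      then show ?thesis by (intro exI[of _ "max n m0"]) auto
    qed
    then obtain k where k: "\<And>n. k n \<ge> n" "\<And>n. norm (expectation (\<lambda>\<omega>. approximant \<phi> \<psi> \<xi> \<eta> n (k n) (\<lambda>_. k n) t \<omega> * Z \<omega>) - Q n) < 1 / Suc n"
      by metis
    have kl: "filterlim k at_top sequentially"
      by (rule filterlim_at_top_mono[OF filterlim_ident]) (use k in auto)
    have "(\<lambda>n. expectation (\<lambda>\<omega>. approximant \<phi> \<psi> \<xi> \<eta> n (k n) (\<lambda>_. k n) t \<omega> * Z \<omega>)) \<longlonglongrightarrow> expectation (\<lambda>\<omega>. Y t \<omega> * Z \<omega>)"
    proof (rule integral_dominated_convergence[OF _ _ Wi])
      show "AE \<omega> in M. (\<lambda>n. approximant \<phi> \<psi> \<xi> \<eta> n (k n) (\<lambda>_. k n) t \<omega> * Z \<omega>) \<longlonglongrightarrow> Y t \<omega> * Z \<omega>"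
        using conv[of "\<lambda>n. n" k "\<lambda>n _. k n", OF filterlim_ident kl kl] by eventually_elim (intro tendsto_intros)
      show "AE \<omega> in M. norm (approximant \<phi> \<psi> \<xi> \<eta> n (k n) (\<lambda>_. k n) t \<omega> * Z \<omega>) \<le> W \<omega>" for n
        using dom[of n "k n" "\<lambda>_. k n"]
      proof eventually_elim
        case (elim \<omega>)
        have "norm (approximant \<phi> \<psi> \<xi> \<eta> n (k n) (\<lambda>_. k n) t \<omega> * Z \<omega>) \<le> norm (approximant \<phi> \<psi> \<xi> \<eta> n (k n) (\<lambda>_. k n) t \<omega>) * 1"
          unfolding norm_mult by (intro mult_left_mono Z) simp
        with elim show ?case by simp
      qed
    qed measurable
    moreover have "(\<lambda>n. expectation (\<lambda>\<omega>. approximant \<phi> \<psi> \<xi> \<eta> n (k n) (\<lambda>_. k n) t \<omega> * Z \<omega>)) \<longlonglongrightarrow> F t"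
    proof -
      have "(\<lambda>n. expectation (\<lambda>\<omega>. approximant \<phi> \<psi> \<xi> \<eta> n (k n) (\<lambda>_. k n) t \<omega> * Z \<omega>) - Q n) \<longlonglongrightarrow> 0"
      proof (rule tendsto_norm_zero_cancel, rule tendsto_sandwich[OF _ _ tendsto_const])
        show "(\<lambda>n. 1 / Suc n) \<longlonglongrightarrow> (0::real)" by (rule LIMSEQ_Suc[OF lim_inverse_n'])
      qed (use k(2) in \<open>auto intro!: always_eventually less_imp_le\<close>)
      from tendsto_add[OF this kernel_approximation[OF Fc Fle, of t, folded Q_def]] show ?thesis by simp
    qed
    ultimately show ?thesis unfolding F_def by (rule LIMSEQ_unique)
  qed
  define D where "D \<omega> = Y t \<omega> - X t \<omega>" for \<omega>
  have [measurable]: "D \<in> borel_measurable M" unfolding D_def by measurable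
  have Di: "integrable M D" unfolding D_def using Yi X_integrable by simp
  \<comment> \<open>The conjugate phase of \<open>D\<close>, which turns the test identity into
    vanishing of the expected modulus. Where \<open>D\<close> is 0 the division yields 0, which is
    harmless.\<close>
  define Z where "Z \<omega> = cnj (D \<omega>) / of_real (norm (D \<omega>))" for \<omega>
  have Z[measurable]: "Z \<in> borel_measurable M" "norm (Z \<omega>) \<le> 1" for \<omega>
    unfolding Z_def by (measurable, simp add: norm_divide)
  have DZ: "D \<omega> * Z \<omega> = of_real (norm (D \<omega>))" for \<omega>
    by (cases "D \<omega> = 0") (simp_all add: Z_def complex_norm_square[symmetric] power2_eq_square)
  have YZ: "integrable M (\<lambda>\<omega>. Y t \<omega> * Z \<omega>)"
    by (rule Bochner_Integration.integrable_bound[OF Yi]) (auto simp: norm_mult intro!: AE_I2 mult_left_le Z)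
  have "complex_of_real (expectation (\<lambda>\<omega>. norm (D \<omega>))) = expectation (\<lambda>\<omega>. D \<omega> * Z \<omega>)"
    unfolding DZ by simp
  also have "\<dots> = 0"
    unfolding D_def left_diff_distrib using YZ L2_integrable_mult[OF X_L2 Z, of t] test[OF Z] by simp
  finally have "expectation (\<lambda>\<omega>. norm (D \<omega>)) = 0" by simp
  then have "AE \<omega> in M. norm (D \<omega>) = 0"
    using Di by (subst (asm) integral_nonneg_eq_0_iff_AE) auto
  then show ?thesis by eventually_elim (simp add: D_def)
qed

end


text \<open>Equality with the continuous limit holds almost surely on the countable separating set,
  and separability extends it to all of \<open>[0, \<tau>]\<close>. Off one null set the exceedance
  event then equals a measurable event formed with rational times, whose probability tends to 0 by
  uniform convergence.\<close>

lemma (in wavelet_expansion) convergence_in_probability: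
  assumes sep: "separable_process M X"
    and N: "filterlim N at_top sequentially" and K0: "filterlim K0 at_top sequentially"
    and K: "\<And>j. filterlim (\<lambda>m. K m j) at_top sequentially"
    and \<tau>: "\<tau> > 0" and \<epsilon>: "\<epsilon> > 0"
  shows "sup_exceeds M \<tau> X (approximant \<phi> \<psi> \<xi> \<eta> (N m) (K0 m) (K m)) \<epsilon> \<in> sets (completion M)"
    and "(\<lambda>m. measure (completion M)
        (sup_exceeds M \<tau> X (approximant \<phi> \<psi> \<xi> \<eta> (N m) (K0 m) (K m)) \<epsilon>)) \<longlonglongrightarrow> 0"
proof -
  \<comment> \<open>One unit of room on either side of \<open>[0, \<tau>]\<close>, so that balls of
    radius at most 1 around its points stay in the range of uniform convergence.\<close>
  define R where "R = \<tau> + 1"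
  have R: "R \<ge> 1" using \<tau> by (simp add: R_def)
  define Am where "Am m t \<omega> = approximant \<phi> \<psi> \<xi> \<eta> (N m) (K0 m) (K m) t \<omega>" for m t \<omega>
  have [measurable]: "Am m t \<in> borel_measurable M" for m t unfolding Am_def[abs_def] by measurable
  have Ac: "continuous_on S (\<lambda>t. Am m t \<omega>)" for S m \<omega> unfolding Am_def by (rule approximant_continuous)
  obtain S where S: "countable S" "closure S = UNIV"
    and sepS: "AE \<omega> in M. \<forall>U F. open U \<and> closed F \<and> (\<forall>t\<in>U \<inter> S. X t \<omega> \<in> F) \<longrightarrow> (\<forall>t\<in>U. X t \<omega> \<in> F)"
    using sep unfolding separable_process_def by blast
  have XS: "AE \<omega> in M. \<forall>s\<in>S. X s \<omega> = Y s \<omega>"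
    using S(1) X_eq_Y by (simp add: AE_ball_countable)
  have good: "AE \<omega> in M. uniform_limit {-R..R} (\<lambda>m t. Am m t \<omega>) (\<lambda>t. Y t \<omega>) sequentially \<and>
     (\<forall>t\<in>{0..\<tau>}. X t \<omega> = Y t \<omega>)"
    using uniform_convergence_Y[OF R] sepS XS
  proof eventually_elim
    case (elim \<omega>)
    have ul: "uniform_limit {-R..R} (\<lambda>m t. Am m t \<omega>) (\<lambda>t. Y t \<omega>) sequentially"
      unfolding Am_def using elim(1) N K0 K by blast
    have Yc: "continuous_on {-R..R} (\<lambda>t. Y t \<omega>)"
      by (rule uniform_limit_theorem[OF _ ul]) (auto intro!: always_eventually Ac)
    have "X t \<omega> = Y t \<omega>" if t: "t \<in> {0..\<tau>}" for t
    proof (rule ccontr)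
      assume ne: "X t \<omega> \<noteq> Y t \<omega>"
      \<comment> \<open>Half the distance, so that the closed ball of radius \<open>e\<close> around
        \<open>Y t\<close> excludes \<open>X t\<close> while containing, by continuity of
        \<open>Y\<close>, the values \<open>X s = Y s\<close> at all nearby separating
        points.\<close>
      define e where "e = dist (X t \<omega>) (Y t \<omega>) / 2"
      have e: "e > 0" using ne by (simp add: e_def)
      have tR: "t \<in> {-R..R}" using t by (auto simp: R_def)
      obtain d where d: "d > 0" "\<And>s. s \<in> {-R..R} \<Longrightarrow> dist s t < d \<Longrightarrow> dist (Y s \<omega>) (Y t \<omega>) < e"
        using Yc[unfolded continuous_on_iff, rule_format, OF tR e] by blast
      let ?U = "ball t (min d 1)" and ?F = "cball (Y t \<omega>) e"
      have "X s \<omega> \<in> ?F" if "s \<in> ?U \<inter> S" for s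
      proof -
        have "s \<in> {-R..R}" "dist s t < d" using that t by (auto simp: dist_real_def R_def abs_less_iff)
        from d(2)[OF this] elim(3) that show ?thesis by (simp add: dist_commute less_imp_le)
      qed
      then have "\<forall>s\<in>?U. X s \<omega> \<in> ?F" using elim(2)[rule_format, of ?U ?F] by blast
      then have "X t \<omega> \<in> ?F" using d(1) by simp
      then have "dist (X t \<omega>) (Y t \<omega>) \<le> e" by (simp add: dist_commute)
      then show False using e by (simp add: e_def)
    qed
    with ul show ?case by blast
  qed
  obtain Z where Z: "{\<omega> \<in> space M. \<not> (uniform_limit {-R..R} (\<lambda>m t. Am m t \<omega>) (\<lambda>t. Y t \<omega>) sequentially \<and>
     (\<forall>t\<in>{0..\<tau>}. X t \<omega> = Y t \<omega>))} \<subseteq> Z" "emeasure M Z = 0" "Z \<in> sets M"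
    by (rule AE_E[OF good])
  then have Z0: "Z \<in> null_sets M" by (simp add: null_sets_def)
  \<comment> \<open>Rational times make the event a countable union. By continuity of
    \<open>Y\<close> and of the approximants a strict exceedance at any time persists at a nearby
    rational time.\<close>
  define Bm where "Bm m = {\<omega> \<in> space M. \<exists>q\<in>\<rat> \<inter> {0..\<tau>}. cmod (Y q \<omega> - Am m q \<omega>) > \<epsilon>}" for m
  define Em where "Em m = sup_exceeds M \<tau> X (approximant \<phi> \<psi> \<xi> \<eta> (N m) (K0 m) (K m)) \<epsilon>" for m
  have B_sets: "Bm m \<in> sets M" for m
  proof -
    have "countable (\<rat> \<inter> {0..\<tau>})" using countable_rat by (rule countable_subset[rotated]) auto
    moreover have "Bm m = (\<Union>q\<in>\<rat> \<inter> {0..\<tau>}. {\<omega> \<in> space M. cmod (Y q \<omega> - Am m q \<omega>) > \<epsilon>})"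
      by (auto simp: Bm_def)
    ultimately show ?thesis by (auto intro!: sets.countable_UN')
  qed
  have EB: "\<omega> \<in> Em m \<longleftrightarrow> \<omega> \<in> Bm m" if \<omega>: "\<omega> \<in> space M" "\<omega> \<notin> Z" for \<omega> m
  proof -
    have "uniform_limit {-R..R} (\<lambda>m t. Am m t \<omega>) (\<lambda>t. Y t \<omega>) sequentially \<and> (\<forall>t\<in>{0..\<tau>}. X t \<omega> = Y t \<omega>)"
      using Z(1) \<omega> by blast
    then have ul: "uniform_limit {-R..R} (\<lambda>m t. Am m t \<omega>) (\<lambda>t. Y t \<omega>) sequentially"
      and XY: "\<And>t. t \<in> {0..\<tau>} \<Longrightarrow> X t \<omega> = Y t \<omega>" by auto
    have Yc: "continuous_on {-R..R} (\<lambda>t. Y t \<omega>)"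
      by (rule uniform_limit_theorem[OF _ ul]) (auto intro!: always_eventually Ac)
    have "\<omega> \<in> Em m \<longleftrightarrow> (\<exists>t\<in>{0..\<tau>}. cmod (Y t \<omega> - Am m t \<omega>) > \<epsilon>)"
      using \<omega>(1) XY by (auto simp: Em_def sup_exceeds_def less_SUP_iff Am_def)
    also have "\<dots> \<longleftrightarrow> (\<exists>q\<in>\<rat> \<inter> {0..\<tau>}. cmod (Y q \<omega> - Am m q \<omega>) > \<epsilon>)"
    proof
      assume "\<exists>t\<in>{0..\<tau>}. cmod (Y t \<omega> - Am m t \<omega>) > \<epsilon>"
      then obtain t where t: "t \<in> {0..\<tau>}" "cmod (Y t \<omega> - Am m t \<omega>) > \<epsilon>" by auto
      have tR: "t \<in> {-R..R}" using t by (auto simp: R_def)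
      let ?f = "\<lambda>t. cmod (Y t \<omega> - Am m t \<omega>)"
      have "continuous_on {-R..R} ?f" by (intro continuous_intros Yc Ac)
      then obtain d where d: "d > 0" "\<And>s. s \<in> {-R..R} \<Longrightarrow> dist s t < d \<Longrightarrow> dist (?f s) (?f t) < ?f t - \<epsilon>"
        unfolding continuous_on_iff using tR t(2) by (metis diff_gt_0_iff_gt)
      have "max 0 (t - d) < min \<tau> (t + d)" using t(1) d(1) \<tau> by auto
      then obtain q where q: "q \<in> \<rat>" "max 0 (t - d) < q" "q < min \<tau> (t + d)" using Rats_dense_in_real by blast
      have "dist (?f q) (?f t) < ?f t - \<epsilon>"
        using q by (intro d(2)) (auto simp: R_def dist_real_def abs_less_iff)
      then have "?f q > \<epsilon>" unfolding dist_real_def by linarith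
      with q show "\<exists>q\<in>\<rat> \<inter> {0..\<tau>}. cmod (Y q \<omega> - Am m q \<omega>) > \<epsilon>" by auto
    qed auto
    finally show ?thesis using \<omega>(1) by (simp add: Bm_def)
  qed
  have E_space: "Em m \<subseteq> space M" for m by (auto simp: Em_def sup_exceeds_def)
  have B_space: "Bm m \<subseteq> space M" for m by (auto simp: Bm_def)
  have E_sets: "Em m \<in> sets (completion M)" for m
  proof (rule sets_completionI[OF _ _ Z0])
    show "Em m = (Bm m - Z) \<union> (Em m \<inter> Z)" using EB E_space[of m] B_space[of m] by blast
  qed (use B_sets Z(3) in auto)
  then show "sup_exceeds M \<tau> X (approximant \<phi> \<psi> \<xi> \<eta> (N m) (K0 m) (K m)) \<epsilon> \<in> sets (completion M)"
    by (simp add: Em_def)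
  have le: "measure (completion M) (Em m) \<le> measure M (Bm m)" for m
  proof -
    interpret C: prob_space "completion M" by (rule prob_space_completion)
    have "measure (completion M) (Em m) \<le> measure (completion M) (Bm m \<union> Z)"
      using B_sets[of m] Z(3) EB E_space[of m] by (intro C.finite_measure_mono) blast+
    also have "\<dots> = measure M (Bm m \<union> Z)" using B_sets[of m] Z(3) by simp
    also have "\<dots> = measure M (Bm m)" using B_sets[of m] Z0 by (intro measure_Un_null_set)
    finally show ?thesis .
  qed
  have Blim: "(\<lambda>m. measure M (Bm m)) \<longlonglongrightarrow> 0"
  proof -
    have "(\<lambda>m. expectation (indicator (Bm m) :: 'a \<Rightarrow> real)) \<longlonglongrightarrow> expectation (\<lambda>_. 0)"
    proof (rule integral_dominated_convergence[where w="\<lambda>_. 1"])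
      show "AE \<omega> in M. (\<lambda>m. indicator (Bm m) \<omega> :: real) \<longlonglongrightarrow> 0"
        using good
      proof eventually_elim
        case (elim \<omega>)
        then have "\<forall>\<^sub>F m in sequentially. \<forall>t\<in>{-R..R}. dist (Am m t \<omega>) (Y t \<omega>) < \<epsilon>"
          using \<epsilon> by (auto simp: uniform_limit_iff)
        then have "\<forall>\<^sub>F m in sequentially. indicator (Bm m) \<omega> = (0::real)"
        proof eventually_elim
          case (elim m)
          have "cmod (Y q \<omega> - Am m q \<omega>) < \<epsilon>" if "q \<in> \<rat> \<inter> {0..\<tau>}" for q
          proof -
            have "q \<in> {-R..R}" using that by (auto simp: R_def)
            with elim show ?thesis by (simp add: dist_norm norm_minus_commute)
          qed
          then have "\<omega> \<notin> Bm m" by (fastforce simp: Bm_def)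
          then show ?case by simp
        qed
        then show ?case by (rule tendsto_eventually)
      qed
    qed (use B_sets in \<open>auto simp: indicator_def\<close>)
    then show ?thesis using B_sets B_space by (simp add: Int_absorb2)
  qed
  show "(\<lambda>m. measure (completion M)
        (sup_exceeds M \<tau> X (approximant \<phi> \<psi> \<xi> \<eta> (N m) (K0 m) (K m)) \<epsilon>)) \<longlonglongrightarrow> 0"
    unfolding Em_def[symmetric]
    by (rule tendsto_sandwich[OF _ _ tendsto_const Blim]) (use le in auto)
qed

section \<open>Deriving the locale assumptions from the hypotheses of the theorem\<close>

lemma has_sum_imp_LINT_CI:
  fixes f :: "int \<Rightarrow> real"
  assumes "(f has_sum s) UNIV" "\<And>k. 0 \<le> f k"
  shows "integrable CI f" "(LINT k|CI. f k) = s"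
proof -
  have "f summable_on UNIV" using assms(1) by (auto simp: summable_on_def)
  then have "(\<lambda>k. norm (f k)) summable_on UNIV" using assms(2) by simp
  then have a: "Infinite_Set_Sum.abs_summable_on f UNIV" using abs_summable_equivalent[of f UNIV] by simp
  then show "integrable CI f" by (simp add: abs_summable_on_def)
  have "(LINT k|CI. f k) = infsetsum f UNIV" by (simp add: infsetsum_def)
  also have "\<dots> = infsum f UNIV" by (rule infsetsum_infsum[OF a])
  also have "\<dots> = s" by (rule infsumI[OF assms(1)])
  finally show "(LINT k|CI. f k) = s" .
qed

lemma isCont_AE_eq:
  fixes f g :: "real \<Rightarrow> complex"
  assumes "isCont f x" "isCont g x" "AE y in lborel. f y = g y"
  shows "f x = g x"
proof (rule ccontr)
  assume "f x \<noteq> g x"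
  then have ne: "f x - g x \<noteq> 0" by simp
  have "isCont (\<lambda>y. f y - g y) x" using assms by (intro continuous_intros)
  then obtain d where d: "d > 0" "\<And>y. dist x y < d \<Longrightarrow> f y - g y \<noteq> 0"
    using continuous_at_avoid[of x "\<lambda>y. f y - g y" 0] ne by blast
  obtain y where "x < y" "y < x + d" "f y = g y" using AE_lborel_obtain[OF assms(3), of x "x + d"] d by auto
  then show False using d(2)[of y] by (auto simp: dist_real_def)
qed

text \<open>Points satisfying the almost everywhere bound lie arbitrarily close to \<open>x\<close>,
  and within distance 1 their bound is at most \<open>E 1 x\<close>; continuity of \<open>f\<close>
  does the rest. Since \<open>\<Phi>\<close> may jump, the bound at \<open>x\<close> itself need not
  be \<open>\<Phi> \<bar>x\<bar>\<close>.\<close>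

lemma (in envelope) bounded_everywhere:
  assumes f: "continuous_on UNIV f" and AE: "AE x in lborel. cmod (f x) \<le> \<Phi> \<bar>x\<bar>"
  shows "cmod (f x) \<le> E 1 x"
proof (rule ccontr)
  assume "\<not> cmod (f x) \<le> E 1 x"
  then have pos: "cmod (f x) - E 1 x > 0" by simp
  have "continuous_on UNIV (\<lambda>y. cmod (f y))" using f by (intro continuous_intros)
  then obtain d where d: "d > 0" "\<And>y. dist y x < d \<Longrightarrow> dist (cmod (f y)) (cmod (f x)) < cmod (f x) - E 1 x"
    unfolding continuous_on_iff using pos by (metis UNIV_I)
  obtain y where y: "x < y" "y < x + min d 1" "cmod (f y) \<le> \<Phi> \<bar>y\<bar>"
    using AE_lborel_obtain[OF AE, of x "x + min d 1"] d by auto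
  have "\<Phi> \<bar>y\<bar> \<le> E 1 x" unfolding E_def using y by (intro \<Phi>_le) auto
  moreover have "dist (cmod (f y)) (cmod (f x)) < cmod (f x) - E 1 x"
    using y by (intro d(2)) (auto simp: dist_real_def)
  ultimately show False using y unfolding dist_real_def by linarith
qed

text \<open>Interpolation with the bound \<open>B\<close>: writing \<open>\<Phi>\<close> as
  \<open>\<Phi>\<close> to the power \<open>\<gamma>\<close> times \<open>\<Phi>\<close> to the
  power \<open>1 - \<gamma>\<close>, the second factor is at most
  \<open>B powr (1 - \<gamma>)\<close>.\<close>

lemma envelope_of_assumption_S:
  assumes S: "assumption_S \<gamma> \<phi> \<psi> \<Phi>" and \<gamma>: "0 < \<gamma>" "\<gamma> < 1"
  shows "envelope \<Phi>"
proof
  from S obtain B where B: "\<And>x. x \<ge> 0 \<Longrightarrow> \<Phi> x \<le> B" and nn: "\<And>x. x \<ge> 0 \<Longrightarrow> 0 \<le> \<Phi> x"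
    and anti: "antimono_on {0..} \<Phi>" and int: "integrable lborel (\<lambda>x. \<Phi> \<bar>x\<bar> powr \<gamma>)"
    unfolding assumption_S_def by blast
  show "0 \<le> \<Phi> x" if "x \<ge> 0" for x using nn[OF that] .
  show "antimono_on {0..} \<Phi>" by fact
  have "mono (\<lambda>x. - \<Phi> (max 0 x))" using anti by (intro monoI) (auto simp: monotone_on_def)
  then have [measurable]: "(\<lambda>x. - \<Phi> (max 0 x)) \<in> borel_measurable borel" by (rule borel_measurable_mono)
  have "(\<lambda>x. - (- \<Phi> (max 0 \<bar>x\<bar>))) \<in> borel_measurable borel" by measurable
  then have [measurable]: "(\<lambda>x. \<Phi> \<bar>x\<bar>) \<in> borel_measurable borel" by simp
  show "integrable lborel (\<lambda>x. \<Phi> \<bar>x\<bar>)"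
  proof (rule Bochner_Integration.integrable_bound[OF integrable_mult_left[OF int, of "B powr (1 - \<gamma>)"]])
    have "\<Phi> \<bar>x\<bar> \<le> \<Phi> \<bar>x\<bar> powr \<gamma> * B powr (1 - \<gamma>)" for x
    proof -
      have "\<Phi> \<bar>x\<bar> = \<Phi> \<bar>x\<bar> powr \<gamma> * \<Phi> \<bar>x\<bar> powr (1 - \<gamma>)"
        using nn[of "\<bar>x\<bar>"] by (cases "\<Phi> \<bar>x\<bar> = 0") (simp_all add: powr_add[symmetric])
      also have "\<dots> \<le> \<Phi> \<bar>x\<bar> powr \<gamma> * B powr (1 - \<gamma>)"
        using nn[of "\<bar>x\<bar>"] B[of "\<bar>x\<bar>"] \<gamma> by (intro mult_left_mono powr_mono2) auto
      finally show ?thesis .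
    qed
    then show "AE x in lborel. norm (\<Phi> \<bar>x\<bar>) \<le> norm (\<Phi> \<bar>x\<bar> powr \<gamma> * B powr (1 - \<gamma>))"
      using nn by (intro AE_I2) (auto intro: order_trans[OF _ abs_ge_self])
  qed measurable
qed

text \<open>For \<open>|u| > 2\<close> the logarithm exceeds 1 because \<open>exp 1 < 3\<close>, so
  the weighted integrand dominates; on \<open>[-2, 2]\<close> the transform is bounded by the
  integral of \<open>norm (f x)\<close>.\<close>

lemma integrable_fourier_of_log_moment:
  assumes f: "integrable lborel f" and \<alpha>: "\<alpha> \<ge> 0"
    and log: "integrable lborel (\<lambda>u. ln (1 + \<bar>u\<bar>) powr \<alpha> * cmod (fourier f u))"
  shows "integrable lborel (fourier f)"
proof (rule Bochner_Integration.integrable_bound)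
  let ?C = "LINT x|lborel. norm (f x)"
  show "integrable lborel (\<lambda>u. ?C * indicator {-2..2} u + ln (1 + \<bar>u\<bar>) powr \<alpha> * cmod (fourier f u))"
    using log by simp
  have "cmod (fourier f u) \<le> ?C * indicator {-2..2} u + ln (1 + \<bar>u\<bar>) powr \<alpha> * cmod (fourier f u)" for u
  proof (cases "\<bar>u\<bar> \<le> 2")
    case True
    then have "u \<in> {-2..2}" by auto
    then show ?thesis using norm_fourier_le[OF f, of u] by (simp add: add_increasing2)
  next
    case False
    then have "exp 1 \<le> 1 + \<bar>u\<bar>" using e_less_272 by linarith
    then have "1 \<le> ln (1 + \<bar>u\<bar>)" by (simp add: ln_ge_iff)
    then have "1 \<le> ln (1 + \<bar>u\<bar>) powr \<alpha>" using \<alpha> by (rule ge_one_powr_ge_zero)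
    then have "1 * cmod (fourier f u) \<le> ln (1 + \<bar>u\<bar>) powr \<alpha> * cmod (fourier f u)" by (rule mult_right_mono) simp
    moreover have "0 \<le> ?C * indicator {-2..2} u" by (simp add: indicator_def)
    ultimately show ?thesis by linarith
  qed
  then show "AE u in lborel. norm (fourier f u) \<le> norm (?C * indicator {-2..2} u + ln (1 + \<bar>u\<bar>) powr \<alpha> * cmod (fourier f u))"
    by (intro AE_I2) (auto intro: order_trans[OF _ abs_ge_self])
qed (use fourier_measurable[OF f] in simp)

text \<open>The two wavelet predicates may use different representatives of the transform;
  integrability of \<open>\<phi>\<close> and \<open>\<psi>\<close> replaces all of them by the
  continuous ordinary transforms. The nonvanishing at the single point 0 transfers because the
  representative is continuous there.\<close>

lemma wavelet_pair_of_wavelets: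
  assumes env: "envelope \<Phi>" and fw: "f_wavelet \<phi>" and mw: "m_wavelet \<phi> \<psi>"
    and c: "continuous_on UNIV \<phi>" "continuous_on UNIV \<psi>"
    and b: "AE x in lborel. cmod (\<phi> x) \<le> \<Phi> \<bar>x\<bar>" "AE x in lborel. cmod (\<psi> x) \<le> \<Phi> \<bar>x\<bar>"
    and \<alpha>: "\<alpha> \<ge> 0"
    and log: "integrable lborel (\<lambda>u. ln (1 + \<bar>u\<bar>) powr \<alpha> * cmod (fourier \<phi> u))"
  obtains m0 where "wavelet_pair \<Phi> \<phi> \<psi> m0"
proof -
  interpret envelope \<Phi> by (rule env)
  have bd: "cmod (\<phi> x) \<le> E 1 x" "cmod (\<psi> x) \<le> E 1 x" for x
    using bounded_everywhere[OF c(1) b(1)] bounded_everywhere[OF c(2) b(2)] by auto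
  have [measurable]: "\<phi> \<in> borel_measurable borel" "\<psi> \<in> borel_measurable borel"
    using c by (auto intro: borel_measurable_continuous_onI)
  have i: "integrable lborel \<phi>" "integrable lborel \<psi>"
    by (auto intro!: Bochner_Integration.integrable_bound[OF E_integrable[of 1]] AE_I2 bd)
  obtain f1 where f1: "has_L2_fourier \<phi> f1" "f1 0 \<noteq> 0" "isCont f1 0"
    "AE y in lborel. ((\<lambda>k::int. (cmod (f1 (y + 2 * pi * of_int k)))\<^sup>2) has_sum 1) UNIV"
    using fw unfolding f_wavelet_def by blast
  obtain f2 m0 where f2: "has_L2_fourier \<phi> f2" "refinement_mask f2 m0"
    "has_L2_fourier \<psi> (\<lambda>y. cnj (m0 (y / 2 + pi)) * exp (- \<i> * of_real (y / 2)) * f2 (y / 2))"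
    using mw unfolding m_wavelet_def by blast
  have e1: "AE y in lborel. f1 y = fourier \<phi> y" by (rule has_L2_fourier_AE[OF f1(1) i(1)])
  have e2: "AE y in lborel. f2 y = fourier \<phi> y" by (rule has_L2_fourier_AE[OF f2(1) i(1)])
  have e2h: "AE y in lborel. f2 (y / 2) = fourier \<phi> (y / 2)"
    using AE_lborel_affine[OF e2, of "1/2" 0] by simp
  have "wavelet_pair \<Phi> \<phi> \<psi> m0"
  proof (intro wavelet_pair.intro wavelet_pair_axioms.intro env c bd)
    show "integrable lborel (fourier \<phi>)" by (rule integrable_fourier_of_log_moment[OF i(1) \<alpha> log])
    have "AE y in lborel. \<forall>k::int. f1 (2 * pi * of_int k + 1 * y) = fourier \<phi> (2 * pi * of_int k + 1 * y)"
      by (subst AE_all_countable) (auto intro!: AE_lborel_affine[OF e1, of 1, simplified])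
    with f1(4) show "AE y in lborel. integrable CI (\<lambda>k. (cmod (fourier \<phi> (y + 2 * pi * of_int k)))\<^sup>2) \<and>
        (LINT k|CI. (cmod (fourier \<phi> (y + 2 * pi * of_int k)))\<^sup>2) = 1"
    proof eventually_elim
      case (elim y)
      then have "((\<lambda>k::int. (cmod (fourier \<phi> (y + 2 * pi * of_int k)))\<^sup>2) has_sum 1) UNIV"
        by (simp add: add.commute)
      from has_sum_imp_LINT_CI[OF this] show ?case by simp
    qed
    have "f1 0 = fourier \<phi> 0"
      using continuous_fourier[OF i(1)] by (intro isCont_AE_eq[OF f1(3) _ e1]) (simp add: continuous_on_eq_continuous_at)
    then show "fourier \<phi> 0 \<noteq> 0" using f1(2) by simp
    show "m0 (y + 2 * pi) = m0 y" for y using f2(2) by (simp add: refinement_mask_def)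
    have "AE y in lborel. f2 y = m0 (y / 2) * f2 (y / 2)" using f2(2) by (simp add: refinement_mask_def)
    with e2 e2h show "AE y in lborel. fourier \<phi> y = m0 (y / 2) * fourier \<phi> (y / 2)"
      by eventually_elim simp
    from has_L2_fourier_AE[OF f2(3) i(2)] e2h
    show "AE y in lborel. fourier \<psi> y = cnj (m0 (y / 2 + pi)) * exp (- \<i> * of_real (y / 2)) * fourier \<phi> (y / 2)"
      by eventually_elim simp
  qed
  then show ?thesis by (rule that)
qed

text \<open>For \<open>j >= 1\<close> one has \<open>sqrt (j + 1) <= 2 * j^(1/2) <= 2 * j^p\<close>.
  Index 0 stays out of the comparison, since \<open>0 powr p\<close> is 0 while
  \<open>sqrt (0 + 1)\<close> is 1.\<close>

lemma summable_sqrt_weight: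
  fixes a :: "nat \<Rightarrow> real"
  assumes s: "summable (\<lambda>j. a j * real j powr p)" and p: "p > 1/2" and a: "\<And>j. a j \<ge> 0"
  shows "summable (\<lambda>j. a j * sqrt (real j + 1))"
proof (rule summable_comparison_test[OF _ summable_mult[OF s, of 2]], intro exI[of _ 1] allI impI)
  fix j :: nat assume j: "j \<ge> 1"
  have "sqrt (real j + 1) \<le> sqrt (4 * real j)" using j by (intro real_sqrt_le_mono) simp
  also have "\<dots> = 2 * real j powr (1/2)" using j by (simp add: real_sqrt_mult powr_half_sqrt)
  also have "\<dots> \<le> 2 * real j powr p" using j p by (intro mult_left_mono powr_mono) auto
  finally have "a j * sqrt (real j + 1) \<le> a j * (2 * real j powr p)" using a by (rule mult_left_mono)
  then show "norm (a j * sqrt (real j + 1)) \<le> 2 * (a j * real j powr p)" using a[of j] by (simp add: abs_mult mult_ac)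
qed

theorem theorem3:
  fixes M :: "'w measure"
    and X :: "real \<Rightarrow> 'w \<Rightarrow> complex"
    and \<phi> \<psi> :: "real \<Rightarrow> complex"
    and \<Phi> c A :: "real \<Rightarrow> real"
    and \<gamma> \<alpha> a0 x0 b0 :: real
    and cj :: "nat \<Rightarrow> real"
    and \<xi> :: "int \<Rightarrow> 'w \<Rightarrow> complex"
    and \<eta> :: "nat \<Rightarrow> int \<Rightarrow> 'w \<Rightarrow> complex"
    and N K0 :: "nat \<Rightarrow> nat"
    and K :: "nat \<Rightarrow> nat \<Rightarrow> nat"
    and T \<epsilon> :: real
  assumes "prob_space M"
    and "f_wavelet \<phi>" and "m_wavelet \<phi> \<psi>"
    and "continuous_on UNIV \<phi>" and "continuous_on UNIV \<psi>"
    and "gaussian_process M X" and "separable_process M X"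
    and "\<And>t. (LINT \<omega>|M. X t \<omega>) = 0"
    and "\<And>t. integrable M (\<lambda>\<omega>. (cmod (X t \<omega>))\<^sup>2)"
    and "continuous_on UNIV (\<lambda>(t, s). covariance M X t s)"
    and "\<And>k. has_ms_integral M (\<lambda>t \<omega>. X t \<omega> * cnj (dilate \<phi> 0 k t)) (\<xi> k)"
    and "\<And>j k. has_ms_integral M (\<lambda>t \<omega>. X t \<omega> * cnj (dilate \<psi> (int j) k t)) (\<eta> j k)"
    and "0 < \<gamma>" and "\<gamma> < 1"
    and "assumption_S \<gamma> \<phi> \<psi> \<Phi>"
    and "\<And>x. c (- x) = c x" and "mono_on {0..} c" and "c 0 > 0"
    and "\<And>a. a > 0 \<Longrightarrow> A a > 0" and "a0 > 0" and "x0 > 0"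
    and "\<And>a x. a \<ge> a0 \<Longrightarrow> x \<ge> x0 \<Longrightarrow> c (a * x) \<le> c x * A a"
    and "integrable lborel (\<lambda>x. c x * \<Phi> \<bar>x\<bar>)"
    and "\<And>t. sqrt (cmod (covariance M X t t)) \<le> c t"
    and "\<alpha> > 1 / (2 * (1 - \<gamma>))"
    and "integrable lborel (\<lambda>u. ln (1 + \<bar>u\<bar>) powr \<alpha> * cmod (fourier \<psi> u))"
    and "integrable lborel (\<lambda>u. ln (1 + \<bar>u\<bar>) powr \<alpha> * cmod (fourier \<phi> u))"
    and "\<And>k. (LINT \<omega>|M. (cmod (\<xi> k \<omega>))\<^sup>2) \<le> b0"
    and "\<And>j k. (LINT \<omega>|M. (cmod (\<eta> j k \<omega>))\<^sup>2) \<le> cj j"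
    and "summable (\<lambda>j. sqrt (cj j) * 2 powr (real j / 2) * real j powr (\<alpha> * (1 - \<gamma>)))"
    and "filterlim N at_top sequentially" and "filterlim K0 at_top sequentially"
    and "\<And>j. filterlim (\<lambda>m. K m j) at_top sequentially"
    and "T > 0" and "\<epsilon> > 0"
  shows "(\<forall>m. sup_exceeds M T X (approximant \<phi> \<psi> \<xi> \<eta> (N m) (K0 m) (K m)) \<epsilon> \<in> sets (completion M)) \<and>
    (\<lambda>m. measure (completion M)
        (sup_exceeds M T X (approximant \<phi> \<psi> \<xi> \<eta> (N m) (K0 m) (K m)) \<epsilon>)) \<longlonglongrightarrow> 0"
proof -
  note a = assms
  have \<alpha>: "\<alpha> * (1 - \<gamma>) > 1/2" "\<alpha> \<ge> 0"
  proof -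
    have "1 / (2 * (1 - \<gamma>)) > 0" using a(14) by simp
    then show "\<alpha> \<ge> 0" using a(25) by linarith
    show "\<alpha> * (1 - \<gamma>) > 1/2" using a(25) a(14) by (simp add: field_simps)
  qed
  have env: "envelope \<Phi>" by (rule envelope_of_assumption_S[OF a(15,13,14)])
  have b: "AE x in lborel. cmod (\<phi> x) \<le> \<Phi> \<bar>x\<bar>" "AE x in lborel. cmod (\<psi> x) \<le> \<Phi> \<bar>x\<bar>"
    using a(15) by (auto simp: assumption_S_def)
  obtain m0 where wp: "wavelet_pair \<Phi> \<phi> \<psi> m0"
    by (rule wavelet_pair_of_wavelets[OF env a(2-5) b \<alpha>(2) a(27)])
  have we: "weighted_envelope \<Phi> c A a0 x0"
    by (intro weighted_envelope.intro weighted_envelope_axioms.intro env) (fact a)+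
  have gp: "gaussian_L2_process M X"
    by (intro gaussian_L2_process.intro gaussian_L2_process_axioms.intro) (fact a)+
  interpret prob_space M by (rule a(1))
  have cj: "cj j \<ge> 0" for j
    by (rule order_trans[OF _ a(29)[of j 0]]) simp
  have sm: "summable (\<lambda>j. sqrt (cj j) * 2 powr (real j / 2) * sqrt (real j + 1))"
    by (rule summable_sqrt_weight[OF a(30) \<alpha>(1)]) (simp add: cj)
  have "wavelet_expansion \<Phi> \<phi> \<psi> m0 c A a0 x0 M X \<xi> \<eta> b0 cj"
    by (intro wavelet_expansion.intro wavelet_process.intro weighted_wavelet_pair.intro wp we gp
        wavelet_expansion_axioms.intro sm) (fact a)+
  then interpret wavelet_expansion \<Phi> \<phi> \<psi> m0 c A a0 x0 M X \<xi> \<eta> b0 cj .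
  show ?thesis
    using convergence_in_probability[where K=K, OF a(7,31,32,33,34,35)] by blast
qed

end
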